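(* Let $R$ be a reduced commutative noetherian ring, let $M$ be a finite $R$-module of rank $k$ (that is, $M_{\mathfrak q}$ has dimension $k$ over $R_{\mathfrak q}$ for each minimal prime $\mathfrak q$ of $R$), and let $d$ be an integer. Let $Z \subseteq \operatorname{Spec} R$ be the closed subscheme defined by the ideal $\mathrm{Fitt}_{(-1)^{d-1}k}^{d-1}(M)$. Then $$ \operatorname{Supp} Z = \{ \mathfrak{p} \in \operatorname{Spec} R \mid \mathrm{pd}(M_\mathfrak{p}) \geq d \}. $$
   Context: $\mathrm{pd}(M_{\mathfrak p})$ is the projective dimension of $M_{\mathfrak p}$ over $R_{\mathfrak p}$. For a map $\phi$ of free $R$-modules of finite rank, $I_m(\phi)$ is the ideal generated by the $m\times m$ minors of $\phi$, with $I_m(\phi)=R$ for $m\le 0$ and $I_m(\phi)=0$ if $m$ exceeds the rank of the source or target. Higher Fitting ideals of a module: choose a resolution $\cdots\to F_2\xrightarrow{d_2}F_1\xrightarrow{d_1}F_0\to M\to 0$ by free $R$-modules of finite rank, regarded as a chain complex $F_\bullet$ with $F_i=0$ for $i<0$ and differentials $d_i:F_i\to F_{i-1}$. Set $r_j=\mathrm{rank}\,F_j$ and $\chi_i=\sum_{j=0}^{i-1}(-1)^{i-j-1}r_j=r_{i-1}-r_{i-2}+\cdots+(-1)^{i-1}r_0$ (the empty sum being $0$), and define $\mathrm{Fitt}^i_m(M)=I_{\chi_i-m}(d_i)$ for $i,m\in\mathbb Z$. This is independent of the chosen resolution; for $i=1$ it is the classical Fitting ideal $\mathrm{Fitt}_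m(M)$.
   Formalization: The upper index of the Fitting ideal is d instead of d-1, and d is required to be at least 1; as printed the claim fails for R = Z, M = Z/2, k = 0, p = (2), both at d = 1 (the ideal is R, but pd = 1) and at d = 0. *)

theory Defs
  imports
    "HOL-Algebra.Ring_Divisibility"
    "HOL-Combinatorics.Permutations"
    "HOL-Library.Extended_Nat"
    "Jordan_Normal_Form.Missing_VectorSpace"
begin

section \<open>Spectrum, reduced rings, localization\<close>

definition Spec :: "'a ring \<Rightarrow> 'a set set" where
  "Spec R = {\<pp>. primeideal \<pp> R}"

definition minimal_primes :: "'a ring \<Rightarrow> 'a set set" where
  "minimal_primes R = {\<qq> \<in> Spec R. \<forall>\<pp>\<in>Spec R. \<pp> \<subseteq> \<qq> \<longrightarrow> \<pp> = \<qq>}"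

text \<open>The support of the closed subscheme defined by an ideal \<open>I\<close>, i.e. \<open>V(I)\<close>.\<close>

definition zero_locus :: "'a ring \<Rightarrow> 'a set \<Rightarrow> 'a set set" where
  "zero_locus R I = {\<pp> \<in> Spec R. I \<subseteq> \<pp>}"

definition reduced_ring :: "'a ring \<Rightarrow> bool" where
  "reduced_ring R \<longleftrightarrow>
     (\<forall>x\<in>carrier R. \<forall>n::nat. x [^]\<^bsub>R\<^esub> n = \<zero>\<^bsub>R\<^esub> \<longrightarrow> x = \<zero>\<^bsub>R\<^esub>)"

text \<open>A fraction with denominator in the multiplicative set \<open>S\<close> is the equivalence class of
  pairs (numerator, denominator). The operations on classes are unions over all pairs of
  representatives; by well-definedness every member of such a union is the same class.\<close>

definition ring_frac :: "'a ring \<Rightarrow> 'a set \<Rightarrow> 'a \<Rightarrow> 'a \<Rightarrow> ('a \<times> 'a) set" where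
  "ring_frac R S a s =
     {(b, t). b \<in> carrier R \<and> t \<in> S \<and>
        (\<exists>u\<in>S. u \<otimes>\<^bsub>R\<^esub> (t \<otimes>\<^bsub>R\<^esub> a) = u \<otimes>\<^bsub>R\<^esub> (s \<otimes>\<^bsub>R\<^esub> b))}"

definition localize_ring :: "'a ring \<Rightarrow> 'a set \<Rightarrow> ('a \<times> 'a) set ring" where
  "localize_ring R S =
    \<lparr>carrier = {ring_frac R S a s | a s. a \<in> carrier R \<and> s \<in> S},
     mult = (\<lambda>X Y. \<Union>(a, s)\<in>X. \<Union>(b, t)\<in>Y. ring_frac R S (a \<otimes>\<^bsub>R\<^esub> b) (s \<otimes>\<^bsub>R\<^esub> t)),
     one = ring_frac R S \<one>\<^bsub>R\<^esub> \<one>\<^bsub>R\<^esub>,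
     zero = ring_frac R S \<zero>\<^bsub>R\<^esub> \<one>\<^bsub>R\<^esub>,
     add = (\<lambda>X Y. \<Union>(a, s)\<in>X. \<Union>(b, t)\<in>Y.
       ring_frac R S ((t \<otimes>\<^bsub>R\<^esub> a) \<oplus>\<^bsub>R\<^esub> (s \<otimes>\<^bsub>R\<^esub> b)) (s \<otimes>\<^bsub>R\<^esub> t))\<rparr>"

definition module_frac ::
  "'a ring \<Rightarrow> ('a, 'b) module \<Rightarrow> 'a set \<Rightarrow> 'b \<Rightarrow> 'a \<Rightarrow> ('b \<times> 'a) set" where
  "module_frac R M S x s =
     {(y, t). y \<in> carrier M \<and> t \<in> S \<and>
        (\<exists>u\<in>S. u \<odot>\<^bsub>M\<^esub> (t \<odot>\<^bsub>M\<^esub> x) = u \<odot>\<^bsub>M\<^esub> (s \<odot>\<^bsub>M\<^esub> y))}"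

text \<open>The fields \<open>mult\<close> and \<open>one\<close> of a module record carry no information.\<close>

definition localize_module ::
  "'a ring \<Rightarrow> ('a, 'b) module \<Rightarrow> 'a set \<Rightarrow> (('a \<times> 'a) set, ('b \<times> 'a) set) module" where
  "localize_module R M S =
    \<lparr>carrier = {module_frac R M S x s | x s. x \<in> carrier M \<and> s \<in> S},
     mult = (\<lambda>_ _. undefined),
     one = undefined,
     zero = module_frac R M S \<zero>\<^bsub>M\<^esub> \<one>\<^bsub>R\<^esub>,
     add = (\<lambda>X Y. \<Union>(x, s)\<in>X. \<Union>(y, t)\<in>Y.
       module_frac R M S ((t \<odot>\<^bsub>M\<^esub> x) \<oplus>\<^bsub>M\<^esub> (s \<odot>\<^bsub>M\<^esub> y)) (s \<otimes>\<^bsub>R\<^esub> t)),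
     smult = (\<lambda>A X. \<Union>(a, s)\<in>A. \<Union>(x, t)\<in>X. module_frac R M S (a \<odot>\<^bsub>M\<^esub> x) (s \<otimes>\<^bsub>R\<^esub> t))\<rparr>"

definition ring_at :: "'a ring \<Rightarrow> 'a set \<Rightarrow> ('a \<times> 'a) set ring" where
  "ring_at R \<pp> = localize_ring R (carrier R - \<pp>)"

definition module_at ::
  "'a ring \<Rightarrow> ('a, 'b) module \<Rightarrow> 'a set \<Rightarrow> (('a \<times> 'a) set, ('b \<times> 'a) set) module" where
  "module_at R M \<pp> = localize_module R M (carrier R - \<pp>)"


section \<open>Finite modules and their rank\<close>

definition finite_module :: "'a ring \<Rightarrow> ('a, 'b) module \<Rightarrow> bool" where
  "finite_module R M \<longleftrightarrow>
     (\<exists>A. finite A \<and> A \<subseteq> carrier M \<and> LinearCombinations.module.span R M A = carrier M)"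

definition has_rank :: "'a ring \<Rightarrow> ('a, 'b) module \<Rightarrow> nat \<Rightarrow> bool" where
  "has_rank R M k \<longleftrightarrow>
     (\<forall>\<qq>\<in>minimal_primes R.
        vectorspace.fin_dim (ring_at R \<qq>) (module_at R M \<qq>) \<and>
        vectorspace.dim (ring_at R \<qq>) (module_at R M \<qq>) = k)"


section \<open>Free and projective modules, projective dimension\<close>

text \<open>The free module on the set \<open>X\<close>: finitely supported families of scalars indexed by \<open>X\<close>.\<close>

definition free_module :: "'a ring \<Rightarrow> 'x set \<Rightarrow> ('a, 'x \<Rightarrow> 'a) module" where
  "free_module R X = (ring.func_space R X)
     \<lparr>carrier := {f \<in> X \<rightarrow>\<^sub>E carrier R. finite {x \<in> X. f x \<noteq> \<zero>\<^bsub>R\<^esub>}}\<rparr>"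

text \<open>Projective means being a direct summand of a free module. Taking the index set \<open>X\<close> among
  the subsets of the element type of \<open>P\<close> is no restriction, since \<open>X = carrier P\<close> always
  suffices for a projective \<open>P\<close>.\<close>

definition projective_module :: "'a ring \<Rightarrow> ('a, 'b) module \<Rightarrow> bool" where
  "projective_module R P \<longleftrightarrow> module R P \<and>
     (\<exists>(X :: 'b set) \<iota> \<pi>.
        \<iota> \<in> module_hom R P (free_module R X) \<and>
        \<pi> \<in> module_hom R (free_module R X) P \<and>
        (\<forall>x\<in>carrier P. \<pi> (\<iota> x) = x))"

definition exact_at ::
  "('a, 'b) module \<Rightarrow> ('b \<Rightarrow> 'c) \<Rightarrow> ('a, 'c) module \<Rightarrow> ('c \<Rightarrow> 'd) \<Rightarrow> ('a, 'd) module \<Rightarrow> bool" where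
  "exact_at A f B g C \<longleftrightarrow> f ` carrier A = {x \<in> carrier B. g x = \<zero>\<^bsub>C\<^esub>}"

text \<open>Here \<open>\<delta> i\<close> is the differential from \<open>P (i + 1)\<close> to \<open>P i\<close>.\<close>

definition projective_resolution ::
  "'a ring \<Rightarrow> ('a, 'b) module \<Rightarrow> (nat \<Rightarrow> ('a, 'p) module) \<Rightarrow> (nat \<Rightarrow> 'p \<Rightarrow> 'p) \<Rightarrow> ('p \<Rightarrow> 'b) \<Rightarrow> bool"
where
  "projective_resolution R N P \<delta> \<epsilon> \<longleftrightarrow>
     (\<forall>i. projective_module R (P i)) \<and>
     (\<forall>i. \<delta> i \<in> module_hom R (P (Suc i)) (P i)) \<and>
     \<epsilon> \<in> module_hom R (P 0) N \<and>
     \<epsilon> ` carrier (P 0) = carrier N \<and>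
     exact_at (P 1) (\<delta> 0) (P 0) \<epsilon> N \<and>
     (\<forall>i. exact_at (P (Suc (Suc i))) (\<delta> (Suc i)) (P (Suc i)) (\<delta> i) (P i))"

text \<open>The projective dimension is the least length of a projective resolution, and \<open>\<infinity>\<close>
  (the infimum of the empty set) if no finite one exists; the zero module gets the value 0.
  HOL forces a fixed element type for the modules \<open>P i\<close>. The one chosen is large enough for any
  module \<open>N\<close> with elements in \<open>'b\<close>: the index type \<open>nat \<times> 'b \<times> 'a\<close> is infinite and at least as
  large as \<open>N\<close> and the ring, so it indexes generators of \<open>N\<close> and of all syzygies, and a projective
  syzygy is a submodule of such a free module.\<close>

definition proj_dim :: "'a ring \<Rightarrow> ('a, 'b) module \<Rightarrow> enat" where
  "proj_dim R N = Inf {enat n | n.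
     \<exists>(P :: nat \<Rightarrow> ('a, nat \<times> 'b \<times> 'a \<Rightarrow> 'a) module) \<delta> \<epsilon>.
       projective_resolution R N P \<delta> \<epsilon> \<and> (\<forall>i>n. carrier (P i) = {\<zero>\<^bsub>P i\<^esub>})}"


section \<open>Ideals of minors and higher Fitting ideals\<close>

definition std_free :: "'a ring \<Rightarrow> nat \<Rightarrow> ('a, nat \<Rightarrow> 'a) module" where
  "std_free R n = free_module R {..<n}"

definition std_basis :: "'a ring \<Rightarrow> nat \<Rightarrow> nat \<Rightarrow> nat \<Rightarrow> 'a" where
  "std_basis R n j = (\<lambda>i\<in>{..<n}. if i = j then \<one>\<^bsub>R\<^esub> else \<zero>\<^bsub>R\<^esub>)"

definition ring_det :: "'a ring \<Rightarrow> nat \<Rightarrow> (nat \<Rightarrow> nat \<Rightarrow> 'a) \<Rightarrow> 'a" where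
  "ring_det R m A =
     (\<Oplus>\<^bsub>R\<^esub>\<sigma>\<in>{\<sigma>. \<sigma> permutes {..<m}}.
        (if evenperm \<sigma> then \<one>\<^bsub>R\<^esub> else \<ominus>\<^bsub>R\<^esub> \<one>\<^bsub>R\<^esub>) \<otimes>\<^bsub>R\<^esub> (\<Otimes>\<^bsub>R\<^esub>i\<in>{..<m}. A i (\<sigma> i)))"

text \<open>The ideal \<open>I\<^sub>m(\<phi>)\<close> of a map \<open>\<phi>\<close> from \<open>R\<^sup>n\<close> to \<open>R\<^sup>l\<close>; \<open>f\<close> selects the rows and \<open>g\<close> the
  columns of a minor. If \<open>m\<close> exceeds \<open>n\<close> or \<open>l\<close> there are no such selections and the ideal is
  generated by the empty set, hence zero.\<close>

definition minors_ideal ::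
  "'a ring \<Rightarrow> nat \<Rightarrow> nat \<Rightarrow> ((nat \<Rightarrow> 'a) \<Rightarrow> nat \<Rightarrow> 'a) \<Rightarrow> int \<Rightarrow> 'a set" where
  "minors_ideal R n l \<phi> m =
     (if m \<le> 0 then carrier R
      else genideal R
        {ring_det R (nat m) (\<lambda>i j. \<phi> (std_basis R n (g j)) (f i)) | f g.
           strict_mono_on {..<nat m} f \<and> f ` {..<nat m} \<subseteq> {..<l} \<and>
           strict_mono_on {..<nat m} g \<and> g ` {..<nat m} \<subseteq> {..<n}})"

text \<open>A resolution of \<open>M\<close> by the free modules \<open>R\<^bsup>r i\<^esup>\<close>, as a complex indexed by the integers with
  differentials \<open>\<delta> i\<close> from degree \<open>i\<close> to degree \<open>i - 1\<close> and augmentation \<open>\<epsilon>\<close>.\<close>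

definition finite_free_resolution ::
  "'a ring \<Rightarrow> ('a, 'b) module \<Rightarrow> (int \<Rightarrow> nat) \<Rightarrow> (int \<Rightarrow> (nat \<Rightarrow> 'a) \<Rightarrow> nat \<Rightarrow> 'a) \<Rightarrow>
     ((nat \<Rightarrow> 'a) \<Rightarrow> 'b) \<Rightarrow> bool" where
  "finite_free_resolution R M r \<delta> \<epsilon> \<longleftrightarrow>
     (\<forall>i<0. r i = 0) \<and>
     (\<forall>i. \<delta> i \<in> module_hom R (std_free R (r i)) (std_free R (r (i - 1)))) \<and>
     \<epsilon> \<in> module_hom R (std_free R (r 0)) M \<and>
     \<epsilon> ` carrier (std_free R (r 0)) = carrier M \<and>
     exact_at (std_free R (r 1)) (\<delta> 1) (std_free R (r 0)) \<epsilon> M \<and>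
     (\<forall>i\<ge>1. exact_at (std_free R (r (i + 1))) (\<delta> (i + 1)) (std_free R (r i)) (\<delta> i)
        (std_free R (r (i - 1))))"

definition fitting_chi :: "(int \<Rightarrow> nat) \<Rightarrow> int \<Rightarrow> int" where
  "fitting_chi r i = (\<Sum>j\<in>{0..i - 1}. (- 1) ^ nat (i - j - 1) * int (r j))"

text \<open>\<open>higher_fitting R M i m\<close> has \<open>i\<close> as the upper and \<open>m\<close> as the lower index. It is independent
  of the chosen resolution, and one exists if \<open>R\<close> is noetherian and \<open>M\<close> is finite.\<close>

definition higher_fitting :: "'a ring \<Rightarrow> ('a, 'b) module \<Rightarrow> int \<Rightarrow> int \<Rightarrow> 'a set" where
  "higher_fitting R M i m =
     (let (r, \<delta>) = (SOME (r, \<delta>). \<exists>\<epsilon>. finite_free_resolution R M r \<delta> \<epsilon>)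
      in minors_ideal R (r i) (r (i - 1)) (\<delta> i) (fitting_chi r i - m))"

end

theory Submission
  imports Defs "Jordan_Normal_Form.Determinant" "HOL-Library.Poly_Mapping" "HOL-Algebra.QuotRing"
begin

text \<open>Rank-nullity in the localized resolutions shows that \<open>\<delta>\<^sub>d\<close> has the same rank
  \<open>\<mu> = \<chi>\<^sub>d - (-1)\<^sup>d\<^sup>-\<^sup>1 k\<close> at every minimal prime, so that, \<open>R\<close> being reduced, all larger minors of
  \<open>\<delta>\<^sub>d\<close> vanish. If some \<open>\<mu>\<close>-minor is a unit at \<open>\<pp>\<close>, Cramer's rule splits the localization of
  \<open>F\<^sub>d\<^sub>-\<^sub>1\<close> into the image of \<open>\<delta>\<^sub>d\<close> and a free complement, and the resolution can be truncated to length
  \<open>d - 1\<close>. Conversely, comparing the localized resolution with a projective one of length less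
  than \<open>d\<close> gives a map \<open>h\<close> with \<open>\<delta>\<^sub>d h \<delta>\<^sub>d = \<delta>\<^sub>d\<close>. The ranks of \<open>\<delta>\<^sub>d\<close> and \<open>1 - \<delta>\<^sub>d h\<close> then have the
  same sum at \<open>\<pp>\<close> as at a minimal prime below it, and neither can grow under specialization, so \<open>\<delta>\<^sub>d\<close>
  still has rank \<open>\<mu>\<close> at \<open>\<pp>\<close> and a \<open>\<mu>\<close>-minor lies outside \<open>\<pp>\<close>.\<close>

section \<open>Determinants over a commutative ring\<close>

text \<open>The comparison of projective resolutions lives over R_p, whereas ranks are compared over
  two fields that receive R: the localization at a minimal prime q below p, and the residue field of
  p. Clearing denominators bridges the gap: \<open>A H A = s A\<close> is obtained over R itself
  with s outside p, so that s is invertible in both fields. There s - A H has kernel exactly the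
  image of A, which explains the constant sum. Ranks cannot grow because they are read off minors
  over R: a minor that is nonzero modulo p is nonzero modulo q. Hence only the kernels of the two
  maps out of R matter. In the other direction, the vanishing minors are those with increasing rows
  and columns, while Cramer's rule asks for bordered minors, whose additional row and column stand
  last; sorting with signs connects the two. The rule holds over any commutative ring with an
  invertible minor, so locality of R_p never enters. Applied over a field, the same splitting
  identifies the rank with the size of the largest nonzero minor.\<close>

text \<open>The library proves its determinant identities for type-class rings. They are transported to
  an arbitrary commutative ring \<open>R\<close> along evaluation homomorphisms out of the
  polynomial ring \<open>\<int>[x\<^sub>a]\<close>, realized as the monoid ring of the multisets of variables.\<close>

definition monom_eval :: "('a, 'z) ring_scheme \<Rightarrow> 'a multiset \<Rightarrow> 'a" where
  "monom_eval R M = (\<Otimes>\<^bsub>R\<^esub>a\<in>set_mset M. a [^]\<^bsub>R\<^esub> count M a)"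

text \<open>The variables are indexed by the whole type \<open>'a\<close>, not by the carrier.
  Dropping every monomial with a variable outside the carrier amounts to sending those variables to
  zero. So evaluation is multiplicative and closed on all polynomials, without side
  conditions.\<close>

definition poly_eval :: "('a, 'z) ring_scheme \<Rightarrow> ('a multiset \<Rightarrow>\<^sub>0 int) \<Rightarrow> 'a" where
  "poly_eval R p = (\<Oplus>\<^bsub>R\<^esub>M\<in>{M \<in> Poly_Mapping.keys p. set_mset M \<subseteq> carrier R}.
     add_pow R (Poly_Mapping.lookup p M) (monom_eval R M))"

context cring
begin

lemma monom_eval_superset:
  assumes "finite F" "set_mset M \<subseteq> F" "F \<subseteq> carrier R"
  shows "monom_eval R M = (\<Otimes>a\<in>F. a [^] count M a)"
  unfolding monom_eval_def using assms
  by (intro finprod_mono_neutral_cong_left) (auto simp: not_in_iff)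

lemma monom_eval_closed:
  assumes "set_mset M \<subseteq> carrier R"
  shows "monom_eval R M \<in> carrier R"
  unfolding monom_eval_def using assms by (intro finprod_closed) auto

lemma monom_eval_add:
  assumes "set_mset M \<subseteq> carrier R" "set_mset N \<subseteq> carrier R"
  shows "monom_eval R (M + N) = monom_eval R M \<otimes> monom_eval R N"
proof -
  let ?F = "set_mset M \<union> set_mset N"
  have F: "finite ?F" "?F \<subseteq> carrier R" using assms by auto
  have "monom_eval R (M + N) = (\<Otimes>a\<in>?F. a [^] count (M + N) a)"
    using F by (intro monom_eval_superset) auto
  also have "\<dots> = (\<Otimes>a\<in>?F. a [^] count M a \<otimes> a [^] count N a)"
    using F by (intro finprod_cong') (auto simp: nat_pow_mult)
  also have "\<dots> = (\<Otimes>a\<in>?F. a [^] count M a) \<otimes> (\<Otimes>a\<in>?F. a [^] count N a)"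
    using F by (intro finprod_multf) auto
  also have "\<dots> = monom_eval R M \<otimes> monom_eval R N"
    using F by (simp add: monom_eval_superset[of ?F])
  finally show ?thesis .
qed

lemma poly_eval_superset:
  assumes "finite F" "{M \<in> Poly_Mapping.keys p. set_mset M \<subseteq> carrier R} \<subseteq> F" "\<And>M. M \<in> F \<Longrightarrow> set_mset M \<subseteq> carrier R"
  shows "poly_eval R p = (\<Oplus>M\<in>F. add_pow R (Poly_Mapping.lookup p M) (monom_eval R M))"
  unfolding poly_eval_def using assms
proof (intro add.finprod_mono_neutral_cong_left)
  have "add_pow R (0 :: int) x = \<zero>" for x
    by (simp add: add_pow_def)
  then show "add_pow R (Poly_Mapping.lookup p M) (monom_eval R M) = \<zero>"
    if "M \<in> F - {M \<in> Poly_Mapping.keys p. set_mset M \<subseteq> carrier R}" for M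
    using that assms(3) by (auto simp: in_keys_iff)
qed (auto simp: monom_eval_closed)

lemma poly_eval_closed: "poly_eval R p \<in> carrier R"
  unfolding poly_eval_def by (intro finsum_closed) (auto simp: monom_eval_closed)

lemma poly_eval_zero: "poly_eval R 0 = \<zero>"
  by (simp add: poly_eval_def)

lemma poly_eval_frag_of:
  "set_mset M \<subseteq> carrier R \<Longrightarrow> poly_eval R (frag_of M) = monom_eval R M"
  by (subst poly_eval_superset[of "{M}"]) (auto simp: keys_frag_of monom_eval_closed)

lemma poly_eval_frag_of_outside:
  "\<not> set_mset M \<subseteq> carrier R \<Longrightarrow> poly_eval R (frag_of M) = \<zero>"
  by (subst poly_eval_superset[of "{}"]) (auto simp: keys_frag_of monom_eval_closed)

lemma poly_eval_add: "poly_eval R (p + q) = poly_eval R p \<oplus> poly_eval R q"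
proof -
  let ?F = "{M \<in> Poly_Mapping.keys p \<union> Poly_Mapping.keys q. set_mset M \<subseteq> carrier R}"
  have "poly_eval R (p + q) = (\<Oplus>M\<in>?F. add_pow R (Poly_Mapping.lookup (p + q) M) (monom_eval R M))"
  proof (rule poly_eval_superset)
    show "{M \<in> Poly_Mapping.keys (p + q). set_mset M \<subseteq> carrier R} \<subseteq> ?F"
      using Poly_Mapping.keys_add[of p q] by blast
  qed auto
  also have "\<dots> = (\<Oplus>M\<in>?F. add_pow R (Poly_Mapping.lookup p M) (monom_eval R M)
      \<oplus> add_pow R (Poly_Mapping.lookup q M) (monom_eval R M))"
  proof (intro add.finprod_cong')
    show "add_pow R (Poly_Mapping.lookup (p + q) M) (monom_eval R M) =
        add_pow R (Poly_Mapping.lookup p M) (monom_eval R M)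
        \<oplus> add_pow R (Poly_Mapping.lookup q M) (monom_eval R M)" if "M \<in> ?F" for M
      unfolding lookup_add using that
      by (intro add.int_pow_mult monom_eval_closed) simp
  qed (auto simp: monom_eval_closed)
  also have "\<dots> = (\<Oplus>M\<in>?F. add_pow R (Poly_Mapping.lookup p M) (monom_eval R M))
      \<oplus> (\<Oplus>M\<in>?F. add_pow R (Poly_Mapping.lookup q M) (monom_eval R M))"
    by (intro add.finprod_multf) (auto simp: monom_eval_closed)
  also have "(\<Oplus>M\<in>?F. add_pow R (Poly_Mapping.lookup p M) (monom_eval R M)) = poly_eval R p"
    by (rule poly_eval_superset[symmetric]) auto
  also have "(\<Oplus>M\<in>?F. add_pow R (Poly_Mapping.lookup q M) (monom_eval R M)) = poly_eval R q"
    by (rule poly_eval_superset[symmetric]) auto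
  finally show ?thesis .
qed

lemma poly_eval_diff: "poly_eval R (p - q) = poly_eval R p \<ominus> poly_eval R q"
proof -
  have "poly_eval R p = poly_eval R (p - q) \<oplus> poly_eval R q"
    by (metis poly_eval_add diff_add_cancel)
  then show ?thesis
    by (metis a_minus_def add.inv_solve_right poly_eval_closed)
qed

lemma poly_eval_uminus: "poly_eval R (- p) = \<ominus> poly_eval R p"
  using poly_eval_diff[of 0 p] by (simp add: poly_eval_zero poly_eval_closed a_minus_def)

lemma poly_eval_one: "poly_eval R 1 = \<one>"
proof -
  have "(1 :: 'a multiset \<Rightarrow>\<^sub>0 int) = frag_of {#}" by (simp flip: single_one)
  moreover have "poly_eval R (frag_of {#}) = \<one>"
    by (subst poly_eval_frag_of) (auto simp: monom_eval_def)
  ultimately show ?thesis by metis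
qed

text \<open>Both sides are biadditive, so two inductions over the free abelian group on the
  monomials reduce the claim to a product of two monomials. If one of them has a variable outside
  the carrier, both sides are zero.\<close>

lemma poly_eval_mult: "poly_eval R (p * q) = poly_eval R p \<otimes> poly_eval R q"
proof -
  have mono: "poly_eval R (frag_of M * frag_of N) = poly_eval R (frag_of M) \<otimes> poly_eval R (frag_of N)"
    for M N :: "'a multiset"
  proof -
    have eq: "frag_of M * frag_of N = frag_of (M + N)"
      by (simp add: mult_single)
    show ?thesis
    proof (cases "set_mset M \<subseteq> carrier R \<and> set_mset N \<subseteq> carrier R")
      case True
      then show ?thesis by (simp add: eq poly_eval_frag_of monom_eval_add)
    next
      case False
      then have "\<not> set_mset (M + N) \<subseteq> carrier R" by simp
      moreover have "poly_eval R (frag_of M) \<otimes> poly_eval R (frag_of N) = \<zero>"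
        using False poly_eval_frag_of_outside[of M] poly_eval_frag_of_outside[of N]
          poly_eval_closed[of "frag_of M"] poly_eval_closed[of "frag_of N"] by (metis l_null r_null)
      ultimately show ?thesis by (simp add: eq poly_eval_frag_of_outside)
    qed
  qed
  have left: "poly_eval R (p * frag_of N) = poly_eval R p \<otimes> poly_eval R (frag_of N)" for p N
  proof (rule frag_induction[OF subset_UNIV[of "Poly_Mapping.keys p"]])
    fix a b
    assume "poly_eval R (a * frag_of N) = poly_eval R a \<otimes> poly_eval R (frag_of N)"
      "poly_eval R (b * frag_of N) = poly_eval R b \<otimes> poly_eval R (frag_of N)"
    moreover have "(a - b) * frag_of N = a * frag_of N - b * frag_of N"
      by (rule left_diff_distrib)
    ultimately show "poly_eval R ((a - b) * frag_of N) = poly_eval R (a - b) \<otimes> poly_eval R (frag_of N)"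
      by (simp only: poly_eval_diff) (simp add: poly_eval_closed a_minus_def l_distr l_minus)
  qed (simp_all add: poly_eval_zero poly_eval_closed mono)
  show ?thesis
  proof (rule frag_induction[OF subset_UNIV[of "Poly_Mapping.keys q"]])
    fix a b
    assume "poly_eval R (p * a) = poly_eval R p \<otimes> poly_eval R a"
      "poly_eval R (p * b) = poly_eval R p \<otimes> poly_eval R b"
    moreover have "p * (a - b) = p * a - p * b"
      by (rule right_diff_distrib)
    ultimately show "poly_eval R (p * (a - b)) = poly_eval R p \<otimes> poly_eval R (a - b)"
      by (simp only: poly_eval_diff) (simp add: poly_eval_closed a_minus_def r_distr r_minus)
  qed (simp_all add: poly_eval_zero poly_eval_closed left)
qed

lemma poly_eval_sum: "finite I \<Longrightarrow> poly_eval R (sum f I) = (\<Oplus>i\<in>I. poly_eval R (f i))"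
  by (induction I rule: finite_induct)
     (auto simp: poly_eval_zero poly_eval_add poly_eval_closed finsum_insert)

lemma poly_eval_prod: "finite I \<Longrightarrow> poly_eval R (prod f I) = (\<Otimes>i\<in>I. poly_eval R (f i))"
  by (induction I rule: finite_induct)
     (auto simp: poly_eval_one poly_eval_mult poly_eval_closed)

lemma poly_eval_variable: "a \<in> carrier R \<Longrightarrow> poly_eval R (frag_of {#a#}) = a"
  by (simp add: poly_eval_frag_of monom_eval_def)

end

text \<open>The variable at place (i, j) is named by the entry \<open>A i j\<close> itself. So the
  one map \<open>poly_eval R\<close> recovers every matrix, and equal entries lift to equal
  variables: repeated rows stay repeated.\<close>

definition generic_mat :: "nat \<Rightarrow> (nat \<Rightarrow> nat \<Rightarrow> 'a) \<Rightarrow> ('a multiset \<Rightarrow>\<^sub>0 int) mat" where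
  "generic_mat n A = mat n n (\<lambda>(i, j). frag_of {#A i j#})"

lemma generic_mat_carrier [simp]: "generic_mat n A \<in> carrier_mat n n"
  by (simp add: generic_mat_def)

lemma permutes_lessThan: "p permutes {..<n} \<Longrightarrow> i < n \<Longrightarrow> p i < (n :: nat)"
  using permutes_in_image[of p "{..<n}" i] by simp

lemma ring_det_eq_eval:
  fixes R :: "'a ring" (structure)
  assumes "cring R" and A: "\<And>i j. i < n \<Longrightarrow> j < n \<Longrightarrow> A i j \<in> carrier R"
  shows "ring_det R n A = poly_eval R (det (generic_mat n A))"
proof -
  interpret cring R by fact
  have "det (generic_mat n A) = (\<Sum>p\<in>{p. p permutes {..<n}}.
      signof p * (\<Prod>i\<in>{..<n}. frag_of {#A i (p i)#}))"
    by (subst det_def'[OF generic_mat_carrier])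
       (auto intro!: sum.cong prod.cong simp: generic_mat_def atLeast0LessThan permutes_lessThan)
  also have "poly_eval R \<dots> = (\<Oplus>p\<in>{p. p permutes {..<n}}.
      poly_eval R (signof p * (\<Prod>i\<in>{..<n}. frag_of {#A i (p i)#})))"
    by (rule poly_eval_sum) (simp add: finite_permutations)
  also have "\<dots> = ring_det R n A"
    unfolding ring_det_def
  proof (rule finsum_cong')
    fix p assume "p \<in> {p. p permutes {..<n}}"
    then have p: "p i < n" if "i < n" for i using that by (simp add: permutes_lessThan)
    have "(\<Otimes>i\<in>{..<n}. poly_eval R (frag_of {#A i (p i)#})) = (\<Otimes>i\<in>{..<n}. A i (p i))"
      using p by (intro finprod_cong') (auto simp: poly_eval_variable A)
    then show "poly_eval R (signof p * (\<Prod>i\<in>{..<n}. frag_of {#A i (p i)#})) =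
        (if evenperm p then \<one> else \<ominus> \<one>) \<otimes> (\<Otimes>i\<in>{..<n}. A i (p i))"
      by (simp add: poly_eval_mult poly_eval_prod sign_def poly_eval_one poly_eval_uminus)
  qed (use A in \<open>auto intro!: finprod_closed m_closed simp: permutes_lessThan\<close>)
  finally show ?thesis by simp
qed

lemma ring_det_closed:
  fixes R :: "'a ring" (structure)
  assumes "cring R" and A: "\<And>i j. i < n \<Longrightarrow> j < n \<Longrightarrow> A i j \<in> carrier R"
  shows "ring_det R n A \<in> carrier R"
  using ring_det_eq_eval[OF assms] cring.poly_eval_closed[OF assms(1)] by simp

lemma ring_det_permute_rows:
  fixes R :: "'a ring" (structure)
  assumes "cring R" and A: "\<And>i j. i < n \<Longrightarrow> j < n \<Longrightarrow> A i j \<in> carrier R"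
    and p: "p permutes {..<n}"
  shows "ring_det R n (\<lambda>i j. A (p i) j) \<in> {ring_det R n A, \<ominus> ring_det R n A}"
proof -
  interpret cring R by fact
  have "generic_mat n (\<lambda>i j. A (p i) j) = mat n n (\<lambda>(i, j). generic_mat n A $$ (p i, j))"
    using p permutes_lessThan[OF p] by (intro eq_matI) (auto simp: generic_mat_def)
  then have "det (generic_mat n (\<lambda>i j. A (p i) j)) = signof p * det (generic_mat n A)"
    using det_permute_rows[OF generic_mat_carrier, of p n A] p by (simp add: atLeast0LessThan)
  then have "poly_eval R (det (generic_mat n (\<lambda>i j. A (p i) j)))
      \<in> {poly_eval R (det (generic_mat n A)), \<ominus> poly_eval R (det (generic_mat n A))}"
    by (simp add: sign_def poly_eval_uminus)
  then show ?thesis using A p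
    by (subst (1 2 3) ring_det_eq_eval[OF assms(1)]) (auto simp: permutes_lessThan)
qed

lemma ring_det_transpose:
  fixes R :: "'a ring" (structure)
  assumes "cring R" and A: "\<And>i j. i < n \<Longrightarrow> j < n \<Longrightarrow> A i j \<in> carrier R"
  shows "ring_det R n (\<lambda>i j. A j i) = ring_det R n A"
proof -
  have "generic_mat n (\<lambda>i j. A j i) = (generic_mat n A)\<^sup>T"
    by (intro eq_matI) (auto simp: generic_mat_def)
  then show ?thesis using A
    by (simp add: ring_det_eq_eval[OF assms(1)] det_transpose[OF generic_mat_carrier])
qed

lemma ring_det_identical_rows:
  fixes R :: "'a ring" (structure)
  assumes "cring R" and A: "\<And>i j. i < n \<Longrightarrow> j < n \<Longrightarrow> A i j \<in> carrier R"
    and ij: "i < n" "j < n" "i \<noteq> j" and eq: "\<And>k. k < n \<Longrightarrow> A i k = A j k"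
  shows "ring_det R n A = \<zero>"
proof -
  interpret cring R by fact
  have "row (generic_mat n A) i = row (generic_mat n A) j"
    using ij eq by (intro eq_vecI) (auto simp: generic_mat_def)
  then have "det (generic_mat n A) = 0"
    using det_identical_rows[OF generic_mat_carrier ij(3,1,2)] by blast
  then show ?thesis using ring_det_eq_eval[OF assms(1) A] poly_eval_zero by simp
qed

text \<open>Laplace expansion along the last row. The order of the quantifiers matters: the
  cofactors \<open>C\<close> depend on the first \<open>n\<close> rows only, so one vector
  \<open>C\<close> serves all last rows \<open>b\<close> at once. This is what turns vanishing
  bordered minors into a relation between columns.\<close>

lemma ring_det_last_row:
  fixes R :: "'a ring" (structure)
  assumes "cring R" and A: "\<And>i j. i < n \<Longrightarrow> j \<le> n \<Longrightarrow> A i j \<in> carrier R"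
  shows "\<exists>C. (\<forall>j\<le>n. C j \<in> carrier R) \<and> C n = ring_det R n A \<and>
    (\<forall>b. (\<forall>j\<le>n. b j \<in> carrier R) \<longrightarrow>
      ring_det R (Suc n) (\<lambda>i j. if i < n then A i j else b j) = (\<Oplus>j\<in>{..n}. b j \<otimes> C j))"
proof -
  interpret cring R by fact
  \<comment> \<open>Row \<open>n\<close> of \<open>A\<close> is unconstrained and may leave the
    carrier. The cofactors along that row delete it.\<close>
  define C where "C j = poly_eval R (cofactor (generic_mat (Suc n) A) n j)" for j
  have 1: "C j \<in> carrier R" for j unfolding C_def by (rule poly_eval_closed)
  have "mat_delete (generic_mat (Suc n) A) n n = generic_mat n A"
    by (intro eq_matI) (auto simp: mat_delete_def generic_mat_def)
  then have 2: "C n = ring_det R n A"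
    using A by (simp add: C_def cofactor_def ring_det_eq_eval[OF assms(1)])
  have 3: "ring_det R (Suc n) (\<lambda>i j. if i < n then A i j else b j) = (\<Oplus>j\<in>{..n}. b j \<otimes> C j)"
    if b: "\<forall>j\<le>n. b j \<in> carrier R" for b
  proof -
    let ?B = "\<lambda>i j. if i < n then A i j else b j"
    have del: "mat_delete (generic_mat (Suc n) ?B) n j = mat_delete (generic_mat (Suc n) A) n j" for j
      by (intro eq_matI) (auto simp: mat_delete_def generic_mat_def)
    have "ring_det R (Suc n) ?B = poly_eval R (det (generic_mat (Suc n) ?B))"
      using A b by (intro ring_det_eq_eval[OF assms(1)]) auto
    also have "det (generic_mat (Suc n) ?B)
        = (\<Sum>j<Suc n. frag_of {#b j#} * cofactor (generic_mat (Suc n) A) n j)"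
      by (subst laplace_expansion_row[OF generic_mat_carrier, of n])
         (auto intro!: sum.cong simp: generic_mat_def[of _ ?B] cofactor_def del[unfolded generic_mat_def[of _ ?B]])
    also have "poly_eval R \<dots> = (\<Oplus>j\<in>{..<Suc n}. poly_eval R (frag_of {#b j#}) \<otimes> C j)"
      by (subst poly_eval_sum) (auto simp: poly_eval_mult C_def)
    also have "\<dots> = (\<Oplus>j\<in>{..n}. b j \<otimes> C j)"
      using b 1 by (intro finsum_cong') (auto simp: poly_eval_variable)
    finally show ?thesis .
  qed
  show ?thesis using 1 2 3 by blast
qed

lemma ring_det_adjugate:
  fixes R :: "'a ring" (structure)
  assumes "cring R" and A: "\<And>i j. i < n \<Longrightarrow> j < n \<Longrightarrow> A i j \<in> carrier R"
  shows "\<exists>B. (\<forall>i j. B i j \<in> carrier R) \<and>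
    (\<forall>i<n. \<forall>j<n. (\<Oplus>k\<in>{..<n}. A i k \<otimes> B k j) = (if i = j then ring_det R n A else \<zero>)) \<and>
    (\<forall>i<n. \<forall>j<n. (\<Oplus>k\<in>{..<n}. B i k \<otimes> A k j) = (if i = j then ring_det R n A else \<zero>))"
proof -
  interpret cring R by fact
  let ?G = "generic_mat n A"
  define B where "B i j = poly_eval R (adj_mat ?G $$ (i, j))" for i j
  note adj = adj_mat[OF generic_mat_carrier, of n A]
  have dims: "dim_row (adj_mat ?G) = n" "dim_col (adj_mat ?G) = n" using adj(1) by auto
  have B: "B i j \<in> carrier R" for i j unfolding B_def by (rule poly_eval_closed)
  have det: "poly_eval R (det ?G) = ring_det R n A"
    using ring_det_eq_eval[OF assms(1) A] by simp
  have "(\<Oplus>k\<in>{..<n}. A i k \<otimes> B k j) = (if i = j then ring_det R n A else \<zero>)"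
    if "i < n" "j < n" for i j
  proof -
    have "(\<Oplus>k\<in>{..<n}. A i k \<otimes> B k j) = poly_eval R (\<Sum>k<n. ?G $$ (i, k) * adj_mat ?G $$ (k, j))"
      using that A B by (subst poly_eval_sum)
        (auto intro!: finsum_cong' simp: poly_eval_mult B_def generic_mat_def poly_eval_variable poly_eval_closed)
    also have "(\<Sum>k<n. ?G $$ (i, k) * adj_mat ?G $$ (k, j)) = (?G * adj_mat ?G) $$ (i, j)"
      using that dims by (simp add: scalar_prod_def atLeast0LessThan generic_mat_def)
    also have "\<dots> = (if i = j then det ?G else 0)" using that adj(2) by simp
    finally show ?thesis by (simp add: det poly_eval_zero)
  qed
  moreover have "(\<Oplus>k\<in>{..<n}. B i k \<otimes> A k j) = (if i = j then ring_det R n A else \<zero>)"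
    if "i < n" "j < n" for i j
  proof -
    have "(\<Oplus>k\<in>{..<n}. B i k \<otimes> A k j) = poly_eval R (\<Sum>k<n. adj_mat ?G $$ (i, k) * ?G $$ (k, j))"
      using that A B by (subst poly_eval_sum)
        (auto intro!: finsum_cong' simp: poly_eval_mult B_def generic_mat_def poly_eval_variable poly_eval_closed)
    also have "(\<Sum>k<n. adj_mat ?G $$ (i, k) * ?G $$ (k, j)) = (adj_mat ?G * ?G) $$ (i, j)"
      using that dims by (simp add: scalar_prod_def atLeast0LessThan generic_mat_def)
    also have "\<dots> = (if i = j then det ?G else 0)" using that adj(3) by simp
    finally show ?thesis by (simp add: det poly_eval_zero)
  qed
  ultimately show ?thesis using B by blast
qed

lemma ring_det_hom:
  fixes R :: "'a ring" (structure) and S :: "'b ring"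
  assumes "cring R" "cring S" and h: "h \<in> Ring.ring_hom R S"
    and A: "\<And>i j. i < n \<Longrightarrow> j < n \<Longrightarrow> A i j \<in> carrier R"
  shows "ring_det S n (\<lambda>i j. h (A i j)) = h (ring_det R n A)"
proof -
  interpret ring_hom_cring R S h
    using assms by (simp add: ring_hom_cring_def ring_hom_cring_axioms_def)
  have prods: "(\<Otimes>i\<in>{..<n}. A i (p i)) \<in> carrier R" if "p permutes {..<n}" for p
    using that A by (intro R.finprod_closed) (auto simp: permutes_lessThan)
  have prod_hom: "h (\<Otimes>i\<in>{..<n}. A i (p i)) = (\<Otimes>\<^bsub>S\<^esub>i\<in>{..<n}. h (A i (p i)))"
    if p: "p permutes {..<n}" for p
  proof -
    have "h (\<Otimes>i\<in>{..<n}. A i (p i)) = (\<Otimes>\<^bsub>S\<^esub>i\<in>{..<n}. (h \<circ> (\<lambda>i. A i (p i))) i)"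
      using p A by (intro hom_finprod) (auto simp: permutes_lessThan)
    then show ?thesis by simp
  qed
  have "h (ring_det R n A) = (\<Oplus>\<^bsub>S\<^esub>p\<in>{p. p permutes {..<n}}.
      h ((if evenperm p then \<one> else \<ominus> \<one>) \<otimes> (\<Otimes>i\<in>{..<n}. A i (p i))))"
    unfolding ring_det_def using prods by (subst hom_finsum) (auto simp: o_def)
  also have "\<dots> = ring_det S n (\<lambda>i j. h (A i j))"
    unfolding ring_det_def
    using A by (intro S.finsum_cong') (auto intro!: S.m_closed S.finprod_closed simp: prod_hom prods permutes_lessThan)
  finally show ?thesis by simp
qed

section \<open>Homomorphisms and free modules\<close>

lemma module_homI:
  assumes "\<And>x. x \<in> carrier M \<Longrightarrow> f x \<in> carrier N"
    and "\<And>x y. x \<in> carrier M \<Longrightarrow> y \<in> carrier M \<Longrightarrow> f (x \<oplus>\<^bsub>M\<^esub> y) = f x \<oplus>\<^bsub>N\<^esub> f y"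
    and "\<And>r x. r \<in> carrier R \<Longrightarrow> x \<in> carrier M \<Longrightarrow> f (r \<odot>\<^bsub>M\<^esub> x) = r \<odot>\<^bsub>N\<^esub> f x"
  shows "f \<in> module_hom R M N"
  using assms by (auto simp: module_hom_def)

lemma module_hom_in: "f \<in> module_hom R M N \<Longrightarrow> x \<in> carrier M \<Longrightarrow> f x \<in> carrier N"
  by (auto simp: module_hom_def)

lemma module_hom_zero:
  assumes "module R M" "module R N" "f \<in> module_hom R M N"
  shows "f \<zero>\<^bsub>M\<^esub> = \<zero>\<^bsub>N\<^esub>"
  using mod_hom.f0_is_0[of R M N f] assms by (simp add: mod_hom_def mod_hom_axioms_def)

lemma module_hom_minus:
  assumes "module R M" "module R N" "f \<in> module_hom R M N" "x \<in> carrier M" "y \<in> carrier M"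
  shows "f (x \<ominus>\<^bsub>M\<^esub> y) = f x \<ominus>\<^bsub>N\<^esub> f y"
  using mod_hom.f_minus[of R M N f] assms by (simp add: mod_hom_def mod_hom_axioms_def)

lemma module_hom_finsum:
  assumes "module R M" "module R N" "f \<in> module_hom R M N" "finite I" "\<And>i. i \<in> I \<Longrightarrow> g i \<in> carrier M"
  shows "f (\<Oplus>\<^bsub>M\<^esub>i\<in>I. g i) = (\<Oplus>\<^bsub>N\<^esub>i\<in>I. f (g i))"
proof -
  interpret M: module R M by fact
  interpret N: module R N by fact
  show ?thesis using assms(4,5)
  proof (induction I rule: finite_induct)
    case empty
    then show ?case using module_hom_zero[OF assms(1-3)] by simp
  next
    case (insert i I)
    then have "f (\<Oplus>\<^bsub>M\<^esub>i\<in>insert i I. g i) = f (g i \<oplus>\<^bsub>M\<^esub> (\<Oplus>\<^bsub>M\<^esub>i\<in>I. g i))"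
      by (subst M.finsum_insert) auto
    also have "\<dots> = f (g i) \<oplus>\<^bsub>N\<^esub> f (\<Oplus>\<^bsub>M\<^esub>i\<in>I. g i)"
      using insert by (intro module_hom_add[OF assms(3)] M.finsum_closed) auto
    also have "\<dots> = (\<Oplus>\<^bsub>N\<^esub>i\<in>insert i I. f (g i))"
      using insert module_hom_in[OF assms(3)] by (subst N.finsum_insert) auto
    finally show ?case .
  qed
qed

lemma module_hom_comp:
  assumes "f \<in> module_hom R M N" "g \<in> module_hom R N P"
  shows "(\<lambda>x. g (f x)) \<in> module_hom R M P"
  using assms by (auto simp: module_hom_def Pi_iff)

lemma module_hom_id: "(\<lambda>x. x) \<in> module_hom R M M"
  by (auto simp: module_hom_def)

lemma module_hom_zero_map:
  assumes "module R M" "module R N"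
  shows "(\<lambda>_. \<zero>\<^bsub>N\<^esub>) \<in> module_hom R M N"
proof -
  interpret N: module R N by fact
  show ?thesis by (intro module_homI) auto
qed

lemma module_hom_diff:
  assumes "module R M" "module R N" "f \<in> module_hom R M N" "g \<in> module_hom R M N"
  shows "(\<lambda>x. f x \<ominus>\<^bsub>N\<^esub> g x) \<in> module_hom R M N"
proof -
  interpret M: module R M by fact
  interpret N: module R N by fact
  show ?thesis
  proof (rule module_homI)
    fix x y assume xy: "x \<in> carrier M" "y \<in> carrier M"
    have c: "f x \<in> carrier N" "f y \<in> carrier N" "g x \<in> carrier N" "g y \<in> carrier N"
      using xy assms by (auto intro: module_hom_in)
    show "f (x \<oplus>\<^bsub>M\<^esub> y) \<ominus>\<^bsub>N\<^esub> g (x \<oplus>\<^bsub>M\<^esub> y) = f x \<ominus>\<^bsub>N\<^esub> g x \<oplus>\<^bsub>N\<^esub> (f y \<ominus>\<^bsub>N\<^esub> g y)"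
      using c by (simp add: module_hom_add[OF assms(3) xy] module_hom_add[OF assms(4) xy]
          a_minus_def N.minus_add N.M.a_ac)
  next
    fix r x assume rx: "r \<in> carrier R" "x \<in> carrier M"
    have c: "f x \<in> carrier N" "g x \<in> carrier N"
      using rx assms by (auto intro: module_hom_in)
    show "f (r \<odot>\<^bsub>M\<^esub> x) \<ominus>\<^bsub>N\<^esub> g (r \<odot>\<^bsub>M\<^esub> x) = r \<odot>\<^bsub>N\<^esub> (f x \<ominus>\<^bsub>N\<^esub> g x)"
      using c rx by (simp add: module_hom_smult[OF assms(3) rx] module_hom_smult[OF assms(4) rx]
          a_minus_def N.smult_r_distr N.smult_r_minus)
  qed (use assms in \<open>auto intro!: N.minus_closed intro: module_hom_in\<close>)
qed

lemma module_hom_smult_map: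
  assumes "module R M" "module R N" "f \<in> module_hom R M N" "s \<in> carrier R"
  shows "(\<lambda>x. s \<odot>\<^bsub>N\<^esub> f x) \<in> module_hom R M N"
proof -
  interpret M: module R M by fact
  interpret N: module R N by fact
  show ?thesis
  proof (rule module_homI)
    fix r x assume rx: "r \<in> carrier R" "x \<in> carrier M"
    then show "s \<odot>\<^bsub>N\<^esub> f (r \<odot>\<^bsub>M\<^esub> x) = r \<odot>\<^bsub>N\<^esub> (s \<odot>\<^bsub>N\<^esub> f x)"
      using assms(4) module_hom_in[OF assms(3)] by (simp add: module_hom_smult[OF assms(3)] M.m_comm flip: N.smult_assoc1)
  qed (use assms(4) module_hom_in[OF assms(3)] in \<open>auto simp: module_hom_add[OF assms(3)] N.smult_r_distr\<close>)
qed

section \<open>Basis vectors and linear extension on free modules\<close>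

definition free_unit :: "'a ring \<Rightarrow> 'x set \<Rightarrow> 'x \<Rightarrow> 'x \<Rightarrow> 'a" where
  "free_unit R X x = (\<lambda>y\<in>X. if y = x then \<one>\<^bsub>R\<^esub> else \<zero>\<^bsub>R\<^esub>)"

text \<open>Summing over the support of \<open>v\<close>, which is finite on
  \<open>free_module R X\<close>, makes one definition serve infinite index sets as well; these
  occur when an arbitrary projective module is a summand of a free one.\<close>

definition lin_ext :: "'a ring \<Rightarrow> ('a, 'b) module \<Rightarrow> 'x set \<Rightarrow> ('x \<Rightarrow> 'b) \<Rightarrow> ('x \<Rightarrow> 'a) \<Rightarrow> 'b" where
  "lin_ext R M X a v = (\<Oplus>\<^bsub>M\<^esub>x\<in>{x \<in> X. v x \<noteq> \<zero>\<^bsub>R\<^esub>}. v x \<odot>\<^bsub>M\<^esub> a x)"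

lemma std_basis_eq_free_unit: "std_basis R n = free_unit R {..<n}"
  by (simp add: std_basis_def free_unit_def fun_eq_iff)

lemma carrier_free_module:
  "carrier (free_module R X) = {f \<in> X \<rightarrow>\<^sub>E carrier R. finite {x \<in> X. f x \<noteq> \<zero>\<^bsub>R\<^esub>}}"
  by (simp add: free_module_def)

lemma carrier_free_module_finite:
  "finite X \<Longrightarrow> carrier (free_module R X) = X \<rightarrow>\<^sub>E carrier R"
  by (auto simp: carrier_free_module)

lemma carrier_std_free: "carrier (std_free R n) = {..<n} \<rightarrow>\<^sub>E carrier R"
  by (simp add: std_free_def carrier_free_module_finite)

lemma free_module_ops:
  fixes R :: "'a ring" (structure)
  assumes "cring R"
  shows "add (free_module R X) = (\<lambda>f g. \<lambda>x\<in>X. f x \<oplus> g x)"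
    "module.smult (free_module R X) = (\<lambda>c f. \<lambda>x\<in>X. c \<otimes> f x)"
    "zero (free_module R X) = (\<lambda>x\<in>X. \<zero>)"
  using assms by (auto simp: free_module_def ring.func_space_def[OF cring.axioms(1)])

lemma std_free_ops:
  fixes R :: "'a ring" (structure)
  assumes "cring R"
  shows "add (std_free R n) = (\<lambda>f g. \<lambda>x\<in>{..<n}. f x \<oplus> g x)"
    "module.smult (std_free R n) = (\<lambda>c f. \<lambda>x\<in>{..<n}. c \<otimes> f x)"
    "zero (std_free R n) = (\<lambda>x\<in>{..<n}. \<zero>)"
  using free_module_ops[OF assms] by (simp_all add: std_free_def)

lemma free_module_is_module:
  fixes R :: "'a ring" (structure)
  assumes "cring R"
  shows "module R (free_module R X)"
proof -
  interpret cring R by fact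
  interpret F: module R "func_space X" by (rule func_space_is_module)
  have "submodule R {f \<in> X \<rightarrow>\<^sub>E carrier R. finite {x \<in> X. f x \<noteq> \<zero>}} (func_space X)"
  proof
    fix v w assume vw: "v \<in> {f \<in> X \<rightarrow>\<^sub>E carrier R. finite {x \<in> X. f x \<noteq> \<zero>}}"
      "w \<in> {f \<in> X \<rightarrow>\<^sub>E carrier R. finite {x \<in> X. f x \<noteq> \<zero>}}"
    have "{x \<in> X. v x \<oplus> w x \<noteq> \<zero>} \<subseteq> {x \<in> X. v x \<noteq> \<zero>} \<union> {x \<in> X. w x \<noteq> \<zero>}" by auto
    moreover have "finite ({x \<in> X. v x \<noteq> \<zero>} \<union> {x \<in> X. w x \<noteq> \<zero>})" using vw by auto
    ultimately have "finite {x \<in> X. v x \<oplus> w x \<noteq> \<zero>}" by (rule finite_subset)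
    moreover have "{x \<in> X. (v \<oplus>\<^bsub>func_space X\<^esub> w) x \<noteq> \<zero>} = {x \<in> X. v x \<oplus> w x \<noteq> \<zero>}"
      by (auto simp: func_space_def)
    ultimately show "v \<oplus>\<^bsub>func_space X\<^esub> w \<in> {f \<in> X \<rightarrow>\<^sub>E carrier R. finite {x \<in> X. f x \<noteq> \<zero>}}"
      using vw by (auto simp: func_space_def PiE_mem)
  next
    fix c v assume cv: "c \<in> carrier R" "v \<in> {f \<in> X \<rightarrow>\<^sub>E carrier R. finite {x \<in> X. f x \<noteq> \<zero>}}"
    have "{x \<in> X. c \<otimes> v x \<noteq> \<zero>} \<subseteq> {x \<in> X. v x \<noteq> \<zero>}" using cv by auto
    then have "finite {x \<in> X. c \<otimes> v x \<noteq> \<zero>}" using cv by (auto intro: finite_subset)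
    moreover have "{x \<in> X. (c \<odot>\<^bsub>func_space X\<^esub> v) x \<noteq> \<zero>} = {x \<in> X. c \<otimes> v x \<noteq> \<zero>}"
      by (auto simp: func_space_def)
    ultimately show "c \<odot>\<^bsub>func_space X\<^esub> v \<in> {f \<in> X \<rightarrow>\<^sub>E carrier R. finite {x \<in> X. f x \<noteq> \<zero>}}"
      using cv by (auto simp: func_space_def PiE_mem)
  qed (auto simp: func_space_def)
  then show ?thesis
    unfolding free_module_def by (rule F.submodule_is_module)
qed

lemma std_free_is_module: "cring R \<Longrightarrow> module R (std_free R n)"
  by (simp add: std_free_def free_module_is_module)

lemma free_unit_in:
  fixes R :: "'a ring" (structure)
  assumes "cring R"
  shows "free_unit R X x \<in> carrier (free_module R X)"
proof -
  interpret cring R by fact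
  have "{y \<in> X. free_unit R X x y \<noteq> \<zero>} \<subseteq> {x}" by (auto simp: free_unit_def split: if_splits)
  then have "finite {y \<in> X. free_unit R X x y \<noteq> \<zero>}" by (rule finite_subset) simp
  then show ?thesis by (auto simp: carrier_free_module free_unit_def)
qed

lemma std_basis_in: "cring R \<Longrightarrow> std_basis R n j \<in> carrier (std_free R n)"
  by (simp add: std_basis_eq_free_unit std_free_def free_unit_in)

lemma free_finsum_apply:
  fixes R :: "'a ring" (structure)
  assumes "cring R" "finite I" "\<And>i. i \<in> I \<Longrightarrow> f i \<in> carrier (free_module R X)" "y \<in> X"
  shows "(\<Oplus>\<^bsub>free_module R X\<^esub>i\<in>I. f i) y = (\<Oplus>i\<in>I. f i y)"
proof -
  interpret cring R by fact
  interpret F: module R "free_module R X" by (rule free_module_is_module) fact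
  have c: "v y \<in> carrier R" if "v \<in> carrier (free_module R X)" for v
    using that assms(4) by (auto simp: carrier_free_module)
  show ?thesis using assms(2,3)
  proof (induction I rule: finite_induct)
    case empty
    then show ?case using assms by (simp add: free_module_ops)
  next
    case (insert i I)
    then show ?case using c assms(4)
      by (simp add: F.finsum_insert finsum_insert Pi_def) (simp add: free_module_ops[OF assms(1)])
  qed
qed

lemma lin_ext_superset:
  fixes R :: "'a ring" (structure)
  assumes "module R M" "v \<in> carrier (free_module R X)" "finite F" "{x \<in> X. v x \<noteq> \<zero>} \<subseteq> F" "F \<subseteq> X"
    "\<And>x. x \<in> X \<Longrightarrow> a x \<in> carrier M"
  shows "lin_ext R M X a v = (\<Oplus>\<^bsub>M\<^esub>x\<in>F. v x \<odot>\<^bsub>M\<^esub> a x)"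
proof -
  interpret module R M by fact
  have v: "v x \<in> carrier R" if "x \<in> X" for x
    using that assms(2) by (auto simp: carrier_free_module)
  show ?thesis unfolding lin_ext_def using assms v
    by (intro M.add.finprod_mono_neutral_cong_left) auto
qed

lemma lin_ext_std:
  fixes R :: "'a ring" (structure)
  assumes "module R M" "v \<in> carrier (std_free R n)" "\<And>j. j < n \<Longrightarrow> a j \<in> carrier M"
  shows "lin_ext R M {..<n} a v = (\<Oplus>\<^bsub>M\<^esub>j\<in>{..<n}. v j \<odot>\<^bsub>M\<^esub> a j)"
  using assms by (intro lin_ext_superset) (auto simp: std_free_def)

lemma lin_ext_hom:
  fixes R :: "'a ring" (structure)
  assumes "module R M" "\<And>x. x \<in> X \<Longrightarrow> a x \<in> carrier M"
  shows "lin_ext R M X a \<in> module_hom R (free_module R X) M"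
proof -
  interpret module R M by fact
  have cr: "cring R" ..
  interpret F: module R "free_module R X" by (rule free_module_is_module[OF cr])
  have val: "v x \<in> carrier R" if "x \<in> X" "v \<in> carrier (free_module R X)" for v x
    using that by (auto simp: carrier_free_module)
  show ?thesis
  proof (rule module_homI)
    fix v assume v: "v \<in> carrier (free_module R X)"
    show "lin_ext R M X a v \<in> carrier M"
      unfolding lin_ext_def using assms(2) val v by (intro M.finsum_closed) auto
  next
    fix v w assume v: "v \<in> carrier (free_module R X)" and w: "w \<in> carrier (free_module R X)"
    let ?F = "{x \<in> X. v x \<noteq> \<zero>} \<union> {x \<in> X. w x \<noteq> \<zero>}"
    have fin: "finite ?F" using v w by (auto simp: carrier_free_module)
    have vw: "(v \<oplus>\<^bsub>free_module R X\<^esub> w) x = v x \<oplus> w x" if "x \<in> X" for x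
      using that by (simp add: free_module_ops[OF cr])
    have "lin_ext R M X a (v \<oplus>\<^bsub>free_module R X\<^esub> w)
        = (\<Oplus>\<^bsub>M\<^esub>x\<in>?F. (v \<oplus>\<^bsub>free_module R X\<^esub> w) x \<odot>\<^bsub>M\<^esub> a x)"
      using v w fin assms(2) by (intro lin_ext_superset[OF assms(1)]) (auto simp: vw)
    also have "\<dots> = (\<Oplus>\<^bsub>M\<^esub>x\<in>?F. v x \<odot>\<^bsub>M\<^esub> a x \<oplus>\<^bsub>M\<^esub> w x \<odot>\<^bsub>M\<^esub> a x)"
      using assms(2) val v w by (intro M.finsum_cong') (auto simp: vw smult_l_distr)
    also have "\<dots> = (\<Oplus>\<^bsub>M\<^esub>x\<in>?F. v x \<odot>\<^bsub>M\<^esub> a x) \<oplus>\<^bsub>M\<^esub> (\<Oplus>\<^bsub>M\<^esub>x\<in>?F. w x \<odot>\<^bsub>M\<^esub> a x)"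
      using assms(2) val v w by (intro M.finsum_addf) auto
    also have "(\<Oplus>\<^bsub>M\<^esub>x\<in>?F. v x \<odot>\<^bsub>M\<^esub> a x) = lin_ext R M X a v"
      using v fin assms(2) by (intro lin_ext_superset[OF assms(1), symmetric]) auto
    also have "(\<Oplus>\<^bsub>M\<^esub>x\<in>?F. w x \<odot>\<^bsub>M\<^esub> a x) = lin_ext R M X a w"
      using w fin assms(2) by (intro lin_ext_superset[OF assms(1), symmetric]) auto
    finally show "lin_ext R M X a (v \<oplus>\<^bsub>free_module R X\<^esub> w) = lin_ext R M X a v \<oplus>\<^bsub>M\<^esub> lin_ext R M X a w" .
  next
    fix r v assume r: "r \<in> carrier R" and v: "v \<in> carrier (free_module R X)"
    let ?F = "{x \<in> X. v x \<noteq> \<zero>}"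
    have fin: "finite ?F" using v by (auto simp: carrier_free_module)
    have rv: "(r \<odot>\<^bsub>free_module R X\<^esub> v) x = r \<otimes> v x" if "x \<in> X" for x
      using that by (simp add: free_module_ops[OF cr])
    have "lin_ext R M X a (r \<odot>\<^bsub>free_module R X\<^esub> v) = (\<Oplus>\<^bsub>M\<^esub>x\<in>?F. (r \<odot>\<^bsub>free_module R X\<^esub> v) x \<odot>\<^bsub>M\<^esub> a x)"
      using r v fin assms(2) by (intro lin_ext_superset[OF assms(1)]) (auto simp: rv)
    also have "\<dots> = (\<Oplus>\<^bsub>M\<^esub>x\<in>?F. r \<odot>\<^bsub>M\<^esub> (v x \<odot>\<^bsub>M\<^esub> a x))"
      using assms(2) val v r by (intro M.finsum_cong') (auto simp: rv smult_assoc1)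
    also have "\<dots> = r \<odot>\<^bsub>M\<^esub> lin_ext R M X a v"
      unfolding lin_ext_def using assms(2) val v r fin
      by (intro finsum_smult_ldistr[symmetric]) auto
    finally show "lin_ext R M X a (r \<odot>\<^bsub>free_module R X\<^esub> v) = r \<odot>\<^bsub>M\<^esub> lin_ext R M X a v" .
  qed
qed

lemma lin_ext_free_unit:
  fixes R :: "'a ring" (structure)
  assumes "module R M" "\<And>x. x \<in> X \<Longrightarrow> a x \<in> carrier M" "x \<in> X"
  shows "lin_ext R M X a (free_unit R X x) = a x"
proof -
  interpret module R M by fact
  have "lin_ext R M X a (free_unit R X x) = (\<Oplus>\<^bsub>M\<^esub>y\<in>{x}. free_unit R X x y \<odot>\<^bsub>M\<^esub> a y)"
    using assms free_unit_in[OF module.axioms(1)[OF assms(1)], of X x]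
    by (intro lin_ext_superset[OF assms(1)]) (auto simp: free_unit_def)
  also have "\<dots> = a x" using assms by (simp add: free_unit_def)
  finally show ?thesis .
qed

lemma free_module_expand:
  fixes R :: "'a ring" (structure)
  assumes "cring R" "v \<in> carrier (free_module R X)"
  shows "lin_ext R (free_module R X) X (free_unit R X) v = v"
proof -
  interpret cring R by fact
  interpret F: module R "free_module R X" by (rule free_module_is_module) fact
  let ?S = "{x \<in> X. v x \<noteq> \<zero>}"
  have fin: "finite ?S" and val: "\<And>x. x \<in> X \<Longrightarrow> v x \<in> carrier R" using assms(2) by (auto simp: carrier_free_module)
  have in_F: "lin_ext R (free_module R X) X (free_unit R X) v \<in> carrier (free_module R X)"
    by (rule module_hom_in[OF lin_ext_hom[OF F.module_axioms free_unit_in[OF assms(1)]] assms(2)])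
  have "lin_ext R (free_module R X) X (free_unit R X) v y = v y" if y: "y \<in> X" for y
  proof -
    have "lin_ext R (free_module R X) X (free_unit R X) v y
        = (\<Oplus>x\<in>?S. (v x \<odot>\<^bsub>free_module R X\<^esub> free_unit R X x) y)"
      unfolding lin_ext_def using fin val y
      by (intro free_finsum_apply[OF assms(1)]) (auto intro!: F.smult_closed free_unit_in[OF assms(1)])
    also have "\<dots> = (\<Oplus>x\<in>?S. if y = x then v x else \<zero>)"
      using y val by (intro finsum_cong') (auto simp: free_module_ops[OF assms(1)] free_unit_def)
    also have "\<dots> = v y"
    proof (cases "v y = \<zero>")
      case True
      have "(\<Oplus>x\<in>?S. if y = x then v x else \<zero>) = (\<Oplus>x\<in>?S. \<zero>)"
        using True by (intro finsum_cong') auto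
      then show ?thesis using True by simp
    next
      case False
      then show ?thesis using fin y val by (subst finsum_singleton) auto
    qed
    finally show ?thesis .
  qed
  moreover have "f = g" if "f \<in> carrier (free_module R X)" "g \<in> carrier (free_module R X)"
    "\<And>y. y \<in> X \<Longrightarrow> f y = g y" for f g
    using that by (auto simp: carrier_free_module intro: PiE_ext)
  ultimately show ?thesis using in_F assms(2) by blast
qed

lemma module_hom_eq_lin_ext:
  fixes R :: "'a ring" (structure) and M :: "('a, 'b) module"
  assumes "module R M" "f \<in> module_hom R (free_module R X) M" "v \<in> carrier (free_module R X)"
  shows "f v = lin_ext R M X (\<lambda>x. f (free_unit R X x)) v"
proof -
  interpret module R M by fact
  have cr: "cring R" ..
  interpret F: module R "free_module R X" by (rule free_module_is_module[OF cr])
  have fin: "finite {x \<in> X. v x \<noteq> \<zero>}" and val: "\<And>x. x \<in> X \<Longrightarrow> v x \<in> carrier R"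
    using assms(3) by (auto simp: carrier_free_module)
  have "f v = f (lin_ext R (free_module R X) X (free_unit R X) v)"
    using free_module_expand[OF cr assms(3)] by simp
  also have "\<dots> = (\<Oplus>\<^bsub>M\<^esub>x\<in>{x \<in> X. v x \<noteq> \<zero>}. f (v x \<odot>\<^bsub>free_module R X\<^esub> free_unit R X x))"
    unfolding lin_ext_def using fin val
    by (intro module_hom_finsum[OF F.module_axioms assms(1,2)]) (auto intro!: F.smult_closed free_unit_in[OF cr])
  also have "\<dots> = lin_ext R M X (\<lambda>x. f (free_unit R X x)) v"
    unfolding lin_ext_def using val free_unit_in[OF cr, of X] module_hom_in[OF assms(2)]
    by (intro M.finsum_cong') (auto simp: module_hom_smult[OF assms(2)])
  finally show ?thesis .
qed

lemma module_hom_eqI: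
  fixes R :: "'a ring" (structure) and M :: "('a, 'b) module"
  assumes "module R M" "f \<in> module_hom R (free_module R X) M" "g \<in> module_hom R (free_module R X) M"
    "\<And>x. x \<in> X \<Longrightarrow> f (free_unit R X x) = g (free_unit R X x)" "v \<in> carrier (free_module R X)"
  shows "f v = g v"
proof -
  interpret module R M by fact
  have cr: "cring R" ..
  have val: "\<And>x. x \<in> X \<Longrightarrow> v x \<in> carrier R"
    using assms(5) by (auto simp: carrier_free_module)
  have "lin_ext R M X (\<lambda>x. f (free_unit R X x)) v = lin_ext R M X (\<lambda>x. g (free_unit R X x)) v"
    unfolding lin_ext_def using val assms(4) module_hom_in[OF assms(3) free_unit_in[OF cr, of X]]
    by (intro M.finsum_cong') auto
  then show ?thesis
    using module_hom_eq_lin_ext[OF assms(1,2,5)] module_hom_eq_lin_ext[OF assms(1,3,5)] by simp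
qed

text \<open>Preimages are chosen for the images of the basis of the ambient free module, extended
  linearly, and restricted along the inclusion of the summand. Only an inclusion of images is asked
  of \<open>g\<close>, since a differential of a resolution is onto a kernel and not onto the whole
  module.\<close>

lemma projective_lift:
  fixes R :: "'a ring" (structure) and P :: "('a, 'p) module"
    and A :: "('a, 'b) module" and B :: "('a, 'c) module"
  assumes P: "projective_module R P" and A: "module R A" and B: "module R B"
    and f: "f \<in> module_hom R P B" and g: "g \<in> module_hom R A B"
    and sub: "\<And>x. x \<in> carrier P \<Longrightarrow> f x \<in> g ` carrier A"
  shows "\<exists>h \<in> module_hom R P A. \<forall>x\<in>carrier P. g (h x) = f x"
proof -
  obtain X :: "'p set" and \<iota> \<pi> where
    \<iota>: "\<iota> \<in> module_hom R P (free_module R X)" and \<pi>: "\<pi> \<in> module_hom R (free_module R X) P"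
    and id: "\<forall>x\<in>carrier P. \<pi> (\<iota> x) = x"
    using P unfolding projective_module_def by blast
  have cr: "cring R" using A by (simp add: module_def)
  define a where "a x = (SOME y. y \<in> carrier A \<and> g y = f (\<pi> (free_unit R X x)))" for x
  have a: "a x \<in> carrier A \<and> g (a x) = f (\<pi> (free_unit R X x))" for x
  proof -
    have "f (\<pi> (free_unit R X x)) \<in> g ` carrier A"
      by (rule sub[OF module_hom_in[OF \<pi> free_unit_in[OF cr]]])
    then have "\<exists>y. y \<in> carrier A \<and> g y = f (\<pi> (free_unit R X x))" by auto
    then show ?thesis unfolding a_def by (rule someI_ex)
  qed
  have e: "lin_ext R A X a \<in> module_hom R (free_module R X) A"
    using a by (intro lin_ext_hom[OF A]) auto
  have hom: "(\<lambda>x. lin_ext R A X a (\<iota> x)) \<in> module_hom R P A"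
    by (rule module_hom_comp[OF \<iota> e])
  have lift: "g (lin_ext R A X a (\<iota> x)) = f x" if x: "x \<in> carrier P" for x
  proof -
    have "g (lin_ext R A X a (\<iota> x)) = f (\<pi> (\<iota> x))"
    proof (rule module_hom_eqI[OF B module_hom_comp[OF e g] module_hom_comp[OF \<pi> f] _ module_hom_in[OF \<iota> x]])
      fix y assume "y \<in> X"
      then have "lin_ext R A X a (free_unit R X y) = a y"
        using a by (intro lin_ext_free_unit[OF A]) auto
      then show "g (lin_ext R A X a (free_unit R X y)) = f (\<pi> (free_unit R X y))"
        by (simp only: conjunct2[OF a])
    qed
    then show ?thesis using bspec[OF id x] by (simp only:)
  qed
  show ?thesis by (rule bexI[OF _ hom]) (rule ballI, rule lift)
qed

lemma reindex_hom:
  fixes R :: "'a ring" (structure)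
  assumes "cring R" and b: "bij_betw b X Y"
  shows "(\<lambda>v. \<lambda>x\<in>X. v (b x)) \<in> module_hom R (free_module R Y) (free_module R X)"
proof (rule module_homI)
  have bX: "b x \<in> Y" if "x \<in> X" for x using b that by (auto simp: bij_betw_def)
  fix v assume v: "v \<in> carrier (free_module R Y)"
  have "{x \<in> X. v (b x) \<noteq> \<zero>} = inv_into X b ` {y \<in> Y. v y \<noteq> \<zero>}"
  proof (intro equalityI subsetI)
    fix x assume "x \<in> {x \<in> X. v (b x) \<noteq> \<zero>}"
    then show "x \<in> inv_into X b ` {y \<in> Y. v y \<noteq> \<zero>}"
      using bX b by (intro image_eqI[of _ _ "b x"]) (auto simp: bij_betw_def)
  next
    fix x assume "x \<in> inv_into X b ` {y \<in> Y. v y \<noteq> \<zero>}"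
    then show "x \<in> {x \<in> X. v (b x) \<noteq> \<zero>}"
      using b by (auto simp: bij_betw_def f_inv_into_f inv_into_into)
  qed
  then have "finite {x \<in> X. v (b x) \<noteq> \<zero>}" using v by (simp add: carrier_free_module)
  moreover have "{x \<in> X. (\<lambda>x\<in>X. v (b x)) x \<noteq> \<zero>} = {x \<in> X. v (b x) \<noteq> \<zero>}" by auto
  ultimately show "(\<lambda>x\<in>X. v (b x)) \<in> carrier (free_module R X)"
    using v bX by (auto simp: carrier_free_module)
qed (use b in \<open>auto simp: free_module_ops[OF assms(1)] bij_betw_def restrict_def fun_eq_iff\<close>)

text \<open>\<open>projective_module\<close> wants an index set inside the element type of the
  module itself. The basis vectors provide one; they are distinct because one differs from
  zero.\<close>

lemma free_module_projective:
  fixes R :: "'a ring" (structure) and X :: "'x set"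
  assumes "cring R" "\<one> \<noteq> \<zero>"
  shows "projective_module R (free_module R X)"
proof -
  let ?Y = "free_unit R X ` X"
  have inj: "inj_on (free_unit R X) X"
  proof (rule inj_onI)
    fix x y assume xy: "x \<in> X" "y \<in> X" and eq: "free_unit R X x = free_unit R X y"
    have "free_unit R X x x = free_unit R X y x" by (simp only: eq)
    then show "x = y" using assms(2) xy by (auto simp: free_unit_def split: if_splits)
  qed
  have b: "bij_betw (free_unit R X) X ?Y" using inj by (simp add: bij_betw_def)
  let ?c = "inv_into X (free_unit R X)"
  have c: "bij_betw ?c ?Y X" using bij_betw_inv_into[OF b] .
  have "(\<lambda>x\<in>X. (\<lambda>y\<in>?Y. v (?c y)) (free_unit R X x)) = v" if "v \<in> carrier (free_module R X)" for v
    using that inj by (auto simp: carrier_free_module fun_eq_iff restrict_def PiE_def extensional_def)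
  then show ?thesis
    unfolding projective_module_def
    using reindex_hom[OF assms(1) b] reindex_hom[OF assms(1) c] free_module_is_module[OF assms(1)]
    by blast
qed

section \<open>Base change of free modules\<close>

text \<open>Entrywise application of \<phi> on free modules and the localization map of an arbitrary
  module are both of this kind, so the same lemmas treat the differentials and the augmentation of a
  resolution.\<close>

definition semilinear ::
  "('a \<Rightarrow> 'k) \<Rightarrow> 'a ring \<Rightarrow> ('a, 'b) module \<Rightarrow> ('k, 'c) module \<Rightarrow> ('b \<Rightarrow> 'c) \<Rightarrow> bool" where
  "semilinear \<phi> R M M' h \<longleftrightarrow> h \<in> carrier M \<rightarrow> carrier M' \<and>
     (\<forall>x\<in>carrier M. \<forall>y\<in>carrier M. h (x \<oplus>\<^bsub>M\<^esub> y) = h x \<oplus>\<^bsub>M'\<^esub> h y) \<and>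
     (\<forall>r\<in>carrier R. \<forall>x\<in>carrier M. h (r \<odot>\<^bsub>M\<^esub> x) = \<phi> r \<odot>\<^bsub>M'\<^esub> h x)"

definition map_vec :: "('a \<Rightarrow> 'k) \<Rightarrow> nat \<Rightarrow> (nat \<Rightarrow> 'a) \<Rightarrow> nat \<Rightarrow> 'k" where
  "map_vec \<phi> n x = (\<lambda>i\<in>{..<n}. \<phi> (x i))"

lemma semilinear_in: "semilinear \<phi> R M M' h \<Longrightarrow> x \<in> carrier M \<Longrightarrow> h x \<in> carrier M'"
  by (auto simp: semilinear_def)

lemma semilinear_zero:
  fixes R :: "'a ring" and K :: "'k ring"
  assumes "module R M" "module K M'" "semilinear \<phi> R M M' h"
  shows "h \<zero>\<^bsub>M\<^esub> = \<zero>\<^bsub>M'\<^esub>"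
proof -
  interpret M: module R M by fact
  interpret M': module K M' by fact
  have "h (\<zero>\<^bsub>M\<^esub> \<oplus>\<^bsub>M\<^esub> \<zero>\<^bsub>M\<^esub>) = h \<zero>\<^bsub>M\<^esub> \<oplus>\<^bsub>M'\<^esub> h \<zero>\<^bsub>M\<^esub>"
    using assms(3) unfolding semilinear_def by blast
  moreover have "h \<zero>\<^bsub>M\<^esub> \<in> carrier M'" using semilinear_in[OF assms(3)] by simp
  ultimately show ?thesis using M'.M.add.l_cancel_one by fastforce
qed

lemma semilinear_finsum:
  fixes R :: "'a ring" and K :: "'k ring"
  assumes "module R M" "module K M'" "semilinear \<phi> R M M' h" "finite I" "\<And>i. i \<in> I \<Longrightarrow> g i \<in> carrier M"
  shows "h (\<Oplus>\<^bsub>M\<^esub>i\<in>I. g i) = (\<Oplus>\<^bsub>M'\<^esub>i\<in>I. h (g i))"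
proof -
  interpret M: module R M by fact
  interpret M': module K M' by fact
  show ?thesis using assms(4,5)
  proof (induction I rule: finite_induct)
    case empty
    then show ?case using semilinear_zero[OF assms(1-3)] by simp
  next
    case (insert i I)
    then have "h (\<Oplus>\<^bsub>M\<^esub>i\<in>insert i I. g i) = h (g i \<oplus>\<^bsub>M\<^esub> (\<Oplus>\<^bsub>M\<^esub>i\<in>I. g i))"
      by (subst M.finsum_insert) auto
    also have "\<dots> = h (g i) \<oplus>\<^bsub>M'\<^esub> h (\<Oplus>\<^bsub>M\<^esub>i\<in>I. g i)"
      using insert assms(3) by (simp add: semilinear_def Pi_def)
    also have "\<dots> = (\<Oplus>\<^bsub>M'\<^esub>i\<in>insert i I. h (g i))"
      using insert semilinear_in[OF assms(3)] by (subst M'.finsum_insert) auto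
    finally show ?case .
  qed
qed

lemma semilinear_map_vec:
  fixes R :: "'a ring" and K :: "'k ring"
  assumes "cring R" "cring K" "\<phi> \<in> Ring.ring_hom R K"
  shows "semilinear \<phi> R (std_free R n) (std_free K n) (map_vec \<phi> n)"
  unfolding semilinear_def
proof (intro conjI ballI funcsetI)
  fix x assume x: "x \<in> carrier (std_free R n)"
  then have xi: "x i \<in> carrier R" if "i < n" for i using that by (auto simp: carrier_std_free)
  show "map_vec \<phi> n x \<in> carrier (std_free K n)"
    using xi ring_hom_closed[OF assms(3)] by (auto simp: map_vec_def carrier_std_free)
  show "map_vec \<phi> n (r \<odot>\<^bsub>std_free R n\<^esub> x) = \<phi> r \<odot>\<^bsub>std_free K n\<^esub> map_vec \<phi> n x" if "r \<in> carrier R" for r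
    using xi ring_hom_mult[OF assms(3) that]
    by (simp add: map_vec_def std_free_ops[OF assms(1)] std_free_ops[OF assms(2)] cong: restrict_cong)
  show "map_vec \<phi> n (x \<oplus>\<^bsub>std_free R n\<^esub> y) = map_vec \<phi> n x \<oplus>\<^bsub>std_free K n\<^esub> map_vec \<phi> n y"
    if y: "y \<in> carrier (std_free R n)" for y
  proof -
    have yi: "y i \<in> carrier R" if "i < n" for i using that y by (auto simp: carrier_std_free)
    show ?thesis using xi yi ring_hom_add[OF assms(3)]
      by (simp add: map_vec_def std_free_ops[OF assms(1)] std_free_ops[OF assms(2)] cong: restrict_cong)
  qed
qed

lemma map_vec_std_basis:
  fixes R :: "'a ring" and K :: "'k ring"
  assumes "cring R" "cring K" "\<phi> \<in> Ring.ring_hom R K"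
  shows "map_vec \<phi> n (std_basis R n j) = std_basis K n j"
proof -
  have "\<phi> \<zero>\<^bsub>R\<^esub> = \<zero>\<^bsub>K\<^esub>"
    using assms by (intro ring_hom_zero) (auto simp: cring_def)
  then show ?thesis
    using ring_hom_one[OF assms(3)] by (auto simp: map_vec_def std_basis_def fun_eq_iff)
qed

text \<open>The source of \<open>T\<close> is free, so the base change is determined by the images
  of the basis vectors and needs no tensor product. For a free target with \<open>map_vec\<close> it
  is the matrix of \<open>T\<close> with \<phi> applied to every entry.\<close>

definition base_change ::
  "'a ring \<Rightarrow> 'k ring \<Rightarrow> nat \<Rightarrow> ('k, 'c) module \<Rightarrow> ('b \<Rightarrow> 'c) \<Rightarrow> ((nat \<Rightarrow> 'a) \<Rightarrow> 'b) \<Rightarrow> (nat \<Rightarrow> 'k) \<Rightarrow> 'c" where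
  "base_change R K n M' h T = lin_ext K M' {..<n} (\<lambda>j. h (T (std_basis R n j)))"

lemma base_change_hom:
  fixes R :: "'a ring" and K :: "'k ring"
  assumes "cring R" "module R M" "module K M'" "semilinear \<phi> R M M' h" "T \<in> module_hom R (std_free R n) M"
  shows "base_change R K n M' h T \<in> module_hom K (std_free K n) M'"
  unfolding base_change_def std_free_def
  by (intro lin_ext_hom[OF assms(3)] semilinear_in[OF assms(4)] module_hom_in[OF assms(5)] std_basis_in[OF assms(1)])

lemma base_change_std_basis:
  fixes R :: "'a ring" and K :: "'k ring"
  assumes "cring R" "module R M" "module K M'" "semilinear \<phi> R M M' h" "T \<in> module_hom R (std_free R n) M" "j < n"
  shows "base_change R K n M' h T (std_basis K n j) = h (T (std_basis R n j))"
  unfolding base_change_def std_basis_eq_free_unit[of K]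
  using assms(6)
  by (intro lin_ext_free_unit[OF assms(3)] semilinear_in[OF assms(4)] module_hom_in[OF assms(5)] std_basis_in[OF assms(1)]) simp

text \<open>The commuting square between \<open>T\<close> and its base change. Localization lemmas
  use it as the compatibility of two maps with the localization maps at both ends.\<close>

lemma base_change_map_vec:
  fixes R :: "'a ring" and K :: "'k ring"
  assumes "cring R" "cring K" "\<phi> \<in> Ring.ring_hom R K" "module R M" "module K M'"
    "semilinear \<phi> R M M' h" "T \<in> module_hom R (std_free R n) M" "x \<in> carrier (std_free R n)"
  shows "base_change R K n M' h T (map_vec \<phi> n x) = h (T x)"
proof -
  interpret M: module R M by fact
  interpret M': module K M' by fact
  let ?b = "\<lambda>j. T (std_basis R n j)"
  have b: "?b j \<in> carrier M" "h (?b j) \<in> carrier M'" for j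
    by (intro semilinear_in[OF assms(6)] module_hom_in[OF assms(7)] std_basis_in[OF assms(1)])+
  have x: "x j \<in> carrier R" if "j < n" for j using that assms(8) by (auto simp: carrier_std_free)
  have "T x = lin_ext R M {..<n} ?b x"
    using module_hom_eq_lin_ext[OF assms(4), of T "{..<n}" x] assms(7,8)
    by (simp add: std_free_def std_basis_eq_free_unit)
  also have "\<dots> = (\<Oplus>\<^bsub>M\<^esub>j\<in>{..<n}. x j \<odot>\<^bsub>M\<^esub> ?b j)"
    by (rule lin_ext_std[OF assms(4,8)]) (rule b)
  finally have "h (T x) = (\<Oplus>\<^bsub>M'\<^esub>j\<in>{..<n}. h (x j \<odot>\<^bsub>M\<^esub> ?b j))"
    using x b by (simp only:) (rule semilinear_finsum[OF assms(4-6)], auto)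
  also have "\<dots> = (\<Oplus>\<^bsub>M'\<^esub>j\<in>{..<n}. map_vec \<phi> n x j \<odot>\<^bsub>M'\<^esub> h (?b j))"
    using x b assms(6) ring_hom_closed[OF assms(3)]
    by (intro M'.finsum_cong') (auto simp: semilinear_def map_vec_def)
  also have "\<dots> = base_change R K n M' h T (map_vec \<phi> n x)"
    unfolding base_change_def
    using b assms(8) semilinear_in[OF semilinear_map_vec[OF assms(1-3)]] by (intro lin_ext_std[OF assms(5), symmetric]) auto
  finally show ?thesis by simp
qed

section \<open>Localization\<close>

text \<open>Operations on fractions are unions over all representatives. Such a union collapses once
  its members are shown to agree; well-definedness enters the proof in this way.\<close>

lemma UN_const:
  assumes "p \<in> X" "\<And>q. q \<in> X \<Longrightarrow> F q = c"
  shows "(\<Union>q\<in>X. F q) = c"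
  using assms by auto

locale mult_set_module = module R M for R :: "'a ring" (structure) and M :: "('a, 'b) module" +
  fixes S :: "'a set"
  assumes S_subset: "S \<subseteq> carrier R" and S_one: "\<one> \<in> S"
    and S_mult: "\<And>s t. s \<in> S \<Longrightarrow> t \<in> S \<Longrightarrow> s \<otimes> t \<in> S"
begin

abbreviation scale (infixr "\<cdot>" 70) where "a \<cdot> x \<equiv> a \<odot>\<^bsub>M\<^esub> x"
abbreviation "mfrac \<equiv> module_frac R M S"
abbreviation "MS \<equiv> localize_module R M S"

lemma S_carrier [simp, intro]: "s \<in> S \<Longrightarrow> s \<in> carrier R"
  using S_subset by auto

lemma mem_module_frac:
  "(y, t) \<in> mfrac x s \<longleftrightarrow> y \<in> carrier M \<and> t \<in> S \<and>
     (\<exists>u\<in>S. u \<cdot> (t \<cdot> x) = u \<cdot> (s \<cdot> y))"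
  by (simp add: module_frac_def)

lemma frac_trans:
  assumes "x \<in> carrier M" "y \<in> carrier M" "z \<in> carrier M" "s \<in> S" "t \<in> S" "w \<in> S"
    and 1: "\<exists>u\<in>S. u \<cdot> (t \<cdot> x) = u \<cdot> (s \<cdot> y)"
    and 2: "\<exists>u\<in>S. u \<cdot> (w \<cdot> y) = u \<cdot> (t \<cdot> z)"
  shows "\<exists>u\<in>S. u \<cdot> (w \<cdot> x) = u \<cdot> (s \<cdot> z)"
proof -
  obtain u v where u: "u \<in> S" "u \<cdot> (t \<cdot> x) = u \<cdot> (s \<cdot> y)"
    and v: "v \<in> S" "v \<cdot> (w \<cdot> y) = v \<cdot> (t \<cdot> z)" using 1 2 by blast
  note c = assms(1-6) u(1) v(1)
  \<comment> \<open>The witness needs the middle denominator \<open>t\<close> besides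
    \<open>u\<close> and \<open>v\<close>: the first relation consumes \<open>t\<close> on the side
    of \<open>x\<close>, the second one returns it on the side of \<open>z\<close>.\<close>
  have "(u \<otimes> v \<otimes> t) \<cdot> (w \<cdot> x) = v \<cdot> (w \<cdot> (u \<cdot> (t \<cdot> x)))"
    using c by (simp add: R.m_ac flip: smult_assoc1)
  also have "\<dots> = u \<cdot> (s \<cdot> (v \<cdot> (w \<cdot> y)))"
    unfolding u(2) using c by (simp add: R.m_ac flip: smult_assoc1)
  also have "\<dots> = (u \<otimes> v \<otimes> t) \<cdot> (s \<cdot> z)"
    unfolding v(2) using c by (simp add: R.m_ac flip: smult_assoc1)
  finally show ?thesis using u(1) v(1) assms(5) S_mult by blast
qed

lemma frac_sym: "\<exists>u\<in>S. u \<cdot> a = u \<cdot> b \<Longrightarrow> \<exists>u\<in>S. u \<cdot> b = u \<cdot> a"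
  by metis

lemma frac_self: "x \<in> carrier M \<Longrightarrow> s \<in> S \<Longrightarrow> (x, s) \<in> mfrac x s"
  using S_one by (auto simp: mem_module_frac)

lemma frac_eq_iff:
  assumes "x \<in> carrier M" "y \<in> carrier M" "s \<in> S" "t \<in> S"
  shows "mfrac x s = mfrac y t \<longleftrightarrow>
    (\<exists>u\<in>S. u \<cdot> (t \<cdot> x) = u \<cdot> (s \<cdot> y))"
proof
  assume "mfrac x s = mfrac y t"
  then have "(y, t) \<in> mfrac x s" using frac_self[OF assms(2,4)] by simp
  then show "\<exists>u\<in>S. u \<cdot> (t \<cdot> x) = u \<cdot> (s \<cdot> y)" by (simp add: mem_module_frac)
next
  assume xy: "\<exists>u\<in>S. u \<cdot> (t \<cdot> x) = u \<cdot> (s \<cdot> y)"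
  have "(z, w) \<in> mfrac x s \<longleftrightarrow> (z, w) \<in> mfrac y t" for z w
  proof -
    have "(\<exists>u\<in>S. u \<cdot> (w \<cdot> x) = u \<cdot> (s \<cdot> z)) \<longleftrightarrow>
        (\<exists>u\<in>S. u \<cdot> (w \<cdot> y) = u \<cdot> (t \<cdot> z))"
      if z: "z \<in> carrier M" "w \<in> S"
      using frac_trans[OF assms(1,2) z(1) assms(3,4) z(2) xy]
        frac_trans[OF assms(2,1) z(1) assms(4,3) z(2) frac_sym[OF xy]] by blast
    then show ?thesis by (auto simp: mem_module_frac)
  qed
  then show "mfrac x s = mfrac y t" by auto
qed

lemma frac_eqI:
  assumes "x \<in> carrier M" "y \<in> carrier M" "s \<in> S" "t \<in> S" "t \<cdot> x = s \<cdot> y"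
  shows "mfrac x s = mfrac y t"
  using S_one assms by (subst frac_eq_iff) auto

lemma carrier_localize_module:
  "carrier (MS) = {mfrac x s | x s. x \<in> carrier M \<and> s \<in> S}"
  by (simp add: localize_module_def)

lemma frac_in: "x \<in> carrier M \<Longrightarrow> s \<in> S \<Longrightarrow> mfrac x s \<in> carrier (MS)"
  by (auto simp: carrier_localize_module)

lemma frac_cases:
  assumes "X \<in> carrier (MS)"
  obtains x s where "X = mfrac x s" "x \<in> carrier M" "s \<in> S"
  using assms by (auto simp: carrier_localize_module)

lemma localize_add:
  assumes x: "x \<in> carrier M" and y: "y \<in> carrier M" and s: "s \<in> S" and t: "t \<in> S"
  shows "mfrac x s \<oplus>\<^bsub>MS\<^esub> mfrac y t
    = mfrac (t \<cdot> x \<oplus>\<^bsub>M\<^esub> s \<cdot> y) (s \<otimes> t)"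
proof -
  have "(\<Union>(x', s')\<in>mfrac x s. \<Union>(y', t')\<in>mfrac y t.
      mfrac (t' \<cdot> x' \<oplus>\<^bsub>M\<^esub> s' \<cdot> y') (s' \<otimes> t'))
    = mfrac (t \<cdot> x \<oplus>\<^bsub>M\<^esub> s \<cdot> y) (s \<otimes> t)"
  proof (rule UN_const[OF frac_self[OF x s]], clarify, rule UN_const[OF frac_self[OF y t]], clarify)
    fix x' s' y' t'
    assume "(x', s') \<in> mfrac x s" "(y', t') \<in> mfrac y t"
    then obtain u v where c: "x' \<in> carrier M" "y' \<in> carrier M" "s' \<in> S" "t' \<in> S" "u \<in> S" "v \<in> S"
      and u: "u \<cdot> (s' \<cdot> x) = u \<cdot> (s \<cdot> x')"
      and v: "v \<cdot> (t' \<cdot> y) = v \<cdot> (t \<cdot> y')"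
      by (auto simp: mem_module_frac)
    note c' = c x y s t
    have "(u \<otimes> v) \<cdot> ((s \<otimes> t) \<cdot> (t' \<cdot> x' \<oplus>\<^bsub>M\<^esub> s' \<cdot> y'))
        = (v \<otimes> t \<otimes> t') \<cdot> (u \<cdot> (s \<cdot> x')) \<oplus>\<^bsub>M\<^esub> (u \<otimes> s \<otimes> s') \<cdot> (v \<cdot> (t \<cdot> y'))"
      using c' by (simp add: smult_r_distr R.m_ac flip: smult_assoc1)
    also have "\<dots> = (u \<otimes> v) \<cdot> ((s' \<otimes> t') \<cdot> (t \<cdot> x \<oplus>\<^bsub>M\<^esub> s \<cdot> y))"
      unfolding u[symmetric] v[symmetric] using c' by (simp add: smult_r_distr R.m_ac flip: smult_assoc1)
    finally have "\<exists>w\<in>S. w \<cdot> ((s \<otimes> t) \<cdot> (t' \<cdot> x' \<oplus>\<^bsub>M\<^esub> s' \<cdot> y'))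
        = w \<cdot> ((s' \<otimes> t') \<cdot> (t \<cdot> x \<oplus>\<^bsub>M\<^esub> s \<cdot> y))"
      using S_mult c by blast
    then show "mfrac (t' \<cdot> x' \<oplus>\<^bsub>M\<^esub> s' \<cdot> y') (s' \<otimes> t')
        = mfrac (t \<cdot> x \<oplus>\<^bsub>M\<^esub> s \<cdot> y) (s \<otimes> t)"
      using c' S_mult by (subst frac_eq_iff) auto
  qed
  then show ?thesis by (simp add: localize_module_def)
qed

lemma localize_smult:
  assumes a: "a \<in> carrier R" and x: "x \<in> carrier M" and s: "s \<in> S" and t: "t \<in> S"
  shows "ring_frac R S a s \<odot>\<^bsub>MS\<^esub> mfrac x t
    = mfrac (a \<cdot> x) (s \<otimes> t)"
proof -
  have self: "(a, s) \<in> ring_frac R S a s"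
    using a s S_one by (auto simp: ring_frac_def)
  have "(\<Union>(a', s')\<in>ring_frac R S a s. \<Union>(x', t')\<in>mfrac x t.
      mfrac (a' \<cdot> x') (s' \<otimes> t'))
    = mfrac (a \<cdot> x) (s \<otimes> t)"
  proof (rule UN_const[OF self], clarify, rule UN_const[OF frac_self[OF x t]], clarify)
    fix a' s' x' t'
    assume "(a', s') \<in> ring_frac R S a s" "(x', t') \<in> mfrac x t"
    then obtain u v where c: "a' \<in> carrier R" "x' \<in> carrier M" "s' \<in> S" "t' \<in> S" "u \<in> S" "v \<in> S"
      and u: "u \<otimes> (s' \<otimes> a) = u \<otimes> (s \<otimes> a')"
      and v: "v \<cdot> (t' \<cdot> x) = v \<cdot> (t \<cdot> x')"
      by (auto simp: mem_module_frac ring_frac_def)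
    note c' = c a x s t
    have "(u \<otimes> v) \<cdot> ((s \<otimes> t) \<cdot> (a' \<cdot> x'))
        = (u \<otimes> (s \<otimes> a')) \<cdot> (v \<cdot> (t \<cdot> x'))"
      using c' by (simp add: R.m_ac flip: smult_assoc1)
    also have "\<dots> = (u \<otimes> v) \<cdot> ((s' \<otimes> t') \<cdot> (a \<cdot> x))"
      unfolding u[symmetric] v[symmetric] using c' by (simp add: R.m_ac flip: smult_assoc1)
    finally have "\<exists>w\<in>S. w \<cdot> ((s \<otimes> t) \<cdot> (a' \<cdot> x'))
        = w \<cdot> ((s' \<otimes> t') \<cdot> (a \<cdot> x))"
      using S_mult c by blast
    then show "mfrac (a' \<cdot> x') (s' \<otimes> t') = mfrac (a \<cdot> x) (s \<otimes> t)"
      using c' S_mult by (subst frac_eq_iff) auto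
  qed
  then show ?thesis by (simp add: localize_module_def)
qed

lemma localize_zero: "\<zero>\<^bsub>MS\<^esub> = mfrac \<zero>\<^bsub>M\<^esub> \<one>"
  by (simp add: localize_module_def)

lemma localize_abelian_group: "abelian_group (MS)"
proof (rule abelian_groupI)
  fix X Y Z
  assume "X \<in> carrier (MS)" "Y \<in> carrier (MS)" "Z \<in> carrier (MS)"
  then obtain x y z s t w where c: "x \<in> carrier M" "s \<in> S" "y \<in> carrier M" "t \<in> S" "z \<in> carrier M" "w \<in> S"
    and eq: "X = mfrac x s" "Y = mfrac y t" "Z = mfrac z w"
    by (metis frac_cases)
  show "X \<oplus>\<^bsub>MS\<^esub> Y \<oplus>\<^bsub>MS\<^esub> Z
      = X \<oplus>\<^bsub>MS\<^esub> (Y \<oplus>\<^bsub>MS\<^esub> Z)"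
    using c S_mult
    by (simp add: eq localize_add smult_r_distr R.m_ac M.a_ac flip: smult_assoc1)
next
  fix X Y
  assume "X \<in> carrier (MS)" "Y \<in> carrier (MS)"
  then obtain x y s t where c: "x \<in> carrier M" "s \<in> S" "y \<in> carrier M" "t \<in> S"
    and eq: "X = mfrac x s" "Y = mfrac y t"
    by (metis frac_cases)
  show "X \<oplus>\<^bsub>MS\<^esub> Y \<in> carrier (MS)"
    using c S_mult by (auto simp: eq localize_add intro!: frac_in)
  show "X \<oplus>\<^bsub>MS\<^esub> Y = Y \<oplus>\<^bsub>MS\<^esub> X"
    using c by (simp add: eq localize_add R.m_comm M.a_comm)
next
  fix X assume "X \<in> carrier (MS)"
  then obtain x s where c: "x \<in> carrier M" "s \<in> S" and eq: "X = mfrac x s"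
    by (metis frac_cases)
  show "\<zero>\<^bsub>MS\<^esub> \<oplus>\<^bsub>MS\<^esub> X = X"
    using c S_one by (simp add: eq localize_zero localize_add)
  have "mfrac (\<ominus>\<^bsub>M\<^esub> x) s \<oplus>\<^bsub>MS\<^esub> X = \<zero>\<^bsub>MS\<^esub>"
  proof -
    have "s \<cdot> (\<ominus>\<^bsub>M\<^esub> x) \<oplus>\<^bsub>M\<^esub> s \<cdot> x = \<zero>\<^bsub>M\<^esub>"
      using c by (simp add: M.l_neg flip: smult_r_distr)
    then have "mfrac (\<ominus>\<^bsub>M\<^esub> x) s \<oplus>\<^bsub>MS\<^esub> X = mfrac \<zero>\<^bsub>M\<^esub> (s \<otimes> s)"
      using c by (simp add: eq localize_add)
    also have "\<dots> = \<zero>\<^bsub>MS\<^esub>"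
      unfolding localize_zero using c S_one S_mult by (intro frac_eqI) auto
    finally show ?thesis .
  qed
  then show "\<exists>Y\<in>carrier (MS). Y \<oplus>\<^bsub>MS\<^esub> X = \<zero>\<^bsub>MS\<^esub>"
    by (rule bexI) (rule frac_in[OF M.a_inv_closed[OF c(1)] c(2)])
qed (auto simp: localize_zero S_one intro!: frac_in)

end

text \<open>With the ring as a module over itself, fractions of ring elements are literally
  fractions of module elements. The additive group of the localized ring and the rule for products
  are then instances of the module case.\<close>

definition regular_module :: "'a ring \<Rightarrow> ('a, 'a) module" where
  "regular_module R = \<lparr>carrier = carrier R, mult = mult R, one = one R, zero = zero R, add = add R, module.smult = mult R\<rparr>"

lemma regular_module_simps [simp]:
  "carrier (regular_module R) = carrier R" "zero (regular_module R) = zero R"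
  "add (regular_module R) = add R" "module.smult (regular_module R) = mult R"
  by (simp_all add: regular_module_def)

lemma regular_module_is_module:
  fixes R :: "'a ring" (structure)
  assumes "cring R"
  shows "module R (regular_module R)"
proof -
  interpret cring R by fact
  have "abelian_group (regular_module R)"
    by (rule abelian_groupI) (auto simp: a_ac intro: l_neg)
  then show ?thesis
    by (intro moduleI[OF assms]) (auto simp: l_distr r_distr m_assoc)
qed

lemma ring_frac_eq: "ring_frac R S = module_frac R (regular_module R) S"
  by (simp add: ring_frac_def module_frac_def fun_eq_iff)

lemma localize_ring_simps:
  "carrier (localize_ring R S) = carrier (localize_module R (regular_module R) S)"
  "add (localize_ring R S) = add (localize_module R (regular_module R) S)"
  "zero (localize_ring R S) = zero (localize_module R (regular_module R) S)"
  "mult (localize_ring R S) = module.smult (localize_module R (regular_module R) S)"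
  "one (localize_ring R S) = ring_frac R S \<one>\<^bsub>R\<^esub> \<one>\<^bsub>R\<^esub>"
  by (simp_all add: localize_ring_def localize_module_def ring_frac_eq)

text \<open>The part of \<open>mult_set_module\<close> that does not fix a module, so that the ring
  and several modules can be localized at one and the same \<open>S\<close>.\<close>

locale mult_set = cring R for R :: "'a ring" (structure) +
  fixes S :: "'a set"
  assumes S_subset: "S \<subseteq> carrier R" and S_one: "\<one> \<in> S"
    and S_mult: "\<And>s t. s \<in> S \<Longrightarrow> t \<in> S \<Longrightarrow> s \<otimes> t \<in> S"
begin

abbreviation "rfrac \<equiv> ring_frac R S"
abbreviation "RS \<equiv> localize_ring R S"

lemma mult_set_moduleI: "module R M \<Longrightarrow> mult_set_module R M S"
  using S_subset S_one S_mult by (simp add: mult_set_module_def mult_set_module_axioms_def)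

lemma cring_R: "cring R" ..

lemma regular: "mult_set_module R (regular_module R) S"
  by (rule mult_set_moduleI[OF regular_module_is_module[OF cring_R]])

lemma S_in: "s \<in> S \<Longrightarrow> s \<in> carrier R"
  using S_subset by auto

lemma ring_frac_eq_iff:
  assumes "a \<in> carrier R" "b \<in> carrier R" "s \<in> S" "t \<in> S"
  shows "rfrac a s = rfrac b t \<longleftrightarrow> (\<exists>u\<in>S. u \<otimes> (t \<otimes> a) = u \<otimes> (s \<otimes> b))"
  using mult_set_module.frac_eq_iff[OF regular] assms by (simp add: ring_frac_eq)

lemma ring_frac_in: "a \<in> carrier R \<Longrightarrow> s \<in> S \<Longrightarrow> rfrac a s \<in> carrier (RS)"
  using mult_set_module.frac_in[OF regular] by (simp add: ring_frac_eq localize_ring_simps)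

lemma ring_frac_cases:
  assumes "X \<in> carrier (RS)"
  obtains a s where "X = rfrac a s" "a \<in> carrier R" "s \<in> S"
  using mult_set_module.frac_cases[OF regular] assms by (auto simp: ring_frac_eq localize_ring_simps)

lemma ring_frac_add:
  assumes "a \<in> carrier R" "b \<in> carrier R" "s \<in> S" "t \<in> S"
  shows "rfrac a s \<oplus>\<^bsub>RS\<^esub> rfrac b t = rfrac (t \<otimes> a \<oplus> s \<otimes> b) (s \<otimes> t)"
  using mult_set_module.localize_add[OF regular] assms by (simp add: ring_frac_eq localize_ring_simps)

lemma ring_frac_mult:
  assumes "a \<in> carrier R" "b \<in> carrier R" "s \<in> S" "t \<in> S"
  shows "rfrac a s \<otimes>\<^bsub>RS\<^esub> rfrac b t = rfrac (a \<otimes> b) (s \<otimes> t)"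
  using mult_set_module.localize_smult[OF regular] assms by (simp add: ring_frac_eq localize_ring_simps)

lemma localize_ring_cring: "cring (RS)"
proof (rule cringI)
  have "abelian_group (localize_module R (regular_module R) S)"
    by (rule mult_set_module.localize_abelian_group[OF regular])
  then interpret A: abelian_group "localize_module R (regular_module R) S" .
  show "abelian_group (RS)"
    by (rule abelian_groupI) (auto simp: localize_ring_simps A.a_ac intro: A.l_neg)
  show "comm_monoid (RS)"
  proof (rule comm_monoidI)
    fix X Y Z
    assume "X \<in> carrier (RS)" "Y \<in> carrier (RS)" "Z \<in> carrier (RS)"
    then obtain x y z s t w where c: "x \<in> carrier R" "s \<in> S" "y \<in> carrier R" "t \<in> S" "z \<in> carrier R" "w \<in> S"
      and eq: "X = rfrac x s" "Y = rfrac y t" "Z = rfrac z w"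
      by (metis ring_frac_cases)
    show "X \<otimes>\<^bsub>RS\<^esub> Y \<otimes>\<^bsub>RS\<^esub> Z = X \<otimes>\<^bsub>RS\<^esub> (Y \<otimes>\<^bsub>RS\<^esub> Z)"
      using c S_mult S_in by (simp add: eq ring_frac_mult m_assoc)
  next
    fix X Y
    assume "X \<in> carrier (RS)" "Y \<in> carrier (RS)"
    then obtain x y s t where c: "x \<in> carrier R" "s \<in> S" "y \<in> carrier R" "t \<in> S"
      and eq: "X = rfrac x s" "Y = rfrac y t"
      by (metis ring_frac_cases)
    show "X \<otimes>\<^bsub>RS\<^esub> Y \<in> carrier (RS)"
      using c S_mult by (auto simp: eq ring_frac_mult intro!: ring_frac_in)
    show "X \<otimes>\<^bsub>RS\<^esub> Y = Y \<otimes>\<^bsub>RS\<^esub> X"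
      using c S_in by (simp add: eq ring_frac_mult m_comm)
  next
    fix X assume "X \<in> carrier (RS)"
    then obtain x s where c: "x \<in> carrier R" "s \<in> S" and eq: "X = rfrac x s"
      by (metis ring_frac_cases)
    show "\<one>\<^bsub>RS\<^esub> \<otimes>\<^bsub>RS\<^esub> X = X"
      using c S_one S_in by (simp add: eq localize_ring_simps(5) ring_frac_mult)
  qed (simp add: localize_ring_simps(5) ring_frac_in S_one)
next
  fix X Y Z
  assume "X \<in> carrier (RS)" "Y \<in> carrier (RS)" "Z \<in> carrier (RS)"
  then obtain x y z s t w where c: "x \<in> carrier R" "s \<in> S" "y \<in> carrier R" "t \<in> S" "z \<in> carrier R" "w \<in> S"
    and eq: "X = rfrac x s" "Y = rfrac y t" "Z = rfrac z w"
    by (metis ring_frac_cases)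
  show "(X \<oplus>\<^bsub>RS\<^esub> Y) \<otimes>\<^bsub>RS\<^esub> Z
      = X \<otimes>\<^bsub>RS\<^esub> Z \<oplus>\<^bsub>RS\<^esub> Y \<otimes>\<^bsub>RS\<^esub> Z"
    using c S_mult S_in S_one
    by (simp add: eq ring_frac_mult ring_frac_add) (subst ring_frac_eq_iff; auto intro!: bexI[of _ \<one>] simp: l_distr r_distr m_ac)
qed

lemma localize_module_is_module:
  assumes "module R M"
  shows "module (RS) (localize_module R M S)"
proof -
  interpret mult_set_module R M S by (rule mult_set_moduleI) fact
  show ?thesis
  proof (rule moduleI[OF localize_ring_cring localize_abelian_group])
    fix A X assume "A \<in> carrier (RS)" "X \<in> carrier (MS)"
    then obtain a s x t where c: "a \<in> carrier R" "s \<in> S" "x \<in> carrier M" "t \<in> S"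
      and eq: "A = rfrac a s" "X = mfrac x t"
      by (metis ring_frac_cases frac_cases)
    show "A \<odot>\<^bsub>MS\<^esub> X \<in> carrier (MS)"
      using c S_mult by (auto simp: eq localize_smult intro!: frac_in)
  next
    fix A B X assume "A \<in> carrier (RS)" "B \<in> carrier (RS)" "X \<in> carrier (MS)"
    then obtain a s b w x t where c: "a \<in> carrier R" "s \<in> S" "b \<in> carrier R" "w \<in> S" "x \<in> carrier M" "t \<in> S"
      and eq: "A = rfrac a s" "B = rfrac b w" "X = mfrac x t"
      by (metis ring_frac_cases frac_cases)
    show "(A \<oplus>\<^bsub>RS\<^esub> B) \<odot>\<^bsub>MS\<^esub> X
        = A \<odot>\<^bsub>MS\<^esub> X \<oplus>\<^bsub>MS\<^esub> B \<odot>\<^bsub>MS\<^esub> X"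
      using c S_mult S_one
      by (simp add: eq ring_frac_add localize_smult localize_add)
        (rule frac_eqI; simp add: smult_l_distr smult_r_distr m_ac flip: smult_assoc1)
    show "(A \<otimes>\<^bsub>RS\<^esub> B) \<odot>\<^bsub>MS\<^esub> X
        = A \<odot>\<^bsub>MS\<^esub> (B \<odot>\<^bsub>MS\<^esub> X)"
      using c S_mult by (simp add: eq ring_frac_mult localize_smult smult_assoc1 m_assoc)
  next
    fix A X Y assume "A \<in> carrier (RS)" "X \<in> carrier (MS)" "Y \<in> carrier (MS)"
    then obtain a s y w x t where c: "a \<in> carrier R" "s \<in> S" "y \<in> carrier M" "w \<in> S" "x \<in> carrier M" "t \<in> S"
      and eq: "A = rfrac a s" "Y = mfrac y w" "X = mfrac x t"
      by (metis ring_frac_cases frac_cases)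
    show "A \<odot>\<^bsub>MS\<^esub> (X \<oplus>\<^bsub>MS\<^esub> Y)
        = A \<odot>\<^bsub>MS\<^esub> X \<oplus>\<^bsub>MS\<^esub> A \<odot>\<^bsub>MS\<^esub> Y"
      using c S_mult S_one
      by (simp add: eq localize_smult localize_add)
        (rule frac_eqI; simp add: smult_l_distr smult_r_distr m_ac flip: smult_assoc1)
  next
    fix X assume "X \<in> carrier (MS)"
    then obtain x t where c: "x \<in> carrier M" "t \<in> S" and eq: "X = mfrac x t"
      by (metis frac_cases)
    show "\<one>\<^bsub>RS\<^esub> \<odot>\<^bsub>MS\<^esub> X = X"
      using c S_one by (simp add: eq localize_ring_simps(5) localize_smult)
  qed
qed

end

text \<open>Localization described by what it does: \<open>S\<close> becomes invertible, every
  element is a numerator up to \<open>S\<close>, and the kernel is \<open>S\<close>-torsion. The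
  arguments on denominators and exactness use these clauses and never look inside a
  fraction.\<close>

definition is_localization :: "'a ring \<Rightarrow> 'a set \<Rightarrow> 'k ring \<Rightarrow> ('a \<Rightarrow> 'k) \<Rightarrow> bool" where
  "is_localization R S L \<phi> \<longleftrightarrow> \<phi> \<in> Ring.ring_hom R L \<and> (\<forall>s\<in>S. \<phi> s \<in> Units L) \<and>
     (\<forall>z\<in>carrier L. \<exists>s\<in>S. \<exists>a\<in>carrier R. \<phi> s \<otimes>\<^bsub>L\<^esub> z = \<phi> a) \<and>
     (\<forall>a\<in>carrier R. \<phi> a = \<zero>\<^bsub>L\<^esub> \<longrightarrow> (\<exists>u\<in>S. u \<otimes>\<^bsub>R\<^esub> a = \<zero>\<^bsub>R\<^esub>))"

definition is_module_localization ::
  "'a ring \<Rightarrow> 'a set \<Rightarrow> ('a \<Rightarrow> 'k) \<Rightarrow> ('a, 'b) module \<Rightarrow> ('k, 'c) module \<Rightarrow> ('b \<Rightarrow> 'c) \<Rightarrow> bool" where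
  "is_module_localization R S \<phi> M M' h \<longleftrightarrow> semilinear \<phi> R M M' h \<and>
     (\<forall>y\<in>carrier M'. \<exists>s\<in>S. \<exists>x\<in>carrier M. \<phi> s \<odot>\<^bsub>M'\<^esub> y = h x) \<and>
     (\<forall>x\<in>carrier M. h x = \<zero>\<^bsub>M'\<^esub> \<longrightarrow> (\<exists>u\<in>S. u \<odot>\<^bsub>M\<^esub> x = \<zero>\<^bsub>M\<^esub>))"

context mult_set
begin

abbreviation loc :: "'a \<Rightarrow> ('a \<times> 'a) set" where
  "loc a \<equiv> rfrac a \<one>"

lemma loc_hom: "loc \<in> Ring.ring_hom R (RS)"
proof (rule ring_hom_memI)
  fix a b assume "a \<in> carrier R" "b \<in> carrier R"
  then show "loc (a \<otimes> b) = loc a \<otimes>\<^bsub>RS\<^esub> loc b"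
    "loc (a \<oplus> b) = loc a \<oplus>\<^bsub>RS\<^esub> loc b"
    using S_one by (simp_all add: ring_frac_mult ring_frac_add)
qed (auto simp: localize_ring_simps(5) S_one intro!: ring_frac_in)

lemma loc_unit:
  assumes "s \<in> S"
  shows "loc s \<in> Units (RS)"
proof -
  interpret L: cring "RS" by (rule localize_ring_cring)
  have "rfrac \<one> s \<otimes>\<^bsub>RS\<^esub> loc s = \<one>\<^bsub>RS\<^esub>"
    using assms S_one S_in
    by (simp add: ring_frac_mult localize_ring_simps(5)) (subst ring_frac_eq_iff; auto)
  moreover have "rfrac \<one> s \<in> carrier (RS)" "loc s \<in> carrier (RS)"
    using assms S_one S_in by (auto intro!: ring_frac_in)
  ultimately show ?thesis using L.m_comm unfolding Units_def by fastforce
qed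

lemma is_localization_loc: "is_localization R S (RS) loc"
  unfolding is_localization_def
proof (intro conjI ballI impI)
  fix z assume "z \<in> carrier (RS)"
  then obtain a s where z: "z = rfrac a s" "a \<in> carrier R" "s \<in> S" by (rule ring_frac_cases)
  have "loc s \<otimes>\<^bsub>RS\<^esub> z = loc a"
    using z S_one S_in by (simp add: ring_frac_mult) (subst ring_frac_eq_iff; auto)
  then show "\<exists>s\<in>S. \<exists>a\<in>carrier R. loc s \<otimes>\<^bsub>RS\<^esub> z = loc a" using z by blast
next
  fix a assume a: "a \<in> carrier R" "loc a = \<zero>\<^bsub>RS\<^esub>"
  then have "rfrac a \<one> = rfrac \<zero> \<one>" by (simp add: localize_ring_def)
  then show "\<exists>u\<in>S. u \<otimes> a = \<zero>" using a S_one S_in by (subst (asm) ring_frac_eq_iff) auto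
qed (auto simp: loc_hom loc_unit)

lemma is_module_localization_loc:
  assumes "module R M"
  shows "is_module_localization R S loc M (localize_module R M S) (\<lambda>x. module_frac R M S x \<one>)"
proof -
  interpret mult_set_module R M S by (rule mult_set_moduleI) fact
  show ?thesis
    unfolding is_module_localization_def semilinear_def
  proof (intro conjI ballI impI)
    fix y assume "y \<in> carrier (localize_module R M S)"
    then obtain x s where y: "y = module_frac R M S x s" "x \<in> carrier M" "s \<in> S" by (rule frac_cases)
    have "loc s \<odot>\<^bsub>localize_module R M S\<^esub> y = module_frac R M S x \<one>"
      using y S_one by (simp add: localize_smult) (rule frac_eqI; simp)
    then show "\<exists>s\<in>S. \<exists>x\<in>carrier M. loc s \<odot>\<^bsub>localize_module R M S\<^esub> y = module_frac R M S x \<one>" using y by blast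
  next
    fix x assume x: "x \<in> carrier M" "module_frac R M S x \<one> = \<zero>\<^bsub>localize_module R M S\<^esub>"
    then show "\<exists>u\<in>S. u \<odot>\<^bsub>M\<^esub> x = \<zero>\<^bsub>M\<^esub>"
      using S_one by (simp add: localize_zero frac_eq_iff)
  qed (use S_one in \<open>auto simp: localize_add localize_smult intro!: frac_in\<close>)
qed

end

section \<open>Denominators, annihilators and exactness under localization\<close>

lemma localization_common_denominator:
  fixes R :: "'a ring" (structure) and L :: "'k ring"
  assumes S: "mult_set R S" and hom: "\<phi> \<in> Ring.ring_hom R L"
    and M: "module R M" and M': "module L M'" and h: "is_module_localization R S \<phi> M M' h"
    and y: "\<And>i. i < (n :: nat) \<Longrightarrow> y i \<in> carrier M'"
  shows "\<exists>s\<in>S. \<forall>i<n. \<exists>x\<in>carrier M. \<phi> s \<odot>\<^bsub>M'\<^esub> y i = h x"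
  using y
proof (induction n)
  case 0
  then show ?case using mult_set.S_one[OF S] by auto
next
  case (Suc n)
  interpret mult_set R S by fact
  interpret M: module R M by fact
  interpret M': module L M' by fact
  note hc = ring_hom_closed[OF hom] and hm = ring_hom_mult[OF hom]
  have sm: "h (r \<odot>\<^bsub>M\<^esub> x) = \<phi> r \<odot>\<^bsub>M'\<^esub> h x" if "r \<in> carrier R" "x \<in> carrier M" for r x
    using h that by (simp add: is_module_localization_def semilinear_def)
  obtain s where s: "s \<in> S" "\<forall>i<n. \<exists>x\<in>carrier M. \<phi> s \<odot>\<^bsub>M'\<^esub> y i = h x" using Suc by auto
  obtain t a where t: "t \<in> S" "a \<in> carrier M" "\<phi> t \<odot>\<^bsub>M'\<^esub> y n = h a"
    using h Suc.prems[of n] unfolding is_module_localization_def by blast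
  have "\<exists>x\<in>carrier M. \<phi> (s \<otimes> t) \<odot>\<^bsub>M'\<^esub> y i = h x" if i: "i < Suc n" for i
  proof (cases "i = n")
    case True
    have "\<phi> (s \<otimes> t) \<odot>\<^bsub>M'\<^esub> y i = h (s \<odot>\<^bsub>M\<^esub> a)"
      using s t Suc.prems[of n] by (simp add: True hm hc S_in M'.smult_assoc1 sm)
    then show ?thesis using s t S_in by blast
  next
    case False
    then obtain b where b: "b \<in> carrier M" "\<phi> s \<odot>\<^bsub>M'\<^esub> y i = h b" using s(2) i less_antisym by blast
    have "\<phi> (s \<otimes> t) \<odot>\<^bsub>M'\<^esub> y i = (\<phi> t \<otimes>\<^bsub>L\<^esub> \<phi> s) \<odot>\<^bsub>M'\<^esub> y i"
      using s t by (simp add: hm hc S_in M'.m_comm)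
    also have "\<dots> = h (t \<odot>\<^bsub>M\<^esub> b)"
      using b s t Suc.prems[OF i] by (simp add: hc S_in M'.smult_assoc1 sm)
    finally show ?thesis using b t S_in by blast
  qed
  then show ?case using s t S_mult by blast
qed

lemma common_annihilator:
  fixes R :: "'a ring" (structure)
  assumes S: "mult_set R S" and M: "module R M" and x: "\<And>i. i < (n :: nat) \<Longrightarrow> x i \<in> carrier M \<and> (\<exists>u\<in>S. u \<odot>\<^bsub>M\<^esub> x i = \<zero>\<^bsub>M\<^esub>)"
  shows "\<exists>u\<in>S. \<forall>i<n. u \<odot>\<^bsub>M\<^esub> x i = \<zero>\<^bsub>M\<^esub>"
  using x
proof (induction n)
  case 0
  then show ?case using mult_set.S_one[OF S] by auto
next
  case (Suc n)
  interpret mult_set R S by fact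
  interpret M: module R M by fact
  obtain u where u: "u \<in> S" "\<forall>i<n. u \<odot>\<^bsub>M\<^esub> x i = \<zero>\<^bsub>M\<^esub>" using Suc by auto
  obtain v where v: "v \<in> S" "v \<odot>\<^bsub>M\<^esub> x n = \<zero>\<^bsub>M\<^esub>" using Suc.prems[of n] by auto
  have "(u \<otimes> v) \<odot>\<^bsub>M\<^esub> x i = \<zero>\<^bsub>M\<^esub>" if i: "i < Suc n" for i
  proof (cases "i = n")
    case True
    then show ?thesis using u v Suc.prems[OF i] by (simp add: M.smult_assoc1 S_in)
  next
    case False
    then have "(v \<otimes> u) \<odot>\<^bsub>M\<^esub> x i = \<zero>\<^bsub>M\<^esub>"
      using u v i Suc.prems[OF i] by (simp add: M.smult_assoc1 S_in)
    then show ?thesis using u v by (simp add: m_comm S_in)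
  qed
  then show ?case using u v S_mult by blast
qed

text \<open>Localization commutes with finite free modules: a vector has finitely many coordinates,
  so these share a denominator, and if they all die in \<open>L\<close>, they share an annihilator
  in \<open>S\<close>.\<close>

lemma is_module_localization_map_vec:
  fixes R :: "'a ring" (structure) and L :: "'k ring"
  assumes S: "mult_set R S" and L: "cring L" "is_localization R S L \<phi>"
  shows "is_module_localization R S \<phi> (std_free R n) (std_free L n) (map_vec \<phi> n)"
  unfolding is_module_localization_def
proof (intro conjI ballI impI)
  interpret mult_set R S by fact
  interpret L: cring L by fact
  have hom: "\<phi> \<in> Ring.ring_hom R L" using L by (simp add: is_localization_def)
  show "semilinear \<phi> R (std_free R n) (std_free L n) (map_vec \<phi> n)"
    by (rule semilinear_map_vec[OF cring_R L(1) hom])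
  {
    fix y assume y: "y \<in> carrier (std_free L n)"
    obtain s where s: "s \<in> S" "\<forall>i<n. \<exists>a\<in>carrier R. \<phi> s \<otimes>\<^bsub>L\<^esub> y i = \<phi> a"
      using localization_common_denominator[OF S hom regular_module_is_module[OF cring_R]
          regular_module_is_module[OF L(1)], of \<phi> n y] L(2) y hom
      by (auto simp: carrier_std_free is_localization_def is_module_localization_def semilinear_def
          ring_hom_add ring_hom_mult ring_hom_closed)
    then obtain x where x: "\<forall>i<n. x i \<in> carrier R \<and> \<phi> s \<otimes>\<^bsub>L\<^esub> y i = \<phi> (x i)" by metis
    have "\<phi> s \<odot>\<^bsub>std_free L n\<^esub> y = map_vec \<phi> n (restrict x {..<n})"
      using x by (auto simp: std_free_ops[OF L(1)] map_vec_def fun_eq_iff)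
    moreover have "restrict x {..<n} \<in> carrier (std_free R n)" using x by (auto simp: carrier_std_free)
    ultimately show "\<exists>s\<in>S. \<exists>x\<in>carrier (std_free R n). \<phi> s \<odot>\<^bsub>std_free L n\<^esub> y = map_vec \<phi> n x"
      using s(1) by blast
  }
  {
    fix x assume x: "x \<in> carrier (std_free R n)" "map_vec \<phi> n x = \<zero>\<^bsub>std_free L n\<^esub>"
    have xi: "x i \<in> carrier (regular_module R) \<and> (\<exists>u\<in>S. u \<odot>\<^bsub>regular_module R\<^esub> x i = \<zero>\<^bsub>regular_module R\<^esub>)"
      if i: "i < n" for i
    proof -
      have "map_vec \<phi> n x i = \<zero>\<^bsub>std_free L n\<^esub> i" using x(2) by simp
      then have "\<phi> (x i) = \<zero>\<^bsub>L\<^esub>" using i by (simp add: map_vec_def std_free_ops[OF L(1)])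
      moreover have "x i \<in> carrier R" using x i by (auto simp: carrier_std_free)
      ultimately show ?thesis using L(2) by (simp add: is_localization_def)
    qed
    obtain u where u: "u \<in> S" "\<forall>i<n. u \<otimes> x i = \<zero>"
      using common_annihilator[OF S regular_module_is_module[OF cring_R], of n x] xi by auto
    then have "u \<odot>\<^bsub>std_free R n\<^esub> x = \<zero>\<^bsub>std_free R n\<^esub>"
      by (auto simp: std_free_ops[OF cring_R] fun_eq_iff)
    then show "\<exists>u\<in>S. u \<odot>\<^bsub>std_free R n\<^esub> x = \<zero>\<^bsub>std_free R n\<^esub>" using u(1) by blast
  }
qed

lemma smult_unit_cancel:
  assumes "module L M" "c \<in> Units L" "y \<in> carrier M"
  shows "inv\<^bsub>L\<^esub> c \<odot>\<^bsub>M\<^esub> (c \<odot>\<^bsub>M\<^esub> y) = y"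
proof -
  interpret module L M by fact
  have "inv\<^bsub>L\<^esub> c \<odot>\<^bsub>M\<^esub> (c \<odot>\<^bsub>M\<^esub> y) = (inv\<^bsub>L\<^esub> c \<otimes>\<^bsub>L\<^esub> c) \<odot>\<^bsub>M\<^esub> y"
    using assms by (intro smult_assoc1[symmetric]) auto
  also have "\<dots> = y" using assms by (simp only: R.Units_l_inv smult_one)
  finally show ?thesis .
qed

lemma localization_surj:
  fixes R :: "'a ring" (structure) and L :: "'k ring"
  assumes L: "is_localization R S L \<phi>"
    and A': "module L A'" and B': "module L B'"
    and hA: "is_module_localization R S \<phi> A A' hA" and hB: "is_module_localization R S \<phi> B B' hB"
    and f': "f' \<in> module_hom L A' B'" and comm: "\<And>x. x \<in> carrier A \<Longrightarrow> f' (hA x) = hB (f x)"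
    and surj: "f ` carrier A = carrier B"
  shows "f' ` carrier A' = carrier B'"
proof (intro equalityI subsetI)
  interpret A': module L A' by fact
  fix y assume y: "y \<in> carrier B'"
  obtain s x where s: "s \<in> S" "x \<in> carrier B" "\<phi> s \<odot>\<^bsub>B'\<^esub> y = hB x"
    using hB y unfolding is_module_localization_def by blast
  obtain a where a: "a \<in> carrier A" "x = f a" using surj s(2) by auto
  have u: "\<phi> s \<in> Units L" using L s by (simp add: is_localization_def)
  have a': "hA a \<in> carrier A'" using hA a by (auto simp: is_module_localization_def intro: semilinear_in)
  have "f' (inv\<^bsub>L\<^esub> (\<phi> s) \<odot>\<^bsub>A'\<^esub> hA a) = inv\<^bsub>L\<^esub> (\<phi> s) \<odot>\<^bsub>B'\<^esub> (\<phi> s \<odot>\<^bsub>B'\<^esub> y)"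
    using u a' by (simp add: module_hom_smult[OF f'] comm a s)
  also have "\<dots> = y" by (rule smult_unit_cancel[OF B' u y])
  finally show "y \<in> f' ` carrier A'" using a' u by (metis A'.R.Units_inv_closed A'.smult_closed image_eqI)
qed (use module_hom_in[OF f'] in auto)

text \<open>The diagram chase for flatness of localization. A cycle \<open>y\<close> becomes the
  image of some \<open>x\<close> after multiplication by s; \<open>g x\<close> is killed by some u,
  so u x is a boundary \<open>f a\<close>, and \<open>y\<close> is the image of a/(us). Conversely,
  after multiplication by a denominator a boundary comes from a boundary of the original
  complex.\<close>

lemma localization_exact:
  fixes R :: "'a ring" (structure) and L :: "'k ring"
  assumes S: "mult_set R S" and L: "is_localization R S L \<phi>"
    and B: "module R B" and C: "module R C"
    and A': "module L A'" and B': "module L B'" and C': "module L C'"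
    and hA: "is_module_localization R S \<phi> A A' hA" and hB: "is_module_localization R S \<phi> B B' hB"
    and hC: "is_module_localization R S \<phi> C C' hC"
    and g: "g \<in> module_hom R B C" and f': "f' \<in> module_hom L A' B'" and g': "g' \<in> module_hom L B' C'"
    and commf: "\<And>x. x \<in> carrier A \<Longrightarrow> f' (hA x) = hB (f x)"
    and commg: "\<And>x. x \<in> carrier B \<Longrightarrow> g' (hB x) = hC (g x)"
    and exact: "exact_at A f B g C"
  shows "exact_at A' f' B' g' C'"
  unfolding exact_at_def
proof (intro equalityI subsetI)
  interpret mult_set R S by fact
  interpret B: module R B by fact
  interpret C: module R C by fact
  interpret A': module L A' by fact
  interpret B': module L B' by fact
  interpret C': module L C' by fact
  have unit: "\<phi> s \<in> Units L" if "s \<in> S" for s using L that by (simp add: is_localization_def)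
  have hom: "\<phi> \<in> Ring.ring_hom R L" using L by (simp add: is_localization_def)
  have sl: "semilinear \<phi> R A A' hA" "semilinear \<phi> R B B' hB" "semilinear \<phi> R C C' hC"
    using hA hB hC by (auto simp: is_module_localization_def)
  {
    fix y assume "y \<in> f' ` carrier A'"
    then obtain a' where a': "a' \<in> carrier A'" "y = f' a'" by auto
    obtain s a where s: "s \<in> S" "a \<in> carrier A" "\<phi> s \<odot>\<^bsub>A'\<^esub> a' = hA a"
      using hA a'(1) unfolding is_module_localization_def by blast
    note u = unit[OF s(1)]
    have y: "y \<in> carrier B'" using a' module_hom_in[OF f'] by simp
    have fa: "f a \<in> carrier B" "g (f a) = \<zero>\<^bsub>C\<^esub>" using exact s(2) unfolding exact_at_def by auto
    have "\<phi> s \<odot>\<^bsub>C'\<^esub> g' y = g' (f' (\<phi> s \<odot>\<^bsub>A'\<^esub> a'))"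
      using u a' y module_hom_in[OF f'] by (simp add: module_hom_smult[OF f'] module_hom_smult[OF g'] A'.R.Units_closed)
    also have "\<dots> = \<zero>\<^bsub>C'\<^esub>"
      using s fa semilinear_zero[OF C C' sl(3)] by (simp add: commf commg)
    finally have "inv\<^bsub>L\<^esub> (\<phi> s) \<odot>\<^bsub>C'\<^esub> (\<phi> s \<odot>\<^bsub>C'\<^esub> g' y) = \<zero>\<^bsub>C'\<^esub>" using u by simp
    then show "y \<in> {x \<in> carrier B'. g' x = \<zero>\<^bsub>C'\<^esub>}"
      using smult_unit_cancel[OF C' u module_hom_in[OF g' y]] y by simp
  }
  {
    fix y assume "y \<in> {x \<in> carrier B'. g' x = \<zero>\<^bsub>C'\<^esub>}"
    then have y: "y \<in> carrier B'" "g' y = \<zero>\<^bsub>C'\<^esub>" by auto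
    obtain s x where s: "s \<in> S" "x \<in> carrier B" "\<phi> s \<odot>\<^bsub>B'\<^esub> y = hB x"
      using hB y(1) unfolding is_module_localization_def by blast
    have gx: "g x \<in> carrier C" using s module_hom_in[OF g] by simp
    have "hC (g x) = g' (\<phi> s \<odot>\<^bsub>B'\<^esub> y)" using s commg by simp
    also have "\<dots> = \<zero>\<^bsub>C'\<^esub>" using y unit[OF s(1)] by (simp add: module_hom_smult[OF g'] A'.R.Units_closed)
    finally obtain u where u: "u \<in> S" "u \<odot>\<^bsub>C\<^esub> g x = \<zero>\<^bsub>C\<^esub>"
      using hC gx unfolding is_module_localization_def by blast
    have ux: "u \<odot>\<^bsub>B\<^esub> x \<in> carrier B" "g (u \<odot>\<^bsub>B\<^esub> x) = \<zero>\<^bsub>C\<^esub>"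
      using u s S_in by (auto simp: module_hom_smult[OF g])
    then have "u \<odot>\<^bsub>B\<^esub> x \<in> f ` carrier A" using exact unfolding exact_at_def by auto
    then obtain a where a: "a \<in> carrier A" "u \<odot>\<^bsub>B\<^esub> x = f a" by auto
    define c where "c = \<phi> u \<otimes>\<^bsub>L\<^esub> \<phi> s"
    have c: "c \<in> Units L" unfolding c_def using unit u s by simp
    have a': "hA a \<in> carrier A'" using semilinear_in[OF sl(1) a(1)] .
    have "c \<odot>\<^bsub>B'\<^esub> y = \<phi> u \<odot>\<^bsub>B'\<^esub> hB x"
      unfolding c_def using unit u s y by (simp add: B'.smult_assoc1 A'.R.Units_closed)
    also have "\<dots> = hB (u \<odot>\<^bsub>B\<^esub> x)" using sl(2) u s S_in by (simp add: semilinear_def)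
    also have "\<dots> = f' (hA a)" using a commf by simp
    finally have "c \<odot>\<^bsub>B'\<^esub> y = f' (hA a)" .
    then have "y = inv\<^bsub>L\<^esub> c \<odot>\<^bsub>B'\<^esub> f' (hA a)" using smult_unit_cancel[OF B' c y(1)] by simp
    also have "\<dots> = f' (inv\<^bsub>L\<^esub> c \<odot>\<^bsub>A'\<^esub> hA a)" using c a' by (simp add: module_hom_smult[OF f'])
    finally show "y \<in> f' ` carrier A'" using c a' by (metis A'.R.Units_inv_closed A'.smult_closed image_eqI)
  }
qed

section \<open>Dimensions of images and kernels\<close>

definition vdim :: "'k ring \<Rightarrow> ('k, 'b) module \<Rightarrow> 'b set \<Rightarrow> nat" where
  "vdim K V A = vectorspace.dim K (V\<lparr>carrier := A\<rparr>)"

lemma vectorspaceI: "field K \<Longrightarrow> module K V \<Longrightarrow> vectorspace K V"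
  by (simp add: vectorspace_def)

lemma hom_image_submodule:
  assumes "module R M" "module R N" "f \<in> module_hom R M N"
  shows "submodule R (f ` carrier M) N"
proof -
  interpret mod_hom R M N f using assms by (simp add: mod_hom_def mod_hom_axioms_def)
  show ?thesis using im_is_submodule by (simp add: im_def)
qed

lemma hom_kernel_submodule:
  assumes "module R M" "module R N" "f \<in> module_hom R M N"
  shows "submodule R {x \<in> carrier M. f x = \<zero>\<^bsub>N\<^esub>} M"
proof -
  interpret mod_hom R M N f using assms by (simp add: mod_hom_def mod_hom_axioms_def)
  show ?thesis using ker_is_submodule by (simp add: ker_def)
qed

lemma vdim_rank_nullity:
  assumes "field K" "module K V" "module K W" "T \<in> module_hom K V W" "vectorspace.fin_dim K V"
  shows "vdim K W (T ` carrier V) + vdim K V {x \<in> carrier V. T x = \<zero>\<^bsub>W\<^esub>} = vectorspace.dim K V"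
proof -
  interpret linear_map K V W T
    using assms by (simp add: linear_map_def mod_hom_def mod_hom_axioms_def vectorspaceI)
  show ?thesis using rank_nullity[OF assms(5)] by (simp add: vdim_def im_def ker_def)
qed

lemma vdim_zero:
  assumes "vectorspace K V"
  shows "vdim K V {\<zero>\<^bsub>V\<^esub>} = 0"
proof -
  interpret V: vectorspace K V by fact
  have "subspace K {\<zero>\<^bsub>V\<^esub>} V"
    using assms by (auto simp: subspace_def submodule_def V.module_axioms)
  then interpret Z: vectorspace K "V.vs {\<zero>\<^bsub>V\<^esub>}" by (rule V.subspace_is_vs)
  have "Z.span {} = {\<zero>\<^bsub>V\<^esub>}" by (auto simp: Z.span_def Z.lincomb_def)
  then have "Z.dim \<le> card ({} :: 'b set)" by (intro Z.gen_ge_dim) auto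
  then show ?thesis by (simp add: vdim_def)
qed

lemma vdim_carrier: "vdim K V (carrier V) = vectorspace.dim K V"
  by (simp add: vdim_def)

lemma std_free_basis:
  fixes K :: "'k ring" (structure)
  assumes "field K"
  shows "vectorspace.fin_dim K (std_free K n)" "vectorspace.dim K (std_free K n) = n"
proof -
  interpret field K by fact
  have cr: "cring K" ..
  interpret V: vectorspace K "std_free K n" by (rule vectorspaceI[OF assms std_free_is_module[OF cr]])
  let ?e = "std_basis K n" and ?B = "std_basis K n ` {..<n}"
  have inj: "inj_on ?e {..<n}"
  proof (rule inj_onI)
    fix i j assume ij: "i \<in> {..<n}" "j \<in> {..<n}" and eq: "?e i = ?e j"
    have "?e i i = ?e j i" by (simp only: eq)
    then show "i = j" using ij by (auto simp: std_basis_def split: if_splits)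
  qed
  have sub: "?B \<subseteq> carrier (std_free K n)" using std_basis_in[OF cr] by auto
  have lin: "V.lincomb a ?B = (\<lambda>i\<in>{..<n}. a (?e i))" if a: "a \<in> ?B \<rightarrow> carrier K" for a
  proof -
    have ai: "a (?e i) \<in> carrier K" if "i < n" for i using a that by auto
    have w: "(\<lambda>i\<in>{..<n}. a (?e i)) \<in> carrier (std_free K n)" using ai by (auto simp: carrier_std_free)
    have "V.lincomb a ?B = (\<Oplus>\<^bsub>std_free K n\<^esub>i\<in>{..<n}. a (?e i) \<odot>\<^bsub>std_free K n\<^esub> ?e i)"
      unfolding V.lincomb_def using inj ai std_basis_in[OF cr] by (intro V.M.finsum_reindex) auto
    also have "\<dots> = (\<Oplus>\<^bsub>std_free K n\<^esub>i\<in>{..<n}. (\<lambda>i\<in>{..<n}. a (?e i)) i \<odot>\<^bsub>std_free K n\<^esub> ?e i)"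
      using ai std_basis_in[OF cr] by (intro V.M.finsum_cong') auto
    also have "\<dots> = lin_ext K (std_free K n) {..<n} ?e (\<lambda>i\<in>{..<n}. a (?e i))"
      by (rule lin_ext_std[OF std_free_is_module[OF cr] w std_basis_in[OF cr], symmetric])
    also have "\<dots> = (\<lambda>i\<in>{..<n}. a (?e i))"
      using free_module_expand[OF cr, of "\<lambda>i\<in>{..<n}. a (?e i)" "{..<n}"] w by (simp add: std_free_def std_basis_eq_free_unit)
    finally show ?thesis .
  qed
  have "V.basis ?B"
  proof (subst V.basis_criterion[OF finite_imageI[OF finite_lessThan] sub], intro allI impI)
    fix v assume v: "v \<in> carrier (std_free K n)"
    define a where "a = (\<lambda>b\<in>?B. v (inv_into {..<n} ?e b))"
    have ae: "a (?e i) = v i" if "i < n" for i using that inj by (simp add: a_def)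
    have a: "a \<in> ?B \<rightarrow>\<^sub>E carrier K"
    proof (rule PiE_I)
      fix b assume "b \<in> ?B"
      then show "a b \<in> carrier K" using ae v by (auto simp: carrier_std_free)
    qed (simp add: a_def)
    show "\<exists>!a. a \<in> ?B \<rightarrow>\<^sub>E carrier K \<and> V.lincomb a ?B = v"
    proof (rule ex1I[of _ a], intro conjI)
      show "V.lincomb a ?B = v"
        using a ae v by (subst lin) (auto simp: carrier_std_free fun_eq_iff PiE_def extensional_def)
    next
      fix b assume b: "b \<in> ?B \<rightarrow>\<^sub>E carrier K \<and> V.lincomb b ?B = v"
      then have "(\<lambda>i\<in>{..<n}. b (?e i)) = v" using lin[of b] by (simp add: PiE_def)
      then have "b (?e i) = a (?e i)" if "i < n" for i using ae[OF that] that by (metis restrict_apply' lessThan_iff)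
      then show "b = a" using a b by (intro PiE_ext[of b ?B "\<lambda>_. carrier K" a]) auto
    qed (rule a)
  qed
  then show "V.fin_dim" "V.dim = n"
    using V.dim_basis[of ?B] inj by (auto simp: V.fin_dim_def V.basis_def card_image)
qed

section \<open>Minors\<close>

text \<open>The index maps \<open>f\<close> and \<open>g\<close> are arbitrary, in contrast to those
  in \<open>minors_ideal\<close>: a bordered minor appends an index in the last place, wherever it
  falls in the order.\<close>

definition minor :: "'a ring \<Rightarrow> nat \<Rightarrow> ((nat \<Rightarrow> 'a) \<Rightarrow> nat \<Rightarrow> 'a) \<Rightarrow> nat \<Rightarrow> (nat \<Rightarrow> nat) \<Rightarrow> (nat \<Rightarrow> nat) \<Rightarrow> 'a" where
  "minor R n T m f g = ring_det R m (\<lambda>i j. T (std_basis R n (g j)) (f i))"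

definition selection :: "nat \<Rightarrow> nat \<Rightarrow> (nat \<Rightarrow> nat) \<Rightarrow> bool" where
  "selection m l f \<longleftrightarrow> strict_mono_on {..<m} f \<and> f ` {..<m} \<subseteq> {..<l}"

lemma selection_le: "selection m l f \<Longrightarrow> m \<le> l"
  using card_inj_on_le[of f "{..<m}" "{..<l}"] by (auto simp: selection_def intro: strict_mono_on_imp_inj_on)

text \<open>A repeated row makes the determinant zero. Otherwise \<open>f\<close> is an increasing
  selection composed with a permutation, and the permutation costs a sign only.\<close>

lemma ring_det_sort_rows:
  fixes R :: "'a ring" (structure)
  assumes "cring R" and f: "f \<in> {..<m} \<rightarrow> {..<l}"
    and A: "\<And>i j. i < l \<Longrightarrow> j < m \<Longrightarrow> A i j \<in> carrier R"
  shows "ring_det R m (\<lambda>i j. A (f i) j) = \<zero> \<or>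
    (\<exists>f'. selection m l f' \<and> ring_det R m (\<lambda>i j. A (f i) j)
      \<in> {ring_det R m (\<lambda>i j. A (f' i) j), \<ominus> ring_det R m (\<lambda>i j. A (f' i) j)})"
proof (cases "inj_on f {..<m}")
  case False
  then obtain i j where "i < m" "j < m" "i \<noteq> j" "f i = f j" by (auto simp: inj_on_def)
  then show ?thesis using f A
    by (intro disjI1 ring_det_identical_rows[OF assms(1), of m _ i j]) auto
next
  case True
  let ?F = "f ` {..<m}"
  define f' where "f' i = sorted_list_of_set ?F ! i" for i
  have len: "length (sorted_list_of_set ?F) = m" using True by (simp add: card_image)
  have mono: "strict_mono_on {..<m} f'"
    using sorted_wrt_nth_less[OF strict_sorted_list_of_set[of ?F]] len
    by (auto simp: strict_mono_on_def f'_def)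
  have img: "f' ` {..<m} = ?F"
  proof -
    have "f' ` {..<m} = set (sorted_list_of_set ?F)"
      unfolding f'_def set_conv_nth len by auto
    then show ?thesis by simp
  qed
  have inj': "inj_on f' {..<m}" using mono by (rule strict_mono_on_imp_inj_on)
  have sel: "selection m l f'" using mono img f by (auto simp: selection_def)
  \<comment> \<open>\<open>p\<close> sends a place to the position of its value in the sorted list,
    so that \<open>f\<close> is \<open>f'\<close> after \<open>p\<close> below \<open>m\<close>.
    Fixing all other numbers makes it a permutation of \<open>{..<m}\<close>.\<close>
  define p where "p i = (if i < m then inv_into {..<m} f' (f i) else i)" for i
  have fp: "f' (p i) = f i" if "i < m" for i
    using that img by (simp add: p_def f_inv_into_f)
  have pm: "p i < m" if "i < m" for i
    using that img inv_into_into[of "f i" f' "{..<m}"] by (simp add: p_def)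
  have "inj_on p {..<m}"
  proof (rule inj_onI)
    fix x y assume xy: "x \<in> {..<m}" "y \<in> {..<m}" "p x = p y"
    then have "f x = f y" using fp[of x] fp[of y] by simp
    then show "x = y" using True xy by (auto dest: inj_onD)
  qed
  moreover have "p ` {..<m} \<subseteq> {..<m}" using pm by auto
  ultimately have "bij_betw p {..<m} {..<m}"
    by (simp add: bij_betw_def endo_inj_surj)
  then have p: "p permutes {..<m}" by (rule bij_imp_permutes) (simp add: p_def)
  have fl: "f' i < l" if "i < m" for i using sel that by (auto simp: selection_def)
  have "ring_det R m (\<lambda>i j. A (f' (p i)) j) \<in> {ring_det R m (\<lambda>i j. A (f' i) j), \<ominus> ring_det R m (\<lambda>i j. A (f' i) j)}"
    using A fl by (intro ring_det_permute_rows[OF assms(1) _ p, of "\<lambda>i j. A (f' i) j"]) auto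
  moreover have "ring_det R m (\<lambda>i j. A (f' (p i)) j) = ring_det R m (\<lambda>i j. A (f i) j)"
  proof -
    interpret cring R by fact
    show ?thesis
      using f A fp pm fl unfolding ring_det_def
      by (intro finsum_cong' arg_cong2[where f = "(\<otimes>)"] finprod_cong' refl)
        (auto intro!: finprod_closed m_closed simp: permutes_lessThan Pi_iff)
  qed
  ultimately show ?thesis using sel by auto
qed

text \<open>Rows are sorted first, for increasing columns; a transposition of the matrix then
  reduces arbitrary columns to increasing ones by the same sorting lemma.\<close>

lemma minor_all_selections:
  fixes R :: "'a ring" (structure)
  assumes "cring R" and T: "T \<in> module_hom R (std_free R n) (std_free R l)"
    and f: "f \<in> {..<m} \<rightarrow> {..<l}" and g: "g \<in> {..<m} \<rightarrow> {..<n}"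
    and zero: "\<And>f g. selection m l f \<Longrightarrow> selection m n g \<Longrightarrow> minor R n T m f g = \<zero>"
  shows "minor R n T m f g = \<zero>"
proof -
  interpret cring R by fact
  let ?E = "\<lambda>i j. T (std_basis R n j) i"
  have E: "?E i j \<in> carrier R" if "i < l" for i j
    using module_hom_in[OF T std_basis_in[OF assms(1)], of j] that by (auto simp: carrier_std_free)
  have 1: "minor R n T m f g = \<zero>" if g: "selection m n g" for g
  proof -
    have "g j < n" if "j < m" for j using g that by (auto simp: selection_def)
    then show ?thesis
      using ring_det_sort_rows[OF assms(1) f, of "\<lambda>i j. ?E i (g j)"] E zero[OF _ g]
      unfolding minor_def by auto
  qed
  have f': "f i < l" if "i < m" for i using f that by auto
  have tr: "minor R n T m f h = ring_det R m (\<lambda>i j. ?E (f j) (h i))" for h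
    unfolding minor_def using E f'
    by (intro ring_det_transpose[OF assms(1), symmetric, of m "\<lambda>i j. ?E (f i) (h j)", simplified]) auto
  show ?thesis
    using ring_det_sort_rows[OF assms(1) g, of "\<lambda>i j. ?E (f j) i"] E f' 1
    unfolding tr[symmetric] tr[symmetric, of "\<lambda>i. _ i"] by (auto simp: tr[symmetric])
qed

section \<open>Splitting off the image by an invertible minor\<close>

lemma std_hom_eqI:
  fixes R :: "'a ring" and M :: "('a, 'b) module"
  assumes "module R M" "f \<in> module_hom R (std_free R n) M" "g \<in> module_hom R (std_free R n) M"
    "\<And>j. j < n \<Longrightarrow> f (std_basis R n j) = g (std_basis R n j)" "v \<in> carrier (std_free R n)"
  shows "f v = g v"
  using assms unfolding std_free_def std_basis_eq_free_unit
  by (intro module_hom_eqI[OF assms(1), of f "{..<n}" g v]) auto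

lemma std_hom_apply:
  fixes R :: "'a ring" (structure)
  assumes "cring R" "x \<in> carrier (std_free R m)" "i < l" "\<And>j. j < m \<Longrightarrow> a j \<in> carrier (std_free R l)"
  shows "lin_ext R (std_free R l) {..<m} a x i = (\<Oplus>j\<in>{..<m}. x j \<otimes> a j i)"
proof -
  interpret cring R by fact
  interpret F: module R "std_free R l" by (rule std_free_is_module) fact
  have x: "x j \<in> carrier R" if "j < m" for j using assms(2) that by (auto simp: carrier_std_free)
  have ai: "a j i \<in> carrier R" if "j < m" for j using assms(3,4) that by (auto simp: carrier_std_free)
  have "lin_ext R (std_free R l) {..<m} a x i = (\<Oplus>\<^bsub>std_free R l\<^esub>j\<in>{..<m}. x j \<odot>\<^bsub>std_free R l\<^esub> a j) i"
    using lin_ext_std[OF F.module_axioms assms(2), of a] assms(4) by simp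
  also have "\<dots> = (\<Oplus>j\<in>{..<m}. (x j \<odot>\<^bsub>std_free R l\<^esub> a j) i)"
    unfolding std_free_def using x assms(3,4)
    by (intro free_finsum_apply[OF assms(1)]) (auto simp flip: std_free_def)
  also have "\<dots> = (\<Oplus>j\<in>{..<m}. x j \<otimes> a j i)"
    using x ai assms(3) by (intro finsum_cong') (auto simp: std_free_ops[OF assms(1)])
  finally show ?thesis .
qed

text \<open>Cramer's rule. The map \<open>C\<close> takes combinations of the columns selected by
  \<open>g\<close>. As the bordered minors vanish, every column of \<open>T\<close> is such a
  combination, so \<open>C\<close> and \<open>T\<close> have the same image. The rows selected by
  \<open>f\<close> form an invertible square matrix, so a vector of the image is determined by its
  coordinates at \<open>f\<close>, and these can be prescribed freely. Over a field this gives the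
  rank, over R_p a direct complement.\<close>

lemma split_by_minor:
  fixes R :: "'a ring" (structure)
  assumes cr: "cring R" and T: "T \<in> module_hom R (std_free R n) (std_free R l)"
    and f: "f \<in> {..<m} \<rightarrow> {..<l}" and g: "g \<in> {..<m} \<rightarrow> {..<n}"
    and unit: "minor R n T m f g \<in> Units R"
    and bordered: "\<forall>i<l. \<forall>j<n.
      minor R n T (Suc m) (\<lambda>a. if a < m then f a else i) (\<lambda>b. if b < m then g b else j) = \<zero>"
  defines "C \<equiv> lin_ext R (std_free R l) {..<m} (\<lambda>t. T (std_basis R n (g t)))"
  shows "C \<in> module_hom R (std_free R m) (std_free R l)"
    and "C ` carrier (std_free R m) = T ` carrier (std_free R n)"
    and "\<And>y. y \<in> carrier (std_free R l) \<Longrightarrow> \<exists>x\<in>carrier (std_free R m). \<forall>a<m. C x (f a) = y (f a)"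
    and "\<And>x. x \<in> carrier (std_free R m) \<Longrightarrow> (\<And>a. a < m \<Longrightarrow> C x (f a) = \<zero>) \<Longrightarrow> x = \<zero>\<^bsub>std_free R m\<^esub>"
proof -
  interpret cring R by fact
  interpret Fl: module R "std_free R l" by (rule std_free_is_module[OF cr])
  interpret Fm: module R "std_free R m" by (rule std_free_is_module[OF cr])
  interpret Fn: module R "std_free R n" by (rule std_free_is_module[OF cr])
  let ?e = "std_basis R n" and ?E = "\<lambda>i j. T (std_basis R n j) i" and ?\<Delta> = "minor R n T m f g"
  have Te: "T (?e j) \<in> carrier (std_free R l)" for j
    by (rule module_hom_in[OF T std_basis_in[OF cr]])
  have E: "?E i j \<in> carrier R" if "i < l" for i j
    using Te[of j] that by (auto simp: carrier_std_free)
  have fl: "f a < l" if "a < m" for a using f that by auto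
  have gn: "g a < n" if "a < m" for a using g that by auto
  have Dc: "?\<Delta> \<in> carrier R" using unit by (rule Units_closed)
  show C: "C \<in> module_hom R (std_free R m) (std_free R l)"
    unfolding C_def std_free_def[of _ m] using Te by (intro lin_ext_hom[OF Fl.module_axioms]) auto
  have Capp: "C x i = (\<Oplus>t\<in>{..<m}. x t \<otimes> ?E i (g t))" if "x \<in> carrier (std_free R m)" "i < l" for x i
    unfolding C_def using that Te by (intro std_hom_apply[OF cr]) auto
  have colC: "C (std_basis R m t) = T (?e (g t))" if "t < m" for t
    unfolding C_def std_basis_eq_free_unit[of _ m] using that Te by (intro lin_ext_free_unit[OF Fl.module_axioms]) auto
  have sub: "submodule R (C ` carrier (std_free R m)) (std_free R l)"
    by (rule hom_image_submodule[OF Fm.module_axioms Fl.module_axioms C])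
  have column: "T (?e j) \<in> C ` carrier (std_free R m)" if j: "j < n" for j
  proof -
    let ?g = "\<lambda>b. if b < m then g b else j"
    obtain c where c: "\<And>b. b \<le> m \<Longrightarrow> c b \<in> carrier R" and cm: "c m = ring_det R m (\<lambda>a b. ?E (f a) (?g b))"
      and det: "\<And>r. (\<forall>b\<le>m. r b \<in> carrier R) \<Longrightarrow>
        ring_det R (Suc m) (\<lambda>a b. if a < m then ?E (f a) (?g b) else r b) = (\<Oplus>b\<in>{..m}. r b \<otimes> c b)"
      using ring_det_last_row[OF cr, of m "\<lambda>a b. ?E (f a) (?g b)"] E fl by auto
    \<comment> \<open>A determinant of size \<open>m\<close> sees column indices below
      \<open>m\<close> only, where \<open>?g\<close> agrees with \<open>g\<close>.\<close>
    have cm: "c m = ?\<Delta>"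
      unfolding cm minor_def ring_det_def using E fl
      by (intro finsum_cong' arg_cong2[where f = "(\<otimes>)"] finprod_cong' refl)
        (auto intro!: finprod_closed m_closed simp: permutes_lessThan Pi_iff)
    \<comment> \<open>Expanding a vanishing bordered minor along its last row \<open>i\<close> gives
      E_ij Delta + sum_t E_i,g(t) c_t = 0. Solving for column \<open>j\<close> yields these
      coefficients, and they are the same for every row \<open>i\<close>.\<close>
    define x where "x = (\<lambda>t\<in>{..<m}. \<ominus> (inv ?\<Delta> \<otimes> c t))"
    have x: "x \<in> carrier (std_free R m)" using c unit by (auto simp: x_def carrier_std_free)
    have "C x i = ?E i j" if i: "i < l" for i
    proof -
      have cl: "?E i (g t) \<otimes> c t \<in> carrier R" if "t < m" for t using E[OF i] c that by auto
      have "\<zero> = ring_det R (Suc m) (\<lambda>a b. ?E (if a < m then f a else i) (?g b))"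
        using bordered i j by (simp add: minor_def)
      also have "(\<lambda>a b. ?E (if a < m then f a else i) (?g b)) = (\<lambda>a b. if a < m then ?E (f a) (?g b) else ?E i (?g b))"
        by (auto simp: fun_eq_iff)
      also have "ring_det R (Suc m) \<dots> = (\<Oplus>b\<in>{..m}. ?E i (?g b) \<otimes> c b)"
        using E[OF i] by (intro det) auto
      also have "{..m} = insert m {..<m}" by auto
      also have "(\<Oplus>b\<in>insert m {..<m}. ?E i (?g b) \<otimes> c b) = ?E i j \<otimes> ?\<Delta> \<oplus> (\<Oplus>b\<in>{..<m}. ?E i (?g b) \<otimes> c b)"
        using E[OF i] c Dc by (subst finsum_insert) (auto simp: cm)
      also have "(\<Oplus>b\<in>{..<m}. ?E i (?g b) \<otimes> c b) = (\<Oplus>t\<in>{..<m}. ?E i (g t) \<otimes> c t)"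
        using cl by (intro finsum_cong') auto
      finally have z: "?E i j \<otimes> ?\<Delta> \<oplus> (\<Oplus>t\<in>{..<m}. ?E i (g t) \<otimes> c t) = \<zero>" by simp
      let ?s = "\<Oplus>t\<in>{..<m}. ?E i (g t) \<otimes> c t"
      have sc: "?s \<in> carrier R" using cl by (intro finsum_closed) auto
      have "C x i = (\<Oplus>t\<in>{..<m}. \<ominus> (inv ?\<Delta>) \<otimes> (?E i (g t) \<otimes> c t))"
        unfolding Capp[OF x i] using E[OF i] c unit
        by (intro finsum_cong') (auto simp: x_def l_minus r_minus m_ac)
      also have "\<dots> = \<ominus> (inv ?\<Delta>) \<otimes> ?s"
        using cl unit by (intro finsum_rdistr[symmetric]) auto
      also have "\<dots> = inv ?\<Delta> \<otimes> (\<ominus> ?s)" using sc unit by (simp add: l_minus r_minus)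
      also have "\<ominus> ?s = ?E i j \<otimes> ?\<Delta>"
        using z sc E[OF i, of j] Dc by (intro minus_equality) auto
      also have "inv ?\<Delta> \<otimes> (?E i j \<otimes> ?\<Delta>) = (inv ?\<Delta> \<otimes> ?\<Delta>) \<otimes> ?E i j"
        using E[OF i, of j] unit by (simp only: m_ac Units_inv_closed Units_closed)
      also have "\<dots> = ?E i j" using E[OF i, of j] unit by simp
      finally show ?thesis .
    qed
    then have "C x = T (?e j)"
      using module_hom_in[OF C x] Te[of j] by (intro PiE_ext[of _ "{..<l}" "\<lambda>_. carrier R"]) (auto simp: carrier_std_free)
    then show ?thesis using x by (metis imageI)
  qed
  show "C ` carrier (std_free R m) = T ` carrier (std_free R n)"
  proof (intro equalityI subsetI)
    fix y assume "y \<in> C ` carrier (std_free R m)"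
    then obtain x where x: "x \<in> carrier (std_free R m)" "y = C x" by auto
    let ?G = "lin_ext R (std_free R n) {..<m} (\<lambda>t. ?e (g t))"
    have G: "?G \<in> module_hom R (std_free R m) (std_free R n)"
      unfolding std_free_def[of _ m] by (intro lin_ext_hom[OF Fn.module_axioms] std_basis_in[OF cr])
    have "T (?G x) = C x"
    proof (rule std_hom_eqI[OF Fl.module_axioms module_hom_comp[OF G T] C _ x(1)])
      fix t assume t: "t < m"
      then have "?G (std_basis R m t) = ?e (g t)"
        unfolding std_basis_eq_free_unit[of _ m] by (intro lin_ext_free_unit[OF Fn.module_axioms std_basis_in[OF cr]]) simp
      then show "T (?G (std_basis R m t)) = C (std_basis R m t)" using colC[OF t] by simp
    qed
    then show "y \<in> T ` carrier (std_free R n)"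
      using x module_hom_in[OF G] by (metis image_eqI)
  next
    fix y assume "y \<in> T ` carrier (std_free R n)"
    then obtain x where x: "x \<in> carrier (std_free R n)" "y = T x" by auto
    have "\<forall>j\<in>{..<n}. \<exists>v. v \<in> carrier (std_free R m) \<and> C v = T (?e j)"
      using column by (fastforce simp: image_iff)
    then obtain c where c: "\<forall>j\<in>{..<n}. c j \<in> carrier (std_free R m) \<and> C (c j) = T (?e j)"
      by (rule bchoice[THEN exE])
    let ?U = "lin_ext R (std_free R m) {..<n} c"
    have U: "?U \<in> module_hom R (std_free R n) (std_free R m)"
      unfolding std_free_def[of _ n] using c by (intro lin_ext_hom[OF Fm.module_axioms]) auto
    have "C (?U x) = T x"
    proof (rule std_hom_eqI[OF Fl.module_axioms module_hom_comp[OF U C] T _ x(1)])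
      fix j assume j: "j < n"
      then have "?U (?e j) = c j"
        unfolding std_basis_eq_free_unit using c by (intro lin_ext_free_unit[OF Fm.module_axioms]) auto
      then show "C (?U (?e j)) = T (?e j)" using c j by simp
    qed
    then show "y \<in> C ` carrier (std_free R m)"
      using x module_hom_in[OF U] by (metis image_eqI)
  qed
  let ?A = "\<lambda>a b. ?E (f a) (g b)"
  have EA: "?A i j \<in> carrier R" if "i < m" "j < m" for i j using E fl that by simp
  obtain B where B: "\<forall>i j. B i j \<in> carrier R"
    and AB: "\<forall>i<m. \<forall>j<m. (\<Oplus>k\<in>{..<m}. ?A i k \<otimes> B k j) = (if i = j then ?\<Delta> else \<zero>)"
    and BA: "\<forall>i<m. \<forall>j<m. (\<Oplus>k\<in>{..<m}. B i k \<otimes> ?A k j) = (if i = j then ?\<Delta> else \<zero>)"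
    using ring_det_adjugate[OF cr, of m ?A, OF EA] unfolding minor_def by blast
  \<comment> \<open>\<open>S\<close> is the square matrix of rows \<open>f\<close> and columns
    \<open>g\<close>, and \<open>Q\<close> is its adjugate. Both composites are multiplication by
    the unit minor, which gives surjectivity and injectivity of \<open>S\<close>.\<close>
  define S where "S x = (\<lambda>a\<in>{..<m}. C x (f a))" for x
  define Q where "Q = lin_ext R (std_free R m) {..<m} (\<lambda>j. \<lambda>k\<in>{..<m}. B k j)"
  have ext: "x = y" if "x \<in> carrier (std_free R m)" "y \<in> carrier (std_free R m)" "\<And>k. k < m \<Longrightarrow> x k = y k" for x y
    using that by (auto simp: carrier_std_free intro: PiE_ext)
  have Bcol: "(\<lambda>k\<in>{..<m}. B k j) \<in> carrier (std_free R m)" for j using B by (auto simp: carrier_std_free)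
  have S: "S \<in> module_hom R (std_free R m) (std_free R m)"
  proof (rule module_homI)
    show "S x \<in> carrier (std_free R m)" if "x \<in> carrier (std_free R m)" for x
      using module_hom_in[OF C that] fl by (auto simp: S_def carrier_std_free)
  qed (use fl in \<open>auto simp: S_def std_free_ops[OF cr] fun_eq_iff module_hom_add[OF C, unfolded std_free_ops[OF cr]]
      module_hom_smult[OF C, unfolded std_free_ops[OF cr]]\<close>)
  have Q: "Q \<in> module_hom R (std_free R m) (std_free R m)"
    unfolding Q_def std_free_def[of _ m] using Bcol
    by (intro lin_ext_hom free_module_is_module[OF cr]) (simp add: std_free_def)
  have \<Delta>: "(\<lambda>x. ?\<Delta> \<odot>\<^bsub>std_free R m\<^esub> x) \<in> module_hom R (std_free R m) (std_free R m)"
    by (rule module_hom_smult_map[OF Fm.module_axioms Fm.module_axioms module_hom_id Dc])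
  have SQ: "S (Q x) = ?\<Delta> \<odot>\<^bsub>std_free R m\<^esub> x" and QS: "Q (S x) = ?\<Delta> \<odot>\<^bsub>std_free R m\<^esub> x"
    if x: "x \<in> carrier (std_free R m)" for x
  proof -
    note on_basis = std_hom_eqI[OF Fm.module_axioms _ \<Delta> _ x]
    have e: "std_basis R m j \<in> carrier (std_free R m)" for j by (rule std_basis_in[OF cr])
    have Qe: "Q (std_basis R m j) = (\<lambda>k\<in>{..<m}. B k j)" if "j < m" for j
      unfolding Q_def std_basis_eq_free_unit using that Bcol by (intro lin_ext_free_unit[OF Fm.module_axioms]) auto
    show "S (Q x) = ?\<Delta> \<odot>\<^bsub>std_free R m\<^esub> x"
    proof (rule on_basis[OF module_hom_comp[OF Q S]])
      fix j assume j: "j < m"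
      show "S (Q (std_basis R m j)) = ?\<Delta> \<odot>\<^bsub>std_free R m\<^esub> std_basis R m j"
      proof (rule ext)
        fix a assume a: "a < m"
        have "C (Q (std_basis R m j)) (f a) = (\<Oplus>t\<in>{..<m}. ?A a t \<otimes> B t j)"
          unfolding Qe[OF j] Capp[OF Bcol fl[OF a]] using B EA[OF a] by (intro finsum_cong') (auto simp: m_comm)
        then show "S (Q (std_basis R m j)) a = (?\<Delta> \<odot>\<^bsub>std_free R m\<^esub> std_basis R m j) a"
          using a j AB Dc by (simp add: S_def std_free_ops[OF cr] std_basis_def)
      qed (use module_hom_in[OF S module_hom_in[OF Q e]] e Dc in auto)
    qed
    show "Q (S x) = ?\<Delta> \<odot>\<^bsub>std_free R m\<^esub> x"
    proof (rule on_basis[OF module_hom_comp[OF S Q]])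
      fix j assume j: "j < m"
      show "Q (S (std_basis R m j)) = ?\<Delta> \<odot>\<^bsub>std_free R m\<^esub> std_basis R m j"
      proof (rule ext)
        fix k assume k: "k < m"
        have "Q (S (std_basis R m j)) k = (\<Oplus>i\<in>{..<m}. S (std_basis R m j) i \<otimes> (\<lambda>k\<in>{..<m}. B k i) k)"
          unfolding Q_def by (rule std_hom_apply[OF cr module_hom_in[OF S e] k Bcol])
        also have "\<dots> = (\<Oplus>i\<in>{..<m}. B k i \<otimes> ?A i j)"
          using k B EA j by (intro finsum_cong') (auto simp: S_def colC m_comm)
        finally show "Q (S (std_basis R m j)) k = (?\<Delta> \<odot>\<^bsub>std_free R m\<^esub> std_basis R m j) k"
          using k j BA Dc by (simp add: std_free_ops[OF cr] std_basis_def)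
      qed (use module_hom_in[OF Q module_hom_in[OF S e]] e Dc in auto)
    qed
  qed
  show "\<exists>x\<in>carrier (std_free R m). \<forall>a<m. C x (f a) = y (f a)" if y: "y \<in> carrier (std_free R l)" for y
  proof -
    let ?z = "\<lambda>a\<in>{..<m}. y (f a)" and ?i = "inv ?\<Delta>"
    have z: "?z \<in> carrier (std_free R m)" using y fl by (auto simp: carrier_std_free)
    have x: "Q (?i \<odot>\<^bsub>std_free R m\<^esub> ?z) \<in> carrier (std_free R m)" using z unit by (intro module_hom_in[OF Q]) simp
    have "S (Q (?i \<odot>\<^bsub>std_free R m\<^esub> ?z)) = ?\<Delta> \<odot>\<^bsub>std_free R m\<^esub> (?i \<odot>\<^bsub>std_free R m\<^esub> ?z)"
      using z unit by (intro SQ) simp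
    also have "\<dots> = (?\<Delta> \<otimes> ?i) \<odot>\<^bsub>std_free R m\<^esub> ?z"
      using z unit Dc by (intro Fm.smult_assoc1[symmetric]) auto
    also have "\<dots> = ?z" using unit by (simp only: Units_r_inv Fm.smult_one[OF z])
    finally have eq: "S (Q (?i \<odot>\<^bsub>std_free R m\<^esub> ?z)) a = ?z a" for a by simp
    have "C (Q (?i \<odot>\<^bsub>std_free R m\<^esub> ?z)) (f a) = y (f a)" if "a < m" for a
      using eq[of a] that by (simp add: S_def)
    then show ?thesis using x by blast
  qed
  show "x = \<zero>\<^bsub>std_free R m\<^esub>" if x: "x \<in> carrier (std_free R m)" and 0: "\<And>a. a < m \<Longrightarrow> C x (f a) = \<zero>" for x
  proof -
    have "S x = \<zero>\<^bsub>std_free R m\<^esub>" using 0 by (auto simp: S_def std_free_ops[OF cr])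
    then have "?\<Delta> \<odot>\<^bsub>std_free R m\<^esub> x = \<zero>\<^bsub>std_free R m\<^esub>"
      using QS[OF x] module_hom_zero[OF Fm.module_axioms Fm.module_axioms Q] by simp
    then show ?thesis using smult_unit_cancel[OF Fm.module_axioms unit x] unit by simp
  qed
qed

text \<open>Over a field the nonzero minor is a unit, so the map \<open>C\<close> of the splitting
  is injective on a space of dimension \<open>m\<close> and has the image of
  \<open>T\<close>.\<close>

lemma rank_eq_minor_size:
  fixes K :: "'k ring" (structure)
  assumes K: "field K" and T: "T \<in> module_hom K (std_free K n) (std_free K l)"
    and fg: "selection m l f" "selection m n g" and nz: "minor K n T m f g \<noteq> \<zero>"
    and zero: "\<And>f g. selection (Suc m) l f \<Longrightarrow> selection (Suc m) n g \<Longrightarrow> minor K n T (Suc m) f g = \<zero>"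
  shows "vdim K (std_free K l) (T ` carrier (std_free K n)) = m"
proof -
  interpret field K by fact
  have cr: "cring K" ..
  have f: "f \<in> {..<m} \<rightarrow> {..<l}" and g: "g \<in> {..<m} \<rightarrow> {..<n}" using fg by (auto simp: selection_def)
  have mc: "minor K n T m f g \<in> carrier K"
    unfolding minor_def using module_hom_in[OF T std_basis_in[OF cr]] f
    by (intro ring_det_closed[OF cr]) (auto simp: carrier_std_free)
  have unit: "minor K n T m f g \<in> Units K" using mc nz by (simp add: field_Units)
  have bordered: "\<forall>i<l. \<forall>j<n.
      minor K n T (Suc m) (\<lambda>a. if a < m then f a else i) (\<lambda>b. if b < m then g b else j) = \<zero>"
    using f g by (intro allI impI minor_all_selections[OF cr T _ _ zero]) auto
  note split = split_by_minor[OF cr T f g unit bordered]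
  let ?C = "lin_ext K (std_free K l) {..<m} (\<lambda>t. T (std_basis K n (g t)))"
  have M: "module K (std_free K m)" "module K (std_free K l)" by (simp_all add: std_free_is_module[OF cr])
  have "{x \<in> carrier (std_free K m). ?C x = \<zero>\<^bsub>std_free K l\<^esub>} = {\<zero>\<^bsub>std_free K m\<^esub>}"
  proof (intro equalityI subsetI)
    fix x assume "x \<in> {x \<in> carrier (std_free K m). ?C x = \<zero>\<^bsub>std_free K l\<^esub>}"
    then have x: "x \<in> carrier (std_free K m)" "?C x = \<zero>\<^bsub>std_free K l\<^esub>" by auto
    have "x = \<zero>\<^bsub>std_free K m\<^esub>"
      using f x(2) by (intro split(4)[OF x(1)]) (auto simp: std_free_ops[OF cr])
    then show "x \<in> {\<zero>\<^bsub>std_free K m\<^esub>}" by simp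
  next
    interpret Fm: module K "std_free K m" by fact
    fix x assume "x \<in> {\<zero>\<^bsub>std_free K m\<^esub>}"
    then show "x \<in> {x \<in> carrier (std_free K m). ?C x = \<zero>\<^bsub>std_free K l\<^esub>}"
      using module_hom_zero[OF M split(1)] by simp
  qed
  then show ?thesis
    using vdim_rank_nullity[OF K M split(1) std_free_basis(1)[OF K]] std_free_basis(2)[OF K, of m]
      vdim_zero[OF vectorspaceI[OF K M(1)]] split(2) by simp
qed

lemma rank_via_minors:
  fixes K :: "'k ring" (structure)
  assumes K: "field K" and T: "T \<in> module_hom K (std_free K n) (std_free K l)"
  defines "r \<equiv> vdim K (std_free K l) (T ` carrier (std_free K n))"
  shows "\<exists>f g. selection r l f \<and> selection r n g \<and> minor K n T r f g \<noteq> \<zero>"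
    and "\<And>m f g. r < m \<Longrightarrow> selection m l f \<Longrightarrow> selection m n g \<Longrightarrow> minor K n T m f g = \<zero>"
proof -
  interpret field K by fact
  define Q where "Q = {m. \<exists>f g. selection m l f \<and> selection m n g \<and> minor K n T m f g \<noteq> \<zero>}"
  have fin: "finite Q" using selection_le by (intro finite_subset[of Q "{..l}"]) (auto simp: Q_def)
  \<comment> \<open>The empty minor is one, so the set \<open>Q\<close> of sizes with a nonzero
    minor is inhabited and has a maximum; that maximum is the rank.\<close>
  have "minor K n T 0 id id = \<one>" by (simp add: minor_def ring_det_def permutes_empty)
  then have "0 \<in> Q" by (auto simp: Q_def selection_def strict_mono_on_def intro!: exI[of _ id])
  then have max: "Max Q \<in> Q" "\<And>m. m \<in> Q \<Longrightarrow> m \<le> Max Q" using fin by (auto intro: Max_in)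
  then obtain f g where fg: "selection (Max Q) l f" "selection (Max Q) n g" "minor K n T (Max Q) f g \<noteq> \<zero>"
    unfolding Q_def by blast
  have "r = Max Q" unfolding r_def
  proof (rule rank_eq_minor_size[OF K T fg])
    fix f g assume "selection (Suc (Max Q)) l f" "selection (Suc (Max Q)) n g"
    then show "minor K n T (Suc (Max Q)) f g = \<zero>" using max(2)[of "Suc (Max Q)"] by (auto simp: Q_def)
  qed
  then show "\<exists>f g. selection r l f \<and> selection r n g \<and> minor K n T r f g \<noteq> \<zero>"
    and "\<And>m f g. r < m \<Longrightarrow> selection m l f \<Longrightarrow> selection m n g \<Longrightarrow> minor K n T m f g = \<zero>"
    using fg max(2) by (blast, force simp: Q_def)
qed

lemma minor_base_change:
  fixes R :: "'a ring" and K :: "'k ring"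
  assumes R: "cring R" and K: "cring K" and \<phi>: "\<phi> \<in> Ring.ring_hom R K"
    and T: "T \<in> module_hom R (std_free R n) (std_free R l)"
    and f: "f \<in> {..<m} \<rightarrow> {..<l}" and g: "g \<in> {..<m} \<rightarrow> {..<n}"
  shows "minor K n (base_change R K n (std_free K l) (map_vec \<phi> l) T) m f g = \<phi> (minor R n T m f g)"
proof -
  interpret K: cring K by fact
  have M: "module R (std_free R l)" "module K (std_free K l)"
    using R K by (simp_all add: std_free_is_module)
  have E: "T (std_basis R n j) i \<in> carrier R" if "i < l" for i j
    using module_hom_in[OF T std_basis_in[OF R], of j] that by (auto simp: carrier_std_free)
  have entry: "base_change R K n (std_free K l) (map_vec \<phi> l) T (std_basis K n (g j)) (f i) = \<phi> (T (std_basis R n (g j)) (f i))"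
    if "i < m" "j < m" for i j
    using that Pi_mem[OF f, of i] Pi_mem[OF g, of j]
      base_change_std_basis[OF R M semilinear_map_vec[OF R K \<phi>] T, of "g j"] by (simp add: map_vec_def)
  have "minor K n (base_change R K n (std_free K l) (map_vec \<phi> l) T) m f g
      = ring_det K m (\<lambda>i j. \<phi> (T (std_basis R n (g j)) (f i)))"
    unfolding minor_def ring_det_def using entry E f g ring_hom_closed[OF \<phi>]
    by (intro K.finsum_cong' arg_cong2[where f = "(\<otimes>\<^bsub>K\<^esub>)"] K.finprod_cong' refl)
      (auto intro!: K.finprod_closed K.m_closed simp: permutes_lessThan Pi_iff)
  also have "\<dots> = \<phi> (minor R n T m f g)"
    unfolding minor_def using E f by (intro ring_det_hom[OF R K \<phi>]) auto
  finally show ?thesis .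
qed

section \<open>Prime ideals and fields\<close>

lemma mult_set_prime_complement:
  assumes "\<pp> \<in> Spec R"
  shows "mult_set R (carrier R - \<pp>)"
proof -
  interpret primeideal \<pp> R using assms by (simp add: Spec_def)
  have "\<one>\<^bsub>R\<^esub> \<notin> \<pp>" using I_notcarr one_imp_carrier by auto
  then show ?thesis
    using I_prime by unfold_locales auto
qed

text \<open>An ideal maximal among those disjoint from a multiplicative set is prime: if neither a
  nor b lay in it, enlarging it by a and by b would produce two elements of \<open>S\<close> whose
  product lies in the ideal as soon as ab does.\<close>

lemma prime_avoiding:
  fixes R :: "'a ring" (structure)
  assumes N: "noetherian_ring R" and S: "mult_set R S" and 0: "\<zero> \<notin> S"
  shows "\<exists>\<pp>\<in>Spec R. \<pp> \<inter> S = {}"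
proof -
  interpret mult_set R S by fact
  interpret noetherian_ring R by fact
  let ?A = "{I. ideal I R \<and> I \<inter> S = {}}"
  have "\<exists>M\<in>?A. \<forall>X\<in>?A. M \<subseteq> X \<longrightarrow> X = M"
  proof (rule subset_Zorn_nonempty)
    have "{\<zero>} \<in> ?A" using zeroideal 0 by auto
    then show "?A \<noteq> {}" by blast
  next
    fix C assume C: "C \<noteq> {}" "subset.chain ?A C"
    then have "subset.chain {I. ideal I R} C" by (auto simp: subset.chain_def)
    \<comment> \<open>In a noetherian ring a nonempty chain of ideals contains its own union, so the
      bound required by Zorn's lemma is a member of the chain.\<close>
    then have "\<Union> C \<in> C" using ideal_chain_is_trivial[OF C(1)] by blast
    then show "\<Union> C \<in> ?A" using C(2) by (auto simp: subset.chain_def)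
  qed
  then obtain I where IA: "I \<in> ?A" and maxA: "\<forall>J\<in>?A. I \<subseteq> J \<longrightarrow> J = I" by (rule bexE)
  have I: "ideal I R" "I \<inter> S = {}" using IA by auto
  have max: "J = I" if "ideal J R" "J \<inter> S = {}" "I \<subseteq> J" for J
    using bspec[OF maxA, of J] that by simp
  interpret I: ideal I R by fact
  have meets: "\<exists>i\<in>I. \<exists>r\<in>carrier R. i \<oplus> r \<otimes> a \<in> S" if a: "a \<in> carrier R" "a \<notin> I" for a
  proof -
    have J: "ideal (I <+> PIdl a) R" by (rule add_ideals[OF I(1) cgenideal_ideal[OF a(1)]])
    have "I \<subseteq> I <+> PIdl a"
    proof
      fix i assume i: "i \<in> I"
      then have "i = i \<oplus> \<zero>" using I.a_Hcarr by simp
      moreover have "\<zero> \<in> PIdl a" using a by (auto simp: cgenideal_def intro!: exI[of _ \<zero>])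
      ultimately show "i \<in> I <+> PIdl a" using i unfolding set_add_def' by blast
    qed
    moreover have "a \<in> I <+> PIdl a"
    proof -
      have "a = \<zero> \<oplus> a" using a by simp
      then show ?thesis using cgenideal_self[OF a(1)] I.zero_closed unfolding set_add_def' by blast
    qed
    ultimately have "(I <+> PIdl a) \<inter> S \<noteq> {}" using max[OF J] a by blast
    then show ?thesis unfolding set_add_def' cgenideal_def by blast
  qed
  have "primeideal I R"
  proof (rule primeidealI[OF I(1) cring_R])
    show "carrier R \<noteq> I" using I(2) S_one by blast
    fix a b assume ab: "a \<in> carrier R" "b \<in> carrier R" "a \<otimes> b \<in> I"
    show "a \<in> I \<or> b \<in> I"
    proof (rule ccontr)
      assume "\<not> (a \<in> I \<or> b \<in> I)"
      then obtain i r j s where c: "i \<in> I" "r \<in> carrier R" "i \<oplus> r \<otimes> a \<in> S" "j \<in> I" "s \<in> carrier R" "j \<oplus> s \<otimes> b \<in> S"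
        using meets ab by meson
      have ij: "i \<in> carrier R" "j \<in> carrier R" using c I.a_Hcarr by auto
      have "(i \<oplus> r \<otimes> a) \<otimes> (j \<oplus> s \<otimes> b) = i \<otimes> (j \<oplus> s \<otimes> b) \<oplus> ((r \<otimes> a) \<otimes> j \<oplus> (r \<otimes> s) \<otimes> (a \<otimes> b))"
        using c ij ab by (simp add: l_distr r_distr m_ac a_ac)
      also have "\<dots> \<in> I"
        using c ij ab I.I_l_closed I.I_r_closed by (intro I.a_closed) auto
      finally show False using S_mult[OF c(3,6)] I(2) by blast
    qed
  qed
  then show ?thesis using I(2) by (auto simp: Spec_def)
qed

text \<open>Zorn's lemma is applied to the multiplicative sets that contain the complement of \<pp>
  and avoid zero; unions of chains of these are easy to control. A prime avoiding a maximal such set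
  is its complement, and minimality of the prime is maximality of the set.\<close>

lemma minimal_prime_below:
  fixes R :: "'a ring" (structure)
  assumes N: "noetherian_ring R" and p: "\<pp> \<in> Spec R"
  shows "\<exists>\<qq>\<in>minimal_primes R. \<qq> \<subseteq> \<pp>"
proof -
  interpret P: primeideal \<pp> R using p by (simp add: Spec_def)
  let ?A = "{T. mult_set R T \<and> \<zero> \<notin> T \<and> carrier R - \<pp> \<subseteq> T}"
  have mem: "carrier R - \<qq> \<in> ?A" if "\<qq> \<in> Spec R" "\<qq> \<subseteq> \<pp>" for \<qq>
  proof -
    interpret Q: primeideal \<qq> R using that by (simp add: Spec_def)
    show ?thesis using mult_set_prime_complement[OF that(1)] that(2) Q.zero_closed by auto
  qed
  have "\<exists>T\<in>?A. \<forall>X\<in>?A. T \<subseteq> X \<longrightarrow> X = T"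
  proof (rule subset_Zorn_nonempty)
    show "?A \<noteq> {}" using mem[OF p] by blast
  next
    fix C assume C: "C \<noteq> {}" "subset.chain ?A C"
    then have el: "mult_set R T \<and> \<zero> \<notin> T \<and> carrier R - \<pp> \<subseteq> T" if "T \<in> C" for T
      using that by (auto simp: subset.chain_def)
    have "mult_set R (\<Union> C)"
    proof
      show "\<Union> C \<subseteq> carrier R" using el mult_set.S_subset by fast
      show "\<one> \<in> \<Union> C" using el C(1) mult_set.S_one by blast
      fix s t assume "s \<in> \<Union> C" "t \<in> \<Union> C"
      then obtain X Y where XY: "X \<in> C" "s \<in> X" "Y \<in> C" "t \<in> Y" by blast
      then have "X \<subseteq> Y \<or> Y \<subseteq> X" using C(2) by (auto simp: subset.chain_def)
      then show "s \<otimes> t \<in> \<Union> C" using XY el mult_set.S_mult by (metis UnionI subsetD)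
    qed
    then show "\<Union> C \<in> ?A" using el C(1) by blast
  qed
  then obtain T where TA: "T \<in> ?A" and maxA: "\<forall>X\<in>?A. T \<subseteq> X \<longrightarrow> X = T" by (rule bexE)
  have T: "mult_set R T" "\<zero> \<notin> T" "carrier R - \<pp> \<subseteq> T" using TA by auto
  have max: "X = T" if "X \<in> ?A" "T \<subseteq> X" for X using bspec[OF maxA that(1)] that(2) by simp
  obtain \<qq> where q: "\<qq> \<in> Spec R" "\<qq> \<inter> T = {}" using prime_avoiding[OF N T(1,2)] by blast
  interpret Q: primeideal \<qq> R using q by (simp add: Spec_def)
  have qp: "\<qq> \<subseteq> \<pp>" using q(2) T(3) Q.a_subset by blast
  have TR: "T \<subseteq> carrier R" using T(1) by (rule mult_set.S_subset)
  have "\<pp>' = \<qq>" if p': "\<pp>' \<in> Spec R" "\<pp>' \<subseteq> \<qq>" for \<pp>'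
  proof -
    interpret P': primeideal \<pp>' R using p' by (simp add: Spec_def)
    \<comment> \<open>The complements of \<pp>' and of \<qq> both contain \<open>T\<close> and both
      belong to \<open>?A\<close>. By maximality both are \<open>T\<close>, so the two primes
      coincide.\<close>
    have "carrier R - \<pp>' = T" using mem[OF p'(1)] p'(2) qp q(2) TR by (intro max) blast+
    moreover have "carrier R - \<qq> = T" using mem[OF q(1) qp] q(2) TR by (intro max) blast+
    ultimately show ?thesis using P'.a_subset Q.a_subset by blast
  qed
  then show ?thesis using q(1) qp by (auto simp: minimal_primes_def)
qed

text \<open>No power of a nonzero element vanishes in a reduced ring, so some prime avoids all its
  powers, and so does a minimal prime below that one.\<close>

lemma reduced_zero_if_in_minimal_primes:
  fixes R :: "'a ring" (structure)
  assumes R: "cring R" "noetherian_ring R" "reduced_ring R" and x: "x \<in> carrier R"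
    and all: "\<And>\<qq>. \<qq> \<in> minimal_primes R \<Longrightarrow> x \<in> \<qq>"
  shows "x = \<zero>"
proof (rule ccontr)
  assume nz: "x \<noteq> \<zero>"
  interpret cring R by fact
  let ?S = "range (\<lambda>n::nat. x [^] n)"
  have "mult_set R ?S"
  proof
    show "\<one> \<in> ?S" by (rule image_eqI[of _ _ 0]) auto
    fix s t assume "s \<in> ?S" "t \<in> ?S"
    then obtain n m :: nat where "s = x [^] n" "t = x [^] m" by blast
    then have "s \<otimes> t = x [^] (n + m)" using x by (simp add: nat_pow_mult)
    then show "s \<otimes> t \<in> ?S" by blast
  qed (use x in auto)
  moreover have "\<zero> \<notin> ?S" using R(3) x nz unfolding reduced_ring_def by (metis rangeE)
  ultimately obtain \<pp> where p: "\<pp> \<in> Spec R" "\<pp> \<inter> ?S = {}" using prime_avoiding[OF R(2)] by blast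
  have "x \<in> ?S" using x by (intro image_eqI[of _ _ 1]) auto
  moreover obtain \<qq> where "\<qq> \<in> minimal_primes R" "\<qq> \<subseteq> \<pp>" using minimal_prime_below[OF R(2) p(1)] by blast
  ultimately show False using all p(2) by blast
qed

text \<open>Yields both kinds of fields on which ranks are compared: fractions of the domain R/p,
  where only zero lies outside \<open>S\<close>, and R_q at a minimal prime, where everything
  outside \<open>S\<close> is torsion.\<close>

lemma field_localize_ring:
  fixes R :: "'a ring" (structure)
  assumes S: "mult_set R S" and 0: "\<zero> \<notin> S"
    and unit_or_torsion: "\<And>a. a \<in> carrier R \<Longrightarrow> a \<in> S \<or> (\<exists>u\<in>S. u \<otimes> a = \<zero>)"
  shows "field (localize_ring R S)"
proof -
  interpret mult_set R S by fact
  let ?L = "localize_ring R S"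
  interpret L: cring ?L by (rule localize_ring_cring)
  have zero: "\<zero>\<^bsub>?L\<^esub> = loc \<zero>" by (simp add: localize_ring_def)
  have frac_zero_iff: "ring_frac R S a s = \<zero>\<^bsub>?L\<^esub> \<longleftrightarrow> a \<notin> S" if "a \<in> carrier R" "s \<in> S" for a s
  proof -
    have "ring_frac R S a s = \<zero>\<^bsub>?L\<^esub> \<longleftrightarrow> (\<exists>u\<in>S. u \<otimes> a = \<zero>)"
      unfolding zero using that S_one S_in by (subst ring_frac_eq_iff) auto
    then show ?thesis using unit_or_torsion[OF that(1)] S_mult 0 by metis
  qed
  have "Units ?L = carrier ?L - {\<zero>\<^bsub>?L\<^esub>}"
  proof (intro equalityI subsetI)
    fix X assume X: "X \<in> Units ?L"
    have "\<one>\<^bsub>?L\<^esub> \<noteq> \<zero>\<^bsub>?L\<^esub>" using frac_zero_iff[OF one_closed S_one] S_one by (simp add: localize_ring_simps(5))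
    then have "X \<noteq> \<zero>\<^bsub>?L\<^esub>" using X L.Units_l_inv L.r_null L.Units_inv_closed by metis
    then show "X \<in> carrier ?L - {\<zero>\<^bsub>?L\<^esub>}" using X L.Units_closed by blast
  next
    fix X assume "X \<in> carrier ?L - {\<zero>\<^bsub>?L\<^esub>}"
    then have XL: "X \<in> carrier ?L" and Xnz: "X \<noteq> \<zero>\<^bsub>?L\<^esub>" by auto
    obtain a s where X': "X = ring_frac R S a s" "a \<in> carrier R" "s \<in> S"
      using XL by (rule ring_frac_cases)
    then have X: "X = ring_frac R S a s" "a \<in> carrier R" "s \<in> S" "a \<in> S"
      using Xnz frac_zero_iff by auto
    have "ring_frac R S s a \<otimes>\<^bsub>?L\<^esub> X = \<one>\<^bsub>?L\<^esub>" "X \<otimes>\<^bsub>?L\<^esub> ring_frac R S s a = \<one>\<^bsub>?L\<^esub>"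
      using X S_one S_in S_mult
      by (auto simp: ring_frac_mult localize_ring_simps(5) ring_frac_eq_iff m_comm intro!: bexI[of _ \<one>])
    then show "X \<in> Units ?L" using X S_in unfolding Units_def by (auto intro!: ring_frac_in bexI[of _ "ring_frac R S s a"])
  qed
  then show ?thesis by (rule L.cring_fieldI)
qed

lemma loc_zero_iff:
  fixes R :: "'a ring" (structure)
  assumes S: "mult_set R S" and a: "a \<in> carrier R"
  shows "ring_frac R S a \<one> = \<zero>\<^bsub>localize_ring R S\<^esub> \<longleftrightarrow> (\<exists>u\<in>S. u \<otimes> a = \<zero>)"
proof -
  interpret mult_set R S by fact
  have "\<zero>\<^bsub>localize_ring R S\<^esub> = ring_frac R S \<zero> \<one>" by (simp add: localize_ring_def)
  then show ?thesis using a S_one S_in by (simp add: ring_frac_eq_iff)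
qed

text \<open>The products u a^n with u outside \<qq> must include zero, since a prime avoiding them
  would lie inside \<qq> and miss \<open>a\<close>, against minimality. Reducedness then improves u
  a^n = 0 to u a = 0. Consequently R_q is a field and R maps to it with kernel \<qq>.\<close>

lemma minimal_prime_torsion:
  fixes R :: "'a ring" (structure)
  assumes R: "cring R" "noetherian_ring R" "reduced_ring R" and q: "\<qq> \<in> minimal_primes R" and a: "a \<in> \<qq>"
  shows "\<exists>u\<in>carrier R - \<qq>. u \<otimes> a = \<zero>"
proof -
  interpret cring R by fact
  have qS: "\<qq> \<in> Spec R" using q by (simp add: minimal_primes_def)
  interpret Q: primeideal \<qq> R using qS by (simp add: Spec_def)
  interpret C: mult_set R "carrier R - \<qq>" by (rule mult_set_prime_complement[OF qS])
  have ac: "a \<in> carrier R" using a Q.a_Hcarr by simp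
  let ?S = "{u \<otimes> a [^] n | u n. u \<in> carrier R - \<qq> \<and> n \<in> (UNIV :: nat set)}"
  have S: "mult_set R ?S"
  proof
    have "\<one> = \<one> \<otimes> a [^] (0::nat)" by simp
    then show "\<one> \<in> ?S" using C.S_one by blast
    fix s t assume "s \<in> ?S" "t \<in> ?S"
    then obtain u n v m where st: "u \<in> carrier R - \<qq>" "s = u \<otimes> a [^] (n::nat)" "v \<in> carrier R - \<qq>" "t = v \<otimes> a [^] (m::nat)"
      by blast
    have "s \<otimes> t = (u \<otimes> v) \<otimes> a [^] (n + m)"
      using st ac by (simp add: m_ac flip: nat_pow_mult)
    then show "s \<otimes> t \<in> ?S" using C.S_mult st by blast
  qed (use ac in auto)
  have "\<zero> \<in> ?S"
  proof (rule ccontr)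
    assume "\<zero> \<notin> ?S"
    then obtain \<pp> where p: "\<pp> \<in> Spec R" "\<pp> \<inter> ?S = {}" using prime_avoiding[OF R(2) S] by blast
    interpret P: primeideal \<pp> R using p by (simp add: Spec_def)
    have "u \<in> ?S" if "u \<in> carrier R - \<qq>" for u
    proof -
      have "u = u \<otimes> a [^] (0::nat)" using that by simp
      then show ?thesis using that by blast
    qed
    then have "\<pp> \<subseteq> \<qq>" using p(2) P.a_subset by blast
    then have "\<pp> = \<qq>" using q p(1) by (auto simp: minimal_primes_def)
    moreover have "a = \<one> \<otimes> a [^] (1::nat)" using ac by simp
    then have "a \<in> ?S" using C.S_one by blast
    ultimately show False using a p(2) by blast
  qed
  then obtain u n where u: "u \<in> carrier R - \<qq>" "\<zero> = u \<otimes> a [^] (n::nat)" by blast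
  \<comment> \<open>The exponent n + 1 provides the factor u a^n even if n = 0, leaving u^n a as
    cofactor.\<close>
  have "(u \<otimes> a) [^] Suc n = (u [^] n \<otimes> a) \<otimes> (u \<otimes> a [^] n)"
    using u(1) ac by (simp add: nat_pow_distrib m_ac)
  also have "\<dots> = \<zero>" using u(1) ac by (simp flip: u(2))
  finally have "u \<otimes> a = \<zero>" using R(3) u(1) ac unfolding reduced_ring_def by blast
  then show ?thesis using u(1) by blast
qed

lemma field_ring_at_minimal_prime:
  fixes R :: "'a ring" (structure)
  assumes R: "cring R" "noetherian_ring R" "reduced_ring R" and q: "\<qq> \<in> minimal_primes R"
  shows "field (ring_at R \<qq>)"
    and "a \<in> carrier R \<Longrightarrow> ring_frac R (carrier R - \<qq>) a \<one> = \<zero>\<^bsub>ring_at R \<qq>\<^esub> \<longleftrightarrow> a \<in> \<qq>"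
proof -
  have qS: "\<qq> \<in> Spec R" using q by (simp add: minimal_primes_def)
  interpret Q: primeideal \<qq> R using qS by (simp add: Spec_def)
  note C = mult_set_prime_complement[OF qS]
  show "field (ring_at R \<qq>)" unfolding ring_at_def
    using minimal_prime_torsion[OF R q] Q.zero_closed by (intro field_localize_ring[OF C]) auto
  show "ring_frac R (carrier R - \<qq>) a \<one> = \<zero>\<^bsub>ring_at R \<qq>\<^esub> \<longleftrightarrow> a \<in> \<qq>" if a: "a \<in> carrier R"
    unfolding ring_at_def loc_zero_iff[OF C a]
  proof
    assume "\<exists>u\<in>carrier R - \<qq>. u \<otimes> a = \<zero>"
    then obtain u where "u \<in> carrier R" "u \<notin> \<qq>" "u \<otimes> a = \<zero>" by blast
    then show "a \<in> \<qq>" using Q.I_prime[of u a] a Q.zero_closed by simp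
  qed (rule minimal_prime_torsion[OF R q])
qed

text \<open>The residue field at \<pp> is taken as the fraction field of R/\<pp> and not as a
  quotient of the local ring. The map from R is then direct, and its kernel is \<pp> because R/\<pp>
  is a domain.\<close>

definition residue_field :: "'a ring \<Rightarrow> 'a set \<Rightarrow> ('a set \<times> 'a set) set ring" where
  "residue_field R \<pp> = localize_ring (R Quot \<pp>) (carrier (R Quot \<pp>) - {\<zero>\<^bsub>R Quot \<pp>\<^esub>})"

definition residue_map :: "'a ring \<Rightarrow> 'a set \<Rightarrow> 'a \<Rightarrow> ('a set \<times> 'a set) set" where
  "residue_map R \<pp> a = ring_frac (R Quot \<pp>) (carrier (R Quot \<pp>) - {\<zero>\<^bsub>R Quot \<pp>\<^esub>}) (\<pp> +>\<^bsub>R\<^esub> a) \<one>\<^bsub>R Quot \<pp>\<^esub>"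

lemma residue_field:
  fixes R :: "'a ring" (structure)
  assumes p: "\<pp> \<in> Spec R"
  shows "field (residue_field R \<pp>)"
    and "residue_map R \<pp> \<in> Ring.ring_hom R (residue_field R \<pp>)"
    and "a \<in> carrier R \<Longrightarrow> residue_map R \<pp> a = \<zero>\<^bsub>residue_field R \<pp>\<^esub> \<longleftrightarrow> a \<in> \<pp>"
proof -
  interpret P: primeideal \<pp> R using p by (simp add: Spec_def)
  let ?D = "R Quot \<pp>"
  interpret D: domain ?D by (rule P.quotient_is_domain)
  let ?S = "carrier ?D - {\<zero>\<^bsub>?D\<^esub>}"
  have S: "mult_set ?D ?S"
    using D.integral by unfold_locales auto
  have tors: "a \<in> ?S \<or> (\<exists>u\<in>?S. u \<otimes>\<^bsub>?D\<^esub> a = \<zero>\<^bsub>?D\<^esub>)" if "a \<in> carrier ?D" for a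
    using that D.one_not_zero by (cases "a = \<zero>\<^bsub>?D\<^esub>") (auto intro!: bexI[of _ "\<one>\<^bsub>?D\<^esub>"])
  show "field (residue_field R \<pp>)"
    unfolding residue_field_def using tors by (intro field_localize_ring[OF S]) auto
  have c: "(+>) \<pp> \<in> Ring.ring_hom R ?D" by (rule P.rcos_ring_hom)
  then show "residue_map R \<pp> \<in> Ring.ring_hom R (residue_field R \<pp>)"
    using ring_hom_trans[OF c mult_set.loc_hom[OF S]]
    by (simp add: residue_field_def residue_map_def[abs_def] o_def)
  show "residue_map R \<pp> a = \<zero>\<^bsub>residue_field R \<pp>\<^esub> \<longleftrightarrow> a \<in> \<pp>" if a: "a \<in> carrier R"
  proof -
    have ac: "\<pp> +> a \<in> carrier ?D" using ring_hom_closed[OF c a] .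
    have "residue_map R \<pp> a = \<zero>\<^bsub>residue_field R \<pp>\<^esub> \<longleftrightarrow> \<pp> +> a = \<zero>\<^bsub>?D\<^esub>"
      unfolding residue_map_def residue_field_def loc_zero_iff[OF S ac] using D.integral ac D.one_not_zero
      by (auto intro!: bexI[of _ "\<one>\<^bsub>?D\<^esub>"])
    also have "\<dots> \<longleftrightarrow> a \<in> \<pp>"
      using P.rcos_const_imp_mem[OF a] P.a_rcos_const[of a] by (auto simp: FactRing_def)
    finally show ?thesis .
  qed
qed

section \<open>Free resolutions over noetherian rings\<close>

lemma span_eq_hom_image:
  fixes R :: "'a ring" (structure) and M :: "('a, 'b) module"
  assumes M: "module R M" and B: "finite B" "B \<subseteq> carrier M"
  shows "\<exists>m \<phi>. \<phi> \<in> module_hom R (std_free R m) M \<and> \<phi> ` carrier (std_free R m) = LinearCombinations.module.span R M B"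
proof -
  interpret module R M by fact
  obtain b where b: "bij_betw b {..<card B} B"
    using ex_bij_betw_nat_finite[OF B(1)] by (auto simp: atLeast0LessThan)
  let ?m = "card B" and ?\<phi> = "lin_ext R M {..<card B} b"
  have inj: "inj_on b {..<?m}" and img: "b ` {..<?m} = B" using b by (auto simp: bij_betw_def)
  have bM: "b j \<in> carrier M" if "j < ?m" for j using that img B(2) by auto
  have hom: "?\<phi> \<in> module_hom R (std_free R ?m) M"
    unfolding std_free_def using bM by (intro lin_ext_hom[OF M]) auto
  have eq: "?\<phi> v = lincomb a B" if v: "v \<in> carrier (std_free R ?m)" and a: "\<And>j. j < ?m \<Longrightarrow> a (b j) = v j" for v a
  proof -
    have vj: "v j \<in> carrier R" if "j < ?m" for j using v that by (auto simp: carrier_std_free)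
    have "lincomb a B = (\<Oplus>\<^bsub>M\<^esub>x\<in>b ` {..<?m}. a x \<odot>\<^bsub>M\<^esub> x)" by (simp add: lincomb_def img)
    also have "\<dots> = (\<Oplus>\<^bsub>M\<^esub>j\<in>{..<?m}. a (b j) \<odot>\<^bsub>M\<^esub> b j)"
      using a vj bM inj by (intro M.finsum_reindex) auto
    also have "\<dots> = (\<Oplus>\<^bsub>M\<^esub>j\<in>{..<?m}. v j \<odot>\<^bsub>M\<^esub> b j)"
      using a vj bM by (intro M.finsum_cong') auto
    also have "\<dots> = ?\<phi> v" by (rule lin_ext_std[OF M v bM, symmetric])
    finally show ?thesis by simp
  qed
  have "?\<phi> ` carrier (std_free R ?m) = span B"
    unfolding finite_span[OF B]
  proof (intro equalityI subsetI)
    fix y assume "y \<in> ?\<phi> ` carrier (std_free R ?m)"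
    then obtain v where v: "v \<in> carrier (std_free R ?m)" "y = ?\<phi> v" by auto
    let ?a = "\<lambda>x. v (inv_into {..<?m} b x)"
    have "y = lincomb ?a B" unfolding v(2) using inj by (intro eq[OF v(1)]) simp
    moreover have "?a \<in> B \<rightarrow> carrier R"
    proof
      fix x assume "x \<in> B"
      then have "inv_into {..<?m} b x \<in> {..<?m}" by (intro inv_into_into) (simp add: img)
      then show "v (inv_into {..<?m} b x) \<in> carrier R" using v(1) by (auto simp: carrier_std_free)
    qed
    ultimately show "y \<in> {lincomb a B |a. a \<in> B \<rightarrow> carrier R}" by blast
  next
    fix y assume "y \<in> {lincomb a B |a. a \<in> B \<rightarrow> carrier R}"
    then obtain a where a: "a \<in> B \<rightarrow> carrier R" "y = lincomb a B" by blast
    let ?v = "\<lambda>j\<in>{..<?m}. a (b j)"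
    have v: "?v \<in> carrier (std_free R ?m)" using a(1) img by (auto simp: carrier_std_free)
    have "?\<phi> ?v = y" unfolding a(2) by (intro eq[OF v]) simp
    then show "y \<in> ?\<phi> ` carrier (std_free R ?m)" using v by (metis imageI)
  qed
  then show ?thesis using hom by blast
qed

lemma coordinate_ideal:
  fixes R :: "'a ring" (structure)
  assumes R: "cring R" and N: "submodule R N (std_free R n)" and k: "k < n"
  shows "ideal {x k | x. x \<in> N} R"
proof -
  interpret cring R by fact
  interpret N: submodule R N "std_free R n" by fact
  note ops = std_free_ops[OF R]
  have NR: "x k \<in> carrier R" if "x \<in> N" for x
    using that N.subset k by (auto simp: carrier_std_free)
  have sm: "c \<otimes> x k \<in> {x k | x. x \<in> N}" if "x \<in> N" "c \<in> carrier R" for x c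
  proof -
    have "(c \<odot>\<^bsub>std_free R n\<^esub> x) k = c \<otimes> x k" using k by (simp add: ops)
    then show ?thesis using N.smult_closed[OF that(2,1)] by (metis (mono_tags, lifting) mem_Collect_eq)
  qed
  show ?thesis
  proof (rule idealI[OF ring_axioms])
    show "subgroup {x k | x. x \<in> N} (add_monoid R)"
    proof (rule add.subgroupI)
      show "{x k | x. x \<in> N} \<subseteq> carrier R" using NR by auto
      show "{x k | x. x \<in> N} \<noteq> {}" using N.zero_closed by blast
      show "\<ominus> a \<in> {x k | x. x \<in> N}" if "a \<in> {x k | x. x \<in> N}" for a
      proof -
        obtain x where x: "x \<in> N" "a = x k" using \<open>a \<in> {x k | x. x \<in> N}\<close> by blast
        then show ?thesis using sm[OF x(1), of "\<ominus> \<one>"] NR[OF x(1)] by (simp add: l_minus)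
      qed
      show "a \<oplus> b \<in> {x k | x. x \<in> N}" if ab: "a \<in> {x k | x. x \<in> N}" "b \<in> {x k | x. x \<in> N}" for a b
      proof -
        obtain x y where xy: "x \<in> N" "a = x k" "y \<in> N" "b = y k" using ab by blast
        have "(x \<oplus>\<^bsub>std_free R n\<^esub> y) k = a \<oplus> b" using k xy by (simp add: ops)
        then show ?thesis using N.m_closed[OF xy(1,3)] by (metis (mono_tags, lifting) mem_Collect_eq)
      qed
    qed
  next
    fix a c assume "a \<in> {x k | x. x \<in> N}" and c: "c \<in> carrier R"
    then obtain x where x: "x \<in> N" "a = x k" by blast
    show "c \<otimes> a \<in> {x k | x. x \<in> N}" unfolding x(2) by (rule sm[OF x(1) c])
    then show "a \<otimes> c \<in> {x k | x. x \<in> N}" using c x NR by (simp add: m_comm)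
  qed
qed

text \<open>Induction on a bound \<open>k\<close> for the support. The k-th coordinates of the
  submodule form an ideal, which is finitely generated. Lifts of its generators allow the k-th
  coordinate of any element to be cancelled, and what remains has smaller support.\<close>

lemma noetherian_submodule_aux:
  fixes R :: "'a ring" (structure)
  assumes R: "cring R" "noetherian_ring R"
  shows "submodule R N (std_free R n) \<Longrightarrow> (\<forall>x\<in>N. \<forall>i<n. k \<le> i \<longrightarrow> x i = \<zero>) \<Longrightarrow>
    \<exists>B. finite B \<and> B \<subseteq> N \<and> N \<subseteq> LinearCombinations.module.span R (std_free R n) B"
proof (induction k arbitrary: N)
  case 0
  interpret F: module R "std_free R n" by (rule std_free_is_module[OF R(1)])
  interpret N: submodule R N "std_free R n" by fact
  have "N \<subseteq> {\<zero>\<^bsub>std_free R n\<^esub>}"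
    using 0(2) N.subset by (fastforce simp: carrier_std_free std_free_ops[OF R(1)] fun_eq_iff PiE_def extensional_def)
  also have "\<dots> \<subseteq> F.span {}" by (auto simp: F.span_def F.lincomb_def)
  finally show ?case by blast
next
  case (Suc k)
  interpret noetherian_ring R by fact
  interpret cring R by fact
  interpret F: module R "std_free R n" by (rule std_free_is_module[OF R(1)])
  interpret N: submodule R N "std_free R n" by fact
  note ops = std_free_ops[OF R(1)]
  show ?case
  proof (cases "k < n")
    case False
    then show ?thesis using Suc by auto
  next
    case k: True
    obtain A where A: "A \<subseteq> carrier R" "finite A" "{x k | x. x \<in> N} = Idl A"
      using finetely_gen[OF coordinate_ideal[OF R(1) Suc.prems(1) k]] by blast
    have "\<exists>x. x \<in> N \<and> x k = a" if "a \<in> A" for a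
      using genideal_self[OF A(1)] that unfolding A(3)[symmetric] by blast
    then obtain y where y: "\<And>a. a \<in> A \<Longrightarrow> y a \<in> N \<and> y a k = a" by metis
    let ?Y = "y ` A"
    have YN: "?Y \<subseteq> N" using y by auto
    have YF: "?Y \<subseteq> carrier (std_free R n)" using YN N.subset by auto
    have sY: "submodule R (F.span ?Y) (std_free R n)" by (rule F.span_is_submodule[OF YF])
    have YN': "F.span ?Y \<subseteq> N" by (rule F.span_is_subset[OF YN N.submodule_axioms])
    have "A \<subseteq> {x k | x. x \<in> F.span ?Y}"
    proof
      fix a assume a: "a \<in> A"
      then have "y a \<in> F.span ?Y" using F.in_own_span[OF YF] by auto
      then show "a \<in> {x k | x. x \<in> F.span ?Y}" using y[OF a] by (metis (mono_tags, lifting) mem_Collect_eq)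
    qed
    then have J: "{x k | x. x \<in> N} \<subseteq> {x k | x. x \<in> F.span ?Y}"
      unfolding A(3) by (intro genideal_minimal coordinate_ideal[OF R(1) sY k])
    let ?N' = "{x \<in> N. x k = \<zero>}"
    have N': "submodule R ?N' (std_free R n)"
    proof (rule submodule.intro[OF F.module_axioms])
      show "?N' \<subseteq> carrier (std_free R n)" using N.subset by auto
      show "\<zero>\<^bsub>std_free R n\<^esub> \<in> ?N'" using k N.zero_closed by (simp add: ops)
      show "v \<oplus>\<^bsub>std_free R n\<^esub> w \<in> ?N'" if "v \<in> ?N'" "w \<in> ?N'" for v w
        using that k N.m_closed[of v w] by (simp add: ops)
      show "c \<odot>\<^bsub>std_free R n\<^esub> v \<in> ?N'" if "c \<in> carrier R" "v \<in> ?N'" for c v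
        using that k N.smult_closed[of c v] by (simp add: ops)
    qed
    have "\<forall>x\<in>?N'. \<forall>i<n. k \<le> i \<longrightarrow> x i = \<zero>"
    proof (intro ballI allI impI)
      fix x i assume "x \<in> ?N'" "i < n" "k \<le> i"
      then show "x i = \<zero>" using Suc.prems(2) by (cases "i = k") auto
    qed
    then obtain B where B: "finite B" "B \<subseteq> ?N'" "?N' \<subseteq> F.span B" using Suc.IH[OF N'] by blast
    let ?B = "?Y \<union> B"
    have BF: "?B \<subseteq> carrier (std_free R n)" using YF B(2) N.subset by auto
    interpret S: submodule R "F.span ?B" "std_free R n" by (rule F.span_is_submodule[OF BF])
    have "N \<subseteq> F.span ?B"
    proof
      fix x assume x: "x \<in> N"
      then obtain z where z: "z \<in> F.span ?Y" "z k = x k" using J by (smt (verit) mem_Collect_eq subsetD)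
      have zN: "z \<in> N" using z(1) YN' by auto
      have c: "x \<in> carrier (std_free R n)" "z \<in> carrier (std_free R n)" using x zN N.subset by auto
      let ?w = "x \<oplus>\<^bsub>std_free R n\<^esub> (\<ominus> \<one>) \<odot>\<^bsub>std_free R n\<^esub> z"
      have "?w \<in> N" using x zN by simp
      moreover have "x k \<in> carrier R" using c k by (auto simp: carrier_std_free)
      then have "?w k = \<zero>" using k z(2) by (simp add: ops l_minus r_neg)
      ultimately have w: "?w \<in> F.span B" using B(3) by blast
      have "F.span ?Y \<subseteq> F.span ?B" "F.span B \<subseteq> F.span ?B" by (auto intro!: F.span_is_monotone)
      then have "?w \<oplus>\<^bsub>std_free R n\<^esub> z \<in> F.span ?B" using w z(1) by blast
      moreover have "?w \<oplus>\<^bsub>std_free R n\<^esub> z = x"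
        using c by (simp add: F.smult_l_minus F.M.a_assoc F.M.l_neg)
      ultimately show "x \<in> F.span ?B" by simp
    qed
    then show ?thesis using A(2) B(1,2) YN by (intro exI[of _ ?B]) auto
  qed
qed

lemma noetherian_submodule_hom_image:
  fixes R :: "'a ring" (structure)
  assumes R: "cring R" "noetherian_ring R" and N: "submodule R N (std_free R n)"
  shows "\<exists>m \<phi>. \<phi> \<in> module_hom R (std_free R m) (std_free R n) \<and> \<phi> ` carrier (std_free R m) = N"
proof -
  interpret F: module R "std_free R n" by (rule std_free_is_module[OF R(1)])
  obtain B where B: "finite B" "B \<subseteq> N" "N \<subseteq> F.span B"
    using noetherian_submodule_aux[OF R N, of n] by auto
  have "F.span B = N" using B(3) F.span_is_subset[OF B(2) N] by auto
  moreover have "B \<subseteq> carrier (std_free R n)" using B(2) submodule.subset[OF N] by auto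
  ultimately show ?thesis using span_eq_hom_image[OF F.module_axioms B(1)] by metis
qed

lemma finite_free_resolution_exists:
  fixes R :: "'a ring" (structure) and M :: "('a, 'b) module"
  assumes R: "cring R" "noetherian_ring R" and M: "module R M" "finite_module R M"
  shows "\<exists>r \<delta> \<epsilon>. finite_free_resolution R M r \<delta> \<epsilon>"
proof -
  obtain A where A: "finite A" "A \<subseteq> carrier M" "LinearCombinations.module.span R M A = carrier M"
    using M(2) by (auto simp: finite_module_def)
  obtain r0 \<epsilon> where e: "\<epsilon> \<in> module_hom R (std_free R r0) M" "\<epsilon> ` carrier (std_free R r0) = carrier M"
    using span_eq_hom_image[OF M(1) A(1,2)] A(3) by metis
  note F = std_free_is_module[OF R(1)]
  \<comment> \<open>Dependent choice runs over states (n, m, \<psi>), where \<psi> maps R^m to R^n.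
    Its kernel lies in a finite free module over a noetherian ring and is thus the image of the next
    map. The clause at index zero ties the first map to the augmentation.\<close>
  let ?P = "\<lambda>k (n, m, \<psi>). \<psi> \<in> module_hom R (std_free R m) (std_free R n) \<and>
      (k = (0::nat) \<longrightarrow> n = r0 \<and> \<psi> ` carrier (std_free R m) = {x \<in> carrier (std_free R n). \<epsilon> x = \<zero>\<^bsub>M\<^esub>})"
  let ?Q = "\<lambda>k (n, m, \<psi>) (n', m', \<psi>'). n' = m \<and>
      \<psi>' ` carrier (std_free R m') = {x \<in> carrier (std_free R m). \<psi> x = \<zero>\<^bsub>std_free R n\<^esub>}"
  have "\<exists>s. \<forall>k. ?P k (s k) \<and> ?Q k (s k) (s (Suc k))"
  proof (rule dependent_nat_choice)
    obtain m \<psi> where "\<psi> \<in> module_hom R (std_free R m) (std_free R r0)"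
      "\<psi> ` carrier (std_free R m) = {x \<in> carrier (std_free R r0). \<epsilon> x = \<zero>\<^bsub>M\<^esub>}"
      using noetherian_submodule_hom_image[OF R hom_kernel_submodule[OF F M(1) e(1)]] by blast
    then have "?P 0 (r0, m, \<psi>)" by simp
    then show "\<exists>x. ?P 0 x" by (rule exI)
  next
    fix x k assume P: "?P k x"
    obtain n m \<psi> where x: "x = (n, m, \<psi>)" by (cases x)
    then have "\<psi> \<in> module_hom R (std_free R m) (std_free R n)" using P by simp
    then obtain m' \<psi>' where "\<psi>' \<in> module_hom R (std_free R m') (std_free R m)"
      "\<psi>' ` carrier (std_free R m') = {x \<in> carrier (std_free R m). \<psi> x = \<zero>\<^bsub>std_free R n\<^esub>}"
      using noetherian_submodule_hom_image[OF R hom_kernel_submodule[OF F F]] by blast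
    then have "?P (Suc k) (m, m', \<psi>') \<and> ?Q k x (m, m', \<psi>')" by (simp add: x)
    then show "\<exists>y. ?P (Suc k) y \<and> ?Q k x y" by (rule exI)
  qed
  then obtain s where s: "\<And>k. ?P k (s k) \<and> ?Q k (s k) (s (Suc k))" by blast
  define n where "n k = fst (s k)" for k
  define \<psi> where "\<psi> k = snd (snd (s k))" for k
  have m: "fst (snd (s k)) = n (Suc k)" for k using s[of k] by (auto simp: n_def split: prod.splits)
  have n0: "n 0 = r0" using s[of 0] by (auto simp: n_def split: prod.splits)
  have hom: "\<psi> k \<in> module_hom R (std_free R (n (Suc k))) (std_free R (n k))" for k
    using s[of k] by (auto simp: n_def \<psi>_def split: prod.splits)
  have ex0: "\<psi> 0 ` carrier (std_free R (n 1)) = {x \<in> carrier (std_free R (n 0)). \<epsilon> x = \<zero>\<^bsub>M\<^esub>}"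
    using s[of 0] m[of 0] by (auto simp: n_def \<psi>_def split: prod.splits)
  have ex: "\<psi> (Suc k) ` carrier (std_free R (n (Suc (Suc k)))) = {x \<in> carrier (std_free R (n (Suc k))). \<psi> k x = \<zero>\<^bsub>std_free R (n k)\<^esub>}" for k
    using s[of k] m[of "Suc k"] by (auto simp: n_def \<psi>_def split: prod.splits)
  define r where "r i = (if i < 0 then 0 else n (nat i))" for i :: int
  \<comment> \<open>The map \<psi> k is the differential leaving degree k + 1, hence the shift by
    one. In degrees at most zero the differential is zero.\<close>
  define \<delta> where "\<delta> i = (if i \<ge> 1 then \<psi> (nat (i - 1)) else (\<lambda>_. \<zero>\<^bsub>std_free R (r (i - 1))\<^esub>))" for i :: int
  have ri: "r (int k) = n k" for k by (simp add: r_def)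
  have di: "\<delta> (int k + 1) = \<psi> k" for k by (simp add: \<delta>_def)
  have homi: "\<delta> i \<in> module_hom R (std_free R (r i)) (std_free R (r (i - 1)))" for i
  proof (cases "i \<ge> 1")
    case True
    define k where "k = nat (i - 1)"
    have k: "i = int k + 1" using True by (simp add: k_def)
    have i: "i = int (Suc k)" "i - 1 = int k" by (simp_all add: k)
    have "r i = n (Suc k)" by (simp only: i(1) ri)
    moreover have "r (i - 1) = n k" by (simp only: i(2) ri)
    moreover have "\<delta> i = \<psi> k" by (simp only: k di)
    ultimately show ?thesis using hom[of k] by simp
  next
    case False
    then show ?thesis unfolding \<delta>_def by (simp only: if_False) (rule module_hom_zero_map[OF F F])
  qed
  have "exact_at (std_free R (r (i + 1))) (\<delta> (i + 1)) (std_free R (r i)) (\<delta> i) (std_free R (r (i - 1)))" if "i \<ge> 1" for i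
  proof -
    define k where "k = nat (i - 1)"
    have k: "i = int k + 1" using that by (simp add: k_def)
    have i: "i = int (Suc k)" "i - 1 = int k" "i + 1 = int (Suc (Suc k))" by (simp_all add: k)
    have "r i = n (Suc k)" by (simp only: i(1) ri)
    moreover have "r (i - 1) = n k" by (simp only: i(2) ri)
    moreover have "r (i + 1) = n (Suc (Suc k))" by (simp only: i(3) ri)
    moreover have "\<delta> (i + 1) = \<psi> (Suc k)" by (simp only: i(1) di)
    moreover have "\<delta> i = \<psi> k" by (simp only: k di)
    ultimately show ?thesis using ex[of k] by (simp add: exact_at_def)
  qed
  moreover have "exact_at (std_free R (r 1)) (\<delta> 1) (std_free R (r 0)) \<epsilon> M"
    using ex0 ri[of 0] ri[of 1] di[of 0] by (simp add: exact_at_def)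
  ultimately have "finite_free_resolution R M r \<delta> \<epsilon>"
    unfolding finite_free_resolution_def using homi e n0 ri[of 0] by (simp add: r_def)
  then show ?thesis by blast
qed

text \<open>The resolution picked inside \<open>higher_fitting\<close> depends on neither
  \<open>i\<close> nor \<open>m\<close>. Existence turns the choice into an actual resolution, and
  the whole argument is carried out on that one.\<close>

lemma higher_fitting_eq:
  fixes R :: "'a ring" and M :: "('a, 'b) module"
  assumes R: "cring R" "noetherian_ring R" and M: "module R M" "finite_module R M"
  obtains r \<delta> \<epsilon> where "finite_free_resolution R M r \<delta> \<epsilon>"
    "\<And>i m. higher_fitting R M i m = minors_ideal R (r i) (r (i - 1)) (\<delta> i) (fitting_chi r i - m)"
proof -
  define rd where "rd = (SOME (r, \<delta>). \<exists>\<epsilon>. finite_free_resolution R M r \<delta> \<epsilon>)"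
  have "\<exists>x. case x of (r, \<delta>) \<Rightarrow> \<exists>\<epsilon>. finite_free_resolution R M r \<delta> \<epsilon>"
    using finite_free_resolution_exists[OF assms] by auto
  then have "case rd of (r, \<delta>) \<Rightarrow> \<exists>\<epsilon>. finite_free_resolution R M r \<delta> \<epsilon>"
    unfolding rd_def by (rule someI_ex)
  then obtain r \<delta> \<epsilon> where "rd = (r, \<delta>)" "finite_free_resolution R M r \<delta> \<epsilon>" by (auto split: prod.splits)
  then show ?thesis
    by (intro that[of r \<delta> \<epsilon>]) (simp_all add: higher_fitting_def flip: rd_def)
qed

section \<open>Comparison of resolutions\<close>

lemma projective_resolutionD:
  assumes "projective_resolution R N P \<delta> \<epsilon>"
  shows "projective_module R (P i)" "module R (P i)" "\<delta> i \<in> module_hom R (P (Suc i)) (P i)"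
    "\<epsilon> \<in> module_hom R (P 0) N" "\<epsilon> ` carrier (P 0) = carrier N"
    "\<delta> 0 ` carrier (P 1) = {x \<in> carrier (P 0). \<epsilon> x = \<zero>\<^bsub>N\<^esub>}"
    "\<delta> (Suc i) ` carrier (P (Suc (Suc i))) = {x \<in> carrier (P (Suc i)). \<delta> i x = \<zero>\<^bsub>P i\<^esub>}"
  using assms by (simp_all add: projective_resolution_def projective_module_def exact_at_def)

lemma projective_resolution_zero:
  assumes "projective_resolution R N P \<delta> \<epsilon>"
  shows "x \<in> carrier (P 1) \<Longrightarrow> \<epsilon> (\<delta> 0 x) = \<zero>\<^bsub>N\<^esub>"
    and "y \<in> carrier (P (Suc (Suc i))) \<Longrightarrow> \<delta> i (\<delta> (Suc i) y) = \<zero>\<^bsub>P i\<^esub>"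
  using projective_resolutionD(6)[OF assms] projective_resolutionD(7)[OF assms, of i] by auto

text \<open>The identity of \<open>N\<close> is lifted degree by degree. The two resolutions may
  have different element types, since one is built from \<open>std_free\<close> and the other comes
  from the definition of \<open>proj_dim\<close>.\<close>

lemma comparison:
  fixes R :: "'a ring" and N :: "('a, 'b) module"
    and X :: "nat \<Rightarrow> ('a, 'x) module" and Y :: "nat \<Rightarrow> ('a, 'y) module"
  assumes X: "projective_resolution R N X dX eX" and Y: "projective_resolution R N Y dY eY" and N: "module R N"
  shows "\<exists>f. \<forall>i. f i \<in> module_hom R (X i) (Y i) \<and> (\<forall>x\<in>carrier (X 0). eY (f 0 x) = eX x) \<and>
    (\<forall>x\<in>carrier (X (Suc i)). dY i (f (Suc i) x) = f i (dX i x))"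
proof -
  note DX = projective_resolutionD[OF X] and DY = projective_resolutionD[OF Y]
  note zX = projective_resolution_zero[OF X] and zY = projective_resolution_zero[OF Y]
  \<comment> \<open>The last clause says that \<open>f\<close> after the differential lands in the
    image of the next differential of \<open>Y\<close>; it is exactly the premise for lifting once
    more.\<close>
  let ?P = "\<lambda>i f. f \<in> module_hom R (X i) (Y i) \<and> (i = 0 \<longrightarrow> (\<forall>x\<in>carrier (X 0). eY (f x) = eX x)) \<and>
    (\<forall>x\<in>carrier (X (Suc i)). f (dX i x) \<in> dY i ` carrier (Y (Suc i)))"
  let ?Q = "\<lambda>i f f'. \<forall>x\<in>carrier (X (Suc i)). dY i (f' x) = f (dX i x)"
  have "\<exists>f. \<forall>i. ?P i (f i) \<and> ?Q i (f i) (f (Suc i))"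
  proof (rule dependent_nat_choice)
    have "\<exists>f\<in>module_hom R (X 0) (Y 0). \<forall>x\<in>carrier (X 0). eY (f x) = eX x"
      using DY(5) module_hom_in[OF DX(4)] by (intro projective_lift[OF DX(1) DY(2) N DX(4) DY(4)]) auto
    then obtain f where f: "f \<in> module_hom R (X 0) (Y 0)" "\<forall>x\<in>carrier (X 0). eY (f x) = eX x" by blast
    have "f (dX 0 x) \<in> dY 0 ` carrier (Y (Suc 0))" if x: "x \<in> carrier (X (Suc 0))" for x
    proof -
      have d: "dX 0 x \<in> carrier (X 0)" using module_hom_in[OF DX(3)] x by simp
      then have "eY (f (dX 0 x)) = \<zero>\<^bsub>N\<^esub>" using f(2) zX(1) x by simp
      then show ?thesis using DY(6) module_hom_in[OF f(1) d] by simp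
    qed
    then show "\<exists>f. ?P 0 f" using f by blast
  next
    fix f i assume P: "?P i f"
    have "\<exists>f'\<in>module_hom R (X (Suc i)) (Y (Suc i)). \<forall>x\<in>carrier (X (Suc i)). dY i (f' x) = f (dX i x)"
      using P by (intro projective_lift[OF DX(1) DY(2) DY(2) _ DY(3)] module_hom_comp[OF DX(3)]) auto
    then obtain f' where f': "f' \<in> module_hom R (X (Suc i)) (Y (Suc i))" "?Q i f f'" by blast
    have "f' (dX (Suc i) x) \<in> dY (Suc i) ` carrier (Y (Suc (Suc i)))" if x: "x \<in> carrier (X (Suc (Suc i)))" for x
    proof -
      have d: "dX (Suc i) x \<in> carrier (X (Suc i))" using module_hom_in[OF DX(3) x] .
      have "f \<in> module_hom R (X i) (Y i)" using P by blast
      then have "dY i (f' (dX (Suc i) x)) = \<zero>\<^bsub>Y i\<^esub>"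
        using f'(2) d zX(2)[OF x] module_hom_zero[OF DX(2) DY(2)] by simp
      then show ?thesis using DY(7) module_hom_in[OF f'(1) d] by simp
    qed
    then show "\<exists>f'. ?P (Suc i) f' \<and> ?Q i f f'" using f' by (intro exI[of _ f'] conjI) auto
  qed
  then obtain f where f: "\<And>i. ?P i (f i) \<and> ?Q i (f i) (f (Suc i))" by blast
  then show ?thesis using f[of 0] by (intro exI[of _ f]) blast
qed

text \<open>If a resolution \<open>P\<close> vanishes in degree \<open>n + 1\<close>, the endomorphism of \<open>F\<close> that factors
  through \<open>P\<close> vanishes there too, and a homotopy from it to the identity yields a generalized
  inverse of the differential.\<close>

lemma generalized_inverse_of_differential:
  fixes R :: "'a ring" and N :: "('a, 'b) module"
    and F :: "nat \<Rightarrow> ('a, 'x) module" and P :: "nat \<Rightarrow> ('a, 'y) module"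
  assumes F: "projective_resolution R N F D e" and P: "projective_resolution R N P \<delta> \<epsilon>" and N: "module R N"
    and vanish: "carrier (P (Suc n)) = {\<zero>\<^bsub>P (Suc n)\<^esub>}"
  shows "\<exists>h\<in>module_hom R (F n) (F (Suc n)). \<forall>x\<in>carrier (F (Suc n)). D n (h (D n x)) = D n x"
proof -
  note DF = projective_resolutionD[OF F] and DP = projective_resolutionD[OF P]
  note zF = projective_resolution_zero[OF F]
  obtain \<alpha> where \<alpha>: "\<And>i. \<alpha> i \<in> module_hom R (F i) (P i)" "\<And>x. x \<in> carrier (F 0) \<Longrightarrow> \<epsilon> (\<alpha> 0 x) = e x"
    "\<And>i x. x \<in> carrier (F (Suc i)) \<Longrightarrow> \<delta> i (\<alpha> (Suc i) x) = \<alpha> i (D i x)"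
    using comparison[OF F P N] by metis
  obtain \<beta> where \<beta>: "\<And>i. \<beta> i \<in> module_hom R (P i) (F i)" "\<And>x. x \<in> carrier (P 0) \<Longrightarrow> e (\<beta> 0 x) = \<epsilon> x"
    "\<And>i x. x \<in> carrier (P (Suc i)) \<Longrightarrow> D i (\<beta> (Suc i) x) = \<beta> i (\<delta> i x)"
    using comparison[OF P F N] by metis
  \<comment> \<open>The identity minus the endomorphism through \<open>P\<close>. It is a chain map
    lifting the zero map of \<open>N\<close>, hence null-homotopic, and it equals the identity
    wherever \<open>P\<close> vanishes.\<close>
  define g where "g i x = x \<ominus>\<^bsub>F i\<^esub> \<beta> i (\<alpha> i x)" for i x
  have g: "g i \<in> module_hom R (F i) (F i)" for i
    unfolding g_def[abs_def]
    by (intro module_hom_diff[OF DF(2) DF(2)] module_hom_id module_hom_comp[OF \<alpha>(1) \<beta>(1)])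
  have e0: "e (g 0 x) = \<zero>\<^bsub>N\<^esub>" if x: "x \<in> carrier (F 0)" for x
  proof -
    interpret N: module R N by fact
    have ax: "\<alpha> 0 x \<in> carrier (P 0)" using module_hom_in[OF \<alpha>(1) x] .
    show ?thesis
      unfolding g_def module_hom_minus[OF DF(2) N DF(4) x module_hom_in[OF \<beta>(1) ax]]
      using module_hom_in[OF DF(4) x] \<beta>(2)[OF ax] \<alpha>(2)[OF x] by (simp add: a_minus_def N.M.r_neg)
  qed
  have chain: "D i (g (Suc i) x) = g i (D i x)" if x: "x \<in> carrier (F (Suc i))" for i x
  proof -
    have ax: "\<alpha> (Suc i) x \<in> carrier (P (Suc i))" using module_hom_in[OF \<alpha>(1) x] .
    show ?thesis
      unfolding g_def module_hom_minus[OF DF(2) DF(2) DF(3) x module_hom_in[OF \<beta>(1) ax]]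
      by (simp add: \<beta>(3)[OF ax] \<alpha>(3)[OF x])
  qed
  \<comment> \<open>This is the null-homotopy g = D h + h' D composed with \<open>D i\<close> on the
    right, which removes the term from the lower degree. In degree \<open>n\<close> it reads D h D =
    g D = D g, and D g = D because \<open>g (Suc n)\<close> is the identity.\<close>
  have "\<exists>h\<in>module_hom R (F i) (F (Suc i)). \<forall>x\<in>carrier (F (Suc i)). D i (h (D i x)) = g i (D i x)" for i
  proof (induction i)
    case 0
    have "\<exists>h\<in>module_hom R (F 0) (F (Suc 0)). \<forall>x\<in>carrier (F 0). D 0 (h x) = g 0 x"
      using DF(6) e0 module_hom_in[OF g] by (intro projective_lift[OF DF(1,2) DF(2) g DF(3)]) auto
    then show ?case using module_hom_in[OF DF(3)] by blast
  next
    case (Suc i)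
    then obtain h where h: "h \<in> module_hom R (F i) (F (Suc i))"
      "\<And>x. x \<in> carrier (F (Suc i)) \<Longrightarrow> D i (h (D i x)) = g i (D i x)" by blast
    interpret Fi: module R "F i" by (rule DF(2))
    interpret Fs: module R "F (Suc i)" by (rule DF(2))
    let ?w = "\<lambda>x. g (Suc i) x \<ominus>\<^bsub>F (Suc i)\<^esub> h (D i x)"
    have w: "?w \<in> module_hom R (F (Suc i)) (F (Suc i))"
      by (intro module_hom_diff[OF DF(2) DF(2) g] module_hom_comp[OF DF(3) h(1)])
    have wim: "?w x \<in> D (Suc i) ` carrier (F (Suc (Suc i)))" if x: "x \<in> carrier (F (Suc i))" for x
    proof -
      have c: "g (Suc i) x \<in> carrier (F (Suc i))" "h (D i x) \<in> carrier (F (Suc i))" "g i (D i x) \<in> carrier (F i)"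
        using module_hom_in[OF g] module_hom_in[OF h(1)] module_hom_in[OF DF(3)] x by auto
      have "D i (?w x) = \<zero>\<^bsub>F i\<^esub>"
        unfolding module_hom_minus[OF DF(2) DF(2) DF(3) c(1,2)]
        using c(3) by (simp add: chain[OF x] h(2)[OF x] a_minus_def Fi.M.r_neg)
      then show ?thesis using DF(7) module_hom_in[OF w x] by auto
    qed
    obtain h' where h': "h' \<in> module_hom R (F (Suc i)) (F (Suc (Suc i)))"
      "\<And>x. x \<in> carrier (F (Suc i)) \<Longrightarrow> D (Suc i) (h' x) = ?w x"
      using projective_lift[OF DF(1) DF(2) DF(2) w DF(3) wim] by blast
    have "D (Suc i) (h' (D (Suc i) y)) = g (Suc i) (D (Suc i) y)" if y: "y \<in> carrier (F (Suc (Suc i)))" for y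
    proof -
      have d: "D (Suc i) y \<in> carrier (F (Suc i))" using module_hom_in[OF DF(3) y] .
      have c: "g (Suc i) (D (Suc i) y) \<in> carrier (F (Suc i))" using module_hom_in[OF g d] .
      have "D (Suc i) (h' (D (Suc i) y)) = g (Suc i) (D (Suc i) y) \<ominus>\<^bsub>F (Suc i)\<^esub> h (D i (D (Suc i) y))"
        by (rule h'(2)[OF d])
      also have "\<dots> = g (Suc i) (D (Suc i) y)"
        unfolding zF(2)[OF y] module_hom_zero[OF DF(2) DF(2) h(1)] using c by (simp add: a_minus_def)
      finally show ?thesis .
    qed
    then show ?case using h'(1) by blast
  qed
  then obtain h where h: "h \<in> module_hom R (F n) (F (Suc n))"
    "\<And>x. x \<in> carrier (F (Suc n)) \<Longrightarrow> D n (h (D n x)) = g n (D n x)" by blast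
  have "D n (h (D n x)) = D n x" if x: "x \<in> carrier (F (Suc n))" for x
  proof -
    interpret Fs: module R "F (Suc n)" by (rule DF(2))
    have "\<alpha> (Suc n) x = \<zero>\<^bsub>P (Suc n)\<^esub>" using module_hom_in[OF \<alpha>(1) x] vanish by blast
    then have "g (Suc n) x = x"
      unfolding g_def using x module_hom_zero[OF DP(2) DF(2) \<beta>(1)] by (simp add: a_minus_def)
    then show ?thesis using h(2)[OF x] chain[OF x] by simp
  qed
  then show ?thesis using h(1) by blast
qed

section \<open>Ranks of base changes\<close>

abbreviation mat_change ::
  "'a ring \<Rightarrow> 'k ring \<Rightarrow> ('a \<Rightarrow> 'k) \<Rightarrow> nat \<Rightarrow> nat \<Rightarrow> ((nat \<Rightarrow> 'a) \<Rightarrow> nat \<Rightarrow> 'a) \<Rightarrow> (nat \<Rightarrow> 'k) \<Rightarrow> nat \<Rightarrow> 'k" where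
  "mat_change R K \<phi> n l T \<equiv> base_change R K n (std_free K l) (map_vec \<phi> l) T"

definition rank_at ::
  "'a ring \<Rightarrow> 'k ring \<Rightarrow> ('a \<Rightarrow> 'k) \<Rightarrow> nat \<Rightarrow> nat \<Rightarrow> ((nat \<Rightarrow> 'a) \<Rightarrow> nat \<Rightarrow> 'a) \<Rightarrow> nat" where
  "rank_at R K \<phi> n l T = vdim K (std_free K l) (mat_change R K \<phi> n l T ` carrier (std_free K n))"

lemma base_change_eqI:
  fixes R :: "'a ring" and K :: "'k ring"
  assumes "cring R" "module R M" "module K M'" "semilinear \<phi> R M M' h" "T \<in> module_hom R (std_free R n) M"
    and G: "G \<in> module_hom K (std_free K n) M'" "\<And>j. j < n \<Longrightarrow> G (std_basis K n j) = h (T (std_basis R n j))"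
    and y: "y \<in> carrier (std_free K n)"
  shows "base_change R K n M' h T y = G y"
  using base_change_std_basis[OF assms(1-5)] G(2)
  by (intro std_hom_eqI[OF assms(3) base_change_hom[OF assms(1-5)] G(1) _ y]) simp

lemma mat_change_hom:
  assumes "cring R" "cring K" "\<phi> \<in> Ring.ring_hom R K" "T \<in> module_hom R (std_free R n) (std_free R l)"
  shows "mat_change R K \<phi> n l T \<in> module_hom K (std_free K n) (std_free K l)"
  using assms by (intro base_change_hom[OF _ _ _ semilinear_map_vec]) (auto simp: std_free_is_module)

lemma mat_change_map_vec:
  assumes "cring R" "cring K" "\<phi> \<in> Ring.ring_hom R K" "T \<in> module_hom R (std_free R n) (std_free R l)"
    "x \<in> carrier (std_free R n)"
  shows "mat_change R K \<phi> n l T (map_vec \<phi> n x) = map_vec \<phi> l (T x)"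
  using assms by (intro base_change_map_vec[OF _ _ _ _ _ semilinear_map_vec]) (auto simp: std_free_is_module)

lemma mat_change_eqI:
  assumes "cring R" "cring K" "\<phi> \<in> Ring.ring_hom R K" "T \<in> module_hom R (std_free R n) (std_free R l)"
    and "G \<in> module_hom K (std_free K n) (std_free K l)"
    and "\<And>j. j < n \<Longrightarrow> G (std_basis K n j) = map_vec \<phi> l (T (std_basis R n j))" "y \<in> carrier (std_free K n)"
  shows "mat_change R K \<phi> n l T y = G y"
  using assms by (intro base_change_eqI[OF _ _ _ semilinear_map_vec]) (auto simp: std_free_is_module)

lemma mat_change_comp:
  assumes R: "cring R" and K: "cring K" and \<phi>: "\<phi> \<in> Ring.ring_hom R K"
    and T: "T \<in> module_hom R (std_free R a) (std_free R b)" and U: "U \<in> module_hom R (std_free R b) (std_free R c)"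
    and y: "y \<in> carrier (std_free K a)"
  shows "mat_change R K \<phi> a c (\<lambda>x. U (T x)) y = mat_change R K \<phi> b c U (mat_change R K \<phi> a b T y)"
proof (rule mat_change_eqI[OF R K \<phi> module_hom_comp[OF T U] module_hom_comp[OF mat_change_hom[OF R K \<phi> T] mat_change_hom[OF R K \<phi> U]] _ y])
  fix j
  show "mat_change R K \<phi> b c U (mat_change R K \<phi> a b T (std_basis K a j)) = map_vec \<phi> c (U (T (std_basis R a j)))"
    unfolding map_vec_std_basis[OF R K \<phi>, symmetric] mat_change_map_vec[OF R K \<phi> T std_basis_in[OF R]]
    by (rule mat_change_map_vec[OF R K \<phi> U module_hom_in[OF T std_basis_in[OF R]]])
qed

lemma rank_at_via_minors:
  fixes R :: "'a ring" and K :: "'k ring"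
  assumes R: "cring R" and K: "field K" and \<phi>: "\<phi> \<in> Ring.ring_hom R K"
    and T: "T \<in> module_hom R (std_free R n) (std_free R l)"
  defines "r \<equiv> rank_at R K \<phi> n l T"
  shows "\<exists>f g. selection r l f \<and> selection r n g \<and> \<phi> (minor R n T r f g) \<noteq> \<zero>\<^bsub>K\<^esub>"
    and "\<And>m f g. r < m \<Longrightarrow> selection m l f \<Longrightarrow> selection m n g \<Longrightarrow> \<phi> (minor R n T m f g) = \<zero>\<^bsub>K\<^esub>"
proof -
  have Kc: "cring K" using K by (simp add: field_def domain_def)
  have eq: "minor K n (mat_change R K \<phi> n l T) m f g = \<phi> (minor R n T m f g)" if "selection m l f" "selection m n g" for m f g
    using that by (intro minor_base_change[OF R Kc \<phi> T]) (auto simp: selection_def)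
  note rk = rank_via_minors[OF K mat_change_hom[OF R Kc \<phi> T], folded rank_at_def r_def]
  show "\<exists>f g. selection r l f \<and> selection r n g \<and> \<phi> (minor R n T r f g) \<noteq> \<zero>\<^bsub>K\<^esub>"
    using rk(1) eq by metis
  show "\<And>m f g. r < m \<Longrightarrow> selection m l f \<Longrightarrow> selection m n g \<Longrightarrow> \<phi> (minor R n T m f g) = \<zero>\<^bsub>K\<^esub>"
    using rk(2) eq by metis
qed

text \<open>Semicontinuity of rank: a minor over \<open>R\<close> that survives in \<open>K'\<close>
  survives in \<open>K\<close>, because the kernel of \<phi> is contained in that of \<psi>.\<close>

lemma rank_at_mono:
  fixes R :: "'a ring" and K :: "'k ring" and K' :: "'k2 ring"
  assumes R: "cring R" and K: "field K" "\<phi> \<in> Ring.ring_hom R K" and K': "field K'" "\<psi> \<in> Ring.ring_hom R K'"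
    and ker: "\<And>a. a \<in> carrier R \<Longrightarrow> \<phi> a = \<zero>\<^bsub>K\<^esub> \<Longrightarrow> \<psi> a = \<zero>\<^bsub>K'\<^esub>"
    and T: "T \<in> module_hom R (std_free R n) (std_free R l)"
  shows "rank_at R K' \<psi> n l T \<le> rank_at R K \<phi> n l T"
proof (rule ccontr)
  assume "\<not> ?thesis"
  then have less: "rank_at R K \<phi> n l T < rank_at R K' \<psi> n l T" by simp
  obtain f g where fg: "selection (rank_at R K' \<psi> n l T) l f" "selection (rank_at R K' \<psi> n l T) n g"
    "\<psi> (minor R n T (rank_at R K' \<psi> n l T) f g) \<noteq> \<zero>\<^bsub>K'\<^esub>"
    using rank_at_via_minors(1)[OF R K' T] by blast
  have "minor R n T (rank_at R K' \<psi> n l T) f g \<in> carrier R"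
    unfolding minor_def using module_hom_in[OF T std_basis_in[OF R]] fg(1)
    by (intro ring_det_closed[OF R]) (auto simp: carrier_std_free selection_def)
  then show False using ker rank_at_via_minors(2)[OF R K T less fg(1,2)] fg(3) by blast
qed

text \<open>The generalized inverse identity \<open>A H A = s A\<close> identifies the kernel of
  \<open>f = s - A H\<close> with the image of \<open>A\<close> wherever \<open>s\<close> is invertible. Since neither the rank of \<open>A\<close>
  nor that of \<open>f\<close> can grow under specialization and their sum is constant, both are constant.\<close>

lemma rank_at_complement:
  fixes R :: "'a ring" and K :: "'k ring"
  assumes R: "cring R" and K: "field K" "\<phi> \<in> Ring.ring_hom R K"
    and A: "A \<in> module_hom R (std_free R n) (std_free R l)" and H: "H \<in> module_hom R (std_free R l) (std_free R n)"
    and s: "s \<in> carrier R" "\<phi> s \<noteq> \<zero>\<^bsub>K\<^esub>"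
    and AHA: "\<And>x. x \<in> carrier (std_free R n) \<Longrightarrow> A (H (A x)) = s \<odot>\<^bsub>std_free R l\<^esub> A x"
  defines "f \<equiv> \<lambda>x. s \<odot>\<^bsub>std_free R l\<^esub> x \<ominus>\<^bsub>std_free R l\<^esub> A (H x)"
  shows "f \<in> module_hom R (std_free R l) (std_free R l)"
    and "rank_at R K \<phi> n l A + rank_at R K \<phi> l l f = l"
proof -
  interpret R: cring R by fact
  interpret K: field K by fact
  have Kc: "cring K" ..
  let ?F = "std_free R l" and ?V = "std_free K l" and ?W = "std_free K n"
  interpret F: module R ?F by (rule std_free_is_module[OF R])
  interpret V: module K ?V by (rule std_free_is_module[OF Kc])
  interpret W: module K ?W by (rule std_free_is_module[OF Kc])
  show f: "f \<in> module_hom R ?F ?F"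
    unfolding f_def
    by (intro module_hom_diff module_hom_smult_map[where f = "\<lambda>x. x"] module_hom_id module_hom_comp[OF H A] s F.module_axioms)
  let ?A = "mat_change R K \<phi> n l A" and ?f = "mat_change R K \<phi> l l f" and ?H = "mat_change R K \<phi> l n H"
  note hom = mat_change_hom[OF R Kc K(2)] and sl = semilinear_map_vec[OF R Kc K(2), of l]
  have u: "\<phi> s \<in> Units K" using s ring_hom_closed[OF K(2) s(1)] by (simp add: K.field_Units)
  \<comment> \<open>The base change of \<open>f\<close> is known on basis vectors only, so its
    formula is obtained by comparing two linear maps there.\<close>
  have fy: "?f y = \<phi> s \<odot>\<^bsub>?V\<^esub> y \<ominus>\<^bsub>?V\<^esub> ?A (?H y)" if y: "y \<in> carrier ?V" for y
  proof (rule mat_change_eqI[OF R Kc K(2) f _ _ y])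
    show "(\<lambda>y. \<phi> s \<odot>\<^bsub>?V\<^esub> y \<ominus>\<^bsub>?V\<^esub> ?A (?H y)) \<in> module_hom K ?V ?V"
      using u by (intro module_hom_diff module_hom_smult_map[where f = "\<lambda>x. x"] module_hom_id
          module_hom_comp[OF hom[OF H] hom[OF A]] V.module_axioms) auto
    fix j
    let ?b = "std_basis R l j"
    have b: "?b \<in> carrier ?F" "H ?b \<in> carrier (std_free R n)" "A (H ?b) \<in> carrier ?F"
      using std_basis_in[OF R] module_hom_in[OF H] module_hom_in[OF A] by auto
    \<comment> \<open>\<open>semilinear\<close> speaks of sums and scalar multiples; writing the
      negative as a multiple by minus one brings it into that form.\<close>
    have neg: "\<ominus>\<^bsub>?F\<^esub> A (H ?b) = (\<ominus>\<^bsub>R\<^esub> \<one>\<^bsub>R\<^esub>) \<odot>\<^bsub>?F\<^esub> A (H ?b)" using b by (simp add: F.smult_l_minus)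
    interpret ring_hom_cring R K \<phi>
      using R Kc K(2) by (simp add: ring_hom_cring_def ring_hom_cring_axioms_def)
    have "map_vec \<phi> l (f ?b) = \<phi> s \<odot>\<^bsub>?V\<^esub> map_vec \<phi> l ?b \<ominus>\<^bsub>?V\<^esub> map_vec \<phi> l (A (H ?b))"
      using sl b s semilinear_in[OF sl b(3)] by (simp add: f_def a_minus_def neg semilinear_def V.smult_l_minus)
    then show "\<phi> s \<odot>\<^bsub>?V\<^esub> std_basis K l j \<ominus>\<^bsub>?V\<^esub> ?A (?H (std_basis K l j)) = map_vec \<phi> l (f ?b)"
      by (simp add: mat_change_map_vec[OF R Kc K(2) H b(1)] mat_change_map_vec[OF R Kc K(2) A b(2)]
          flip: map_vec_std_basis[OF R Kc K(2)])
  qed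
  have "{x \<in> carrier ?V. ?f x = \<zero>\<^bsub>?V\<^esub>} = ?A ` carrier ?W"
  proof (intro equalityI subsetI)
    fix x assume "x \<in> {x \<in> carrier ?V. ?f x = \<zero>\<^bsub>?V\<^esub>}"
    then have x: "x \<in> carrier ?V" "\<phi> s \<odot>\<^bsub>?V\<^esub> x \<ominus>\<^bsub>?V\<^esub> ?A (?H x) = \<zero>\<^bsub>?V\<^esub>" using fy by auto
    have c: "?H x \<in> carrier ?W" "?A (?H x) \<in> carrier ?V"
      using module_hom_in[OF hom[OF H]] module_hom_in[OF hom[OF A]] x(1) by auto
    have "\<phi> s \<odot>\<^bsub>?V\<^esub> x = (\<phi> s \<odot>\<^bsub>?V\<^esub> x \<ominus>\<^bsub>?V\<^esub> ?A (?H x)) \<oplus>\<^bsub>?V\<^esub> ?A (?H x)"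
      using x(1) c u by (simp add: a_minus_def V.M.a_assoc V.M.l_neg K.Units_closed)
    also have "\<dots> = ?A (?H x)" using x(2) c by simp
    finally have "\<phi> s \<odot>\<^bsub>?V\<^esub> x = ?A (?H x)" .
    then have "x = inv\<^bsub>K\<^esub> (\<phi> s) \<odot>\<^bsub>?V\<^esub> ?A (?H x)" using smult_unit_cancel[OF V.module_axioms u x(1)] by simp
    also have "\<dots> = ?A (inv\<^bsub>K\<^esub> (\<phi> s) \<odot>\<^bsub>?W\<^esub> ?H x)" using u c by (simp add: module_hom_smult[OF hom[OF A]])
    finally show "x \<in> ?A ` carrier ?W" using u c by (metis K.Units_inv_closed W.smult_closed image_eqI)
  next
    fix x assume "x \<in> ?A ` carrier ?W"
    then obtain y where y: "y \<in> carrier ?W" "x = ?A y" by blast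
    have "?f (?A y) = mat_change R K \<phi> n l (\<lambda>x. f (A x)) y"
      by (rule mat_change_comp[OF R Kc K(2) A f y(1), symmetric])
    also have "\<dots> = \<zero>\<^bsub>?V\<^esub>"
    proof (rule mat_change_eqI[OF R Kc K(2) module_hom_comp[OF A f] module_hom_zero_map[OF W.module_axioms V.module_axioms] _ y(1)])
      fix j
      have "A (std_basis R n j) \<in> carrier ?F" by (rule module_hom_in[OF A std_basis_in[OF R]])
      then have "f (A (std_basis R n j)) = \<zero>\<^bsub>?F\<^esub>"
        unfolding f_def AHA[OF std_basis_in[OF R]] using s by (simp add: a_minus_def F.M.r_neg)
      then show "\<zero>\<^bsub>?V\<^esub> = map_vec \<phi> l (f (A (std_basis R n j)))"
        using semilinear_zero[OF F.module_axioms V.module_axioms sl] by simp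
    qed
    finally show "x \<in> {x \<in> carrier ?V. ?f x = \<zero>\<^bsub>?V\<^esub>}" using y module_hom_in[OF hom[OF A]] by simp
  qed
  then show "rank_at R K \<phi> n l A + rank_at R K \<phi> l l f = l"
    using vdim_rank_nullity[OF K(1) V.module_axioms V.module_axioms hom[OF f] std_free_basis(1)[OF K(1)]]
    by (simp add: rank_at_def std_free_basis(2)[OF K(1)])
qed

lemma rank_at_constant:
  fixes R :: "'a ring" and K :: "'k ring" and K' :: "'k2 ring"
  assumes R: "cring R" and K: "field K" "\<phi> \<in> Ring.ring_hom R K" and K': "field K'" "\<psi> \<in> Ring.ring_hom R K'"
    and ker: "\<And>a. a \<in> carrier R \<Longrightarrow> \<phi> a = \<zero>\<^bsub>K\<^esub> \<Longrightarrow> \<psi> a = \<zero>\<^bsub>K'\<^esub>"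
    and A: "A \<in> module_hom R (std_free R n) (std_free R l)" and H: "H \<in> module_hom R (std_free R l) (std_free R n)"
    and s: "s \<in> carrier R" "\<psi> s \<noteq> \<zero>\<^bsub>K'\<^esub>"
    and AHA: "\<And>x. x \<in> carrier (std_free R n) \<Longrightarrow> A (H (A x)) = s \<odot>\<^bsub>std_free R l\<^esub> A x"
  shows "rank_at R K \<phi> n l A = rank_at R K' \<psi> n l A"
proof -
  have "\<phi> s \<noteq> \<zero>\<^bsub>K\<^esub>" using ker[OF s(1)] s(2) by blast
  note f = rank_at_complement(1)[OF R K A H s(1) this AHA] and sum = rank_at_complement(2)[OF R K A H s(1) this AHA]
  note sum' = rank_at_complement(2)[OF R K' A H s AHA]
  show ?thesis
    using sum sum' rank_at_mono[OF R K K' ker A] rank_at_mono[OF R K K' ker f] by linarith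
qed

text \<open>Two denominators are cleared. A first s makes the finitely many columns of s h come from
  \<open>R\<close> and gives \<open>H\<close>. Then A H A and s A agree only after localization, and
  a further u kills their difference on every basis vector. So u H satisfies the identity over
  \<open>R\<close> with constant us in \<open>S\<close>.\<close>

lemma descend_generalized_inverse:
  fixes R :: "'a ring" (structure) and L :: "'k ring"
  assumes S: "mult_set R S" and L: "cring L" "is_localization R S L \<phi>"
    and A: "A \<in> module_hom R (std_free R n) (std_free R l)"
    and h: "h \<in> module_hom L (std_free L l) (std_free L n)"
    and inv: "\<And>y. y \<in> carrier (std_free L n) \<Longrightarrow>
      mat_change R L \<phi> n l A (h (mat_change R L \<phi> n l A y)) = mat_change R L \<phi> n l A y"
  shows "\<exists>s\<in>S. \<exists>H\<in>module_hom R (std_free R l) (std_free R n).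
    \<forall>x\<in>carrier (std_free R n). A (H (A x)) = s \<odot>\<^bsub>std_free R l\<^esub> A x"
proof -
  interpret mult_set R S by fact
  have R: "cring R" ..
  have \<phi>: "\<phi> \<in> Ring.ring_hom R L" using L(2) by (simp add: is_localization_def)
  let ?A = "mat_change R L \<phi> n l A"
  note F = std_free_is_module[OF R] and G = std_free_is_module[OF L(1)]
  note locv = is_module_localization_map_vec[OF S L] and sl = semilinear_map_vec[OF R L(1) \<phi>]
  interpret Fl: module R "std_free R l" by (rule F)
  interpret Fn: module R "std_free R n" by (rule F)
  interpret Gl: module L "std_free L l" by (rule G)
  interpret Gn: module L "std_free L n" by (rule G)
  have A': "?A \<in> module_hom L (std_free L n) (std_free L l)" by (rule mat_change_hom[OF R L(1) \<phi> A])
  obtain s where s: "s \<in> S" "\<forall>j<l. \<exists>x\<in>carrier (std_free R n). \<phi> s \<odot>\<^bsub>std_free L n\<^esub> h (std_basis L l j) = map_vec \<phi> n x"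
    using localization_common_denominator[OF S \<phi> F G locv, of l "\<lambda>j. h (std_basis L l j)"]
      module_hom_in[OF h std_basis_in[OF L(1)]] by blast
  then obtain y where y: "\<And>j. j < l \<Longrightarrow> y j \<in> carrier (std_free R n) \<and> \<phi> s \<odot>\<^bsub>std_free L n\<^esub> h (std_basis L l j) = map_vec \<phi> n (y j)"
    by metis
  have sR: "s \<in> carrier R" and sL: "\<phi> s \<in> carrier L" using s(1) S_in ring_hom_closed[OF \<phi>] by auto
  define H where "H = lin_ext R (std_free R n) {..<l} y"
  have H: "H \<in> module_hom R (std_free R l) (std_free R n)"
    unfolding H_def std_free_def[of _ l] using y by (intro lin_ext_hom[OF F]) auto
  have Hj: "H (std_basis R l j) = y j" if "j < l" for j
    unfolding H_def std_basis_eq_free_unit using y that by (intro lin_ext_free_unit[OF F]) auto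
  have Hvec: "map_vec \<phi> n (H x) = \<phi> s \<odot>\<^bsub>std_free L n\<^esub> h (map_vec \<phi> l x)" if x: "x \<in> carrier (std_free R l)" for x
    unfolding mat_change_map_vec[OF R L(1) \<phi> H x, symmetric]
    using y Hj by (intro mat_change_eqI[OF R L(1) \<phi> H module_hom_smult_map[OF G G h sL] _ semilinear_in[OF sl x]]) simp
  \<comment> \<open>The error of \<open>H\<close> over \<open>R\<close>. It vanishes in the
    localization and is therefore \<open>S\<close>-torsion.\<close>
  define w where "w x = A (H (A x)) \<ominus>\<^bsub>std_free R l\<^esub> s \<odot>\<^bsub>std_free R l\<^esub> A x" for x
  have AHA: "(\<lambda>x. A (H (A x))) \<in> module_hom R (std_free R n) (std_free R l)"
    by (rule module_hom_comp[OF module_hom_comp[OF A H] A])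
  have sA: "(\<lambda>x. s \<odot>\<^bsub>std_free R l\<^esub> A x) \<in> module_hom R (std_free R n) (std_free R l)"
    by (rule module_hom_smult_map[OF F F A sR])
  have "\<exists>u\<in>S. \<forall>j<n. u \<odot>\<^bsub>std_free R l\<^esub> w (std_basis R n j) = \<zero>\<^bsub>std_free R l\<^esub>"
  proof (rule common_annihilator[OF S F], intro conjI)
    fix j
    let ?b = "std_basis R n j" and ?c = "std_basis L n j"
    have b: "?b \<in> carrier (std_free R n)" "?c \<in> carrier (std_free L n)" using std_basis_in R L(1) by auto
    have c: "A ?b \<in> carrier (std_free R l)" "A (H (A ?b)) \<in> carrier (std_free R l)" "H (A ?b) \<in> carrier (std_free R n)"
      using module_hom_in[OF A] module_hom_in[OF H] b by auto
    show wc: "w ?b \<in> carrier (std_free R l)" using c sR by (simp add: w_def)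
    have Ab: "map_vec \<phi> l (A ?b) = ?A ?c"
      using mat_change_map_vec[OF R L(1) \<phi> A b(1)] by (simp add: map_vec_std_basis[OF R L(1) \<phi>])
    have Ac: "?A ?c \<in> carrier (std_free L l)" using module_hom_in[OF A' b(2)] .
    have "map_vec \<phi> l (A (H (A ?b))) = ?A (\<phi> s \<odot>\<^bsub>std_free L n\<^esub> h (?A ?c))"
      by (simp add: mat_change_map_vec[OF R L(1) \<phi> A c(3), symmetric] Hvec[OF c(1)] Ab)
    also have "\<dots> = \<phi> s \<odot>\<^bsub>std_free L l\<^esub> ?A (h (?A ?c))"
      by (rule module_hom_smult[OF A' sL module_hom_in[OF h Ac]])
    also have "\<dots> = map_vec \<phi> l (s \<odot>\<^bsub>std_free R l\<^esub> A ?b)"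
      using sl[of l] sR c(1) by (simp add: inv[OF b(2)] semilinear_def Ab)
    finally have eq: "map_vec \<phi> l (A (H (A ?b))) = map_vec \<phi> l (s \<odot>\<^bsub>std_free R l\<^esub> A ?b)" .
    have "w ?b \<oplus>\<^bsub>std_free R l\<^esub> s \<odot>\<^bsub>std_free R l\<^esub> A ?b = A (H (A ?b))"
      unfolding w_def using c sR by (simp add: a_minus_def Fl.M.a_assoc Fl.M.l_neg)
    then have "map_vec \<phi> l (w ?b) \<oplus>\<^bsub>std_free L l\<^esub> map_vec \<phi> l (s \<odot>\<^bsub>std_free R l\<^esub> A ?b) = map_vec \<phi> l (A (H (A ?b)))"
      using sl[of l] wc c sR Fl.smult_closed unfolding semilinear_def by metis
    then have "map_vec \<phi> l (w ?b) = \<zero>\<^bsub>std_free L l\<^esub>"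
      unfolding eq using semilinear_in[OF sl wc] semilinear_in[OF sl Fl.smult_closed[OF sR c(1)]]
      by (simp add: Gl.M.add.r_cancel_one)
    then show "\<exists>u\<in>S. u \<odot>\<^bsub>std_free R l\<^esub> w ?b = \<zero>\<^bsub>std_free R l\<^esub>"
      using locv[of l] wc by (simp add: is_module_localization_def)
  qed
  then obtain u where u: "u \<in> S" "\<And>j. j < n \<Longrightarrow> u \<odot>\<^bsub>std_free R l\<^esub> w (std_basis R n j) = \<zero>\<^bsub>std_free R l\<^esub>" by blast
  have uR: "u \<in> carrier R" using u(1) S_in by auto
  have uH: "(\<lambda>x. u \<odot>\<^bsub>std_free R n\<^esub> H x) \<in> module_hom R (std_free R l) (std_free R n)"
    by (rule module_hom_smult_map[OF F F H uR])
  have wh: "w \<in> module_hom R (std_free R n) (std_free R l)"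
    unfolding w_def[abs_def] by (rule module_hom_diff[OF F F AHA sA])
  have uw: "u \<odot>\<^bsub>std_free R l\<^esub> w x = \<zero>\<^bsub>std_free R l\<^esub>" if x: "x \<in> carrier (std_free R n)" for x
    using u(2) by (intro std_hom_eqI[OF F module_hom_smult_map[OF F F wh uR] module_hom_zero_map[OF F F] _ x])
  have "A (u \<odot>\<^bsub>std_free R n\<^esub> H (A x)) = (u \<otimes> s) \<odot>\<^bsub>std_free R l\<^esub> A x" if x: "x \<in> carrier (std_free R n)" for x
  proof -
    have c: "A x \<in> carrier (std_free R l)" "A (H (A x)) \<in> carrier (std_free R l)" "H (A x) \<in> carrier (std_free R n)"
      using module_hom_in[OF A] module_hom_in[OF H] x by auto
    have "A (H (A x)) = w x \<oplus>\<^bsub>std_free R l\<^esub> s \<odot>\<^bsub>std_free R l\<^esub> A x"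
      unfolding w_def using c sR by (simp add: a_minus_def Fl.M.a_assoc Fl.M.l_neg)
    then have "u \<odot>\<^bsub>std_free R l\<^esub> A (H (A x)) = u \<odot>\<^bsub>std_free R l\<^esub> (s \<odot>\<^bsub>std_free R l\<^esub> A x)"
      using c sR uR module_hom_in[OF wh x] by (simp add: Fl.smult_r_distr uw[OF x])
    then show ?thesis using c sR uR by (simp add: module_hom_smult[OF A] Fl.smult_assoc1)
  qed
  then show ?thesis by (intro bexI[OF _ S_mult[OF u(1) s(1)]] bexI[OF _ uH] ballI)
qed

section \<open>Projective dimension\<close>

text \<open>The complement is spanned by the unit vectors at the rows that \<open>f\<close> leaves
  out, and \<iota> embeds it by filling the rows of \<open>f\<close> with zeros. An image vector
  vanishing at \<open>f\<close> is zero, and any vector can be made to vanish at \<open>f\<close> by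
  subtracting an image vector: together, a direct sum decomposition.\<close>

lemma complement_of_minor:
  fixes R :: "'a ring" (structure)
  assumes R: "cring R" and T: "T \<in> module_hom R (std_free R n) (std_free R l)"
    and f: "selection m l f" and g: "selection m n g"
    and unit: "minor R n T m f g \<in> Units R"
    and bordered: "\<forall>i<l. \<forall>j<n.
      minor R n T (Suc m) (\<lambda>a. if a < m then f a else i) (\<lambda>b. if b < m then g b else j) = \<zero>"
  shows "\<exists>t. \<exists>\<iota>\<in>module_hom R (std_free R t) (std_free R l).
    (\<forall>x\<in>carrier (std_free R t). \<iota> x \<in> T ` carrier (std_free R n) \<longrightarrow> x = \<zero>\<^bsub>std_free R t\<^esub>) \<and>
    (\<forall>y\<in>carrier (std_free R l). \<exists>w\<in>T ` carrier (std_free R n). \<exists>z\<in>carrier (std_free R t).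
       y = w \<oplus>\<^bsub>std_free R l\<^esub> \<iota> z)"
proof -
  interpret cring R by fact
  note ops = std_free_ops[OF R]
  have f': "f \<in> {..<m} \<rightarrow> {..<l}" and g': "g \<in> {..<m} \<rightarrow> {..<n}" using f g by (auto simp: selection_def)
  note split = split_by_minor[OF R T f' g' unit bordered]
  let ?C = "lin_ext R (std_free R l) {..<m} (\<lambda>t. T (std_basis R n (g t)))"
  let ?J = "{..<l} - f ` {..<m}"
  obtain c where c: "bij_betw c {..<card ?J} ?J"
    using ex_bij_betw_nat_finite[of ?J] by (auto simp: atLeast0LessThan)
  let ?t = "card ?J" and ?d = "inv_into {..<card ?J} c"
  have cJ: "c i \<in> ?J" if "i < ?t" for i using c that by (auto simp: bij_betw_def)
  have dt: "?d k < ?t" if "k \<in> ?J" for k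
    using inv_into_into[of k c "{..<?t}"] c that by (simp add: bij_betw_def)
  have cd: "c (?d k) = k" if "k \<in> ?J" for k using c that by (simp add: bij_betw_def f_inv_into_f)
  have dc: "?d (c i) = i" if "i < ?t" for i using c that by (simp add: bij_betw_def)
  define \<iota> where "\<iota> x = (\<lambda>k\<in>{..<l}. if k \<in> ?J then x (?d k) else \<zero>)" for x
  have io: "\<iota> \<in> module_hom R (std_free R ?t) (std_free R l)"
  proof (rule module_homI)
    fix x assume x: "x \<in> carrier (std_free R ?t)"
    then have xi: "x i \<in> carrier R" if "i < ?t" for i using that by (auto simp: carrier_std_free)
    show "\<iota> x \<in> carrier (std_free R l)" using xi dt by (auto simp: carrier_std_free \<iota>_def)
    show "\<iota> (x \<oplus>\<^bsub>std_free R ?t\<^esub> y) = \<iota> x \<oplus>\<^bsub>std_free R l\<^esub> \<iota> y" if "y \<in> carrier (std_free R ?t)" for y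
      using dt by (auto simp: \<iota>_def ops fun_eq_iff)
    show "\<iota> (r \<odot>\<^bsub>std_free R ?t\<^esub> x) = r \<odot>\<^bsub>std_free R l\<^esub> \<iota> x" if "r \<in> carrier R" for r
      using dt that by (auto simp: \<iota>_def ops fun_eq_iff)
  qed
  have iof: "\<iota> x (f a) = \<zero>" if "a < m" for x a
    using that f' by (auto simp: \<iota>_def)
  have inj: "x = \<zero>\<^bsub>std_free R ?t\<^esub>" if x: "x \<in> carrier (std_free R ?t)" "\<iota> x \<in> T ` carrier (std_free R n)" for x
  proof -
    obtain z where z: "z \<in> carrier (std_free R m)" "\<iota> x = ?C z" using x(2) split(2) by auto
    have "z = \<zero>\<^bsub>std_free R m\<^esub>" by (rule split(4)[OF z(1)]) (simp add: iof flip: z(2))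
    then have 0: "\<iota> x = \<zero>\<^bsub>std_free R l\<^esub>"
      using z(2) module_hom_zero[OF std_free_is_module[OF R] std_free_is_module[OF R] split(1)] by simp
    have "x i = \<zero>" if i: "i < ?t" for i
    proof -
      have "\<iota> x (c i) = x i" using cJ[OF i] dc[OF i] by (simp add: \<iota>_def)
      then show ?thesis using cJ[OF i] unfolding 0 by (simp add: ops)
    qed
    then show ?thesis using x(1) by (auto simp: ops carrier_std_free fun_eq_iff PiE_def extensional_def)
  qed
  have gen: "\<exists>w\<in>T ` carrier (std_free R n). \<exists>z\<in>carrier (std_free R ?t). y = w \<oplus>\<^bsub>std_free R l\<^esub> \<iota> z"
    if y: "y \<in> carrier (std_free R l)" for y
  proof -
    obtain x where x: "x \<in> carrier (std_free R m)" "\<forall>a<m. ?C x (f a) = y (f a)" using split(3)[OF y] by blast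
    have Cx: "?C x \<in> carrier (std_free R l)" by (rule module_hom_in[OF split(1) x(1)])
    \<comment> \<open>The image vector \<open>?C x\<close> already matches \<open>y\<close> at the
      rows of \<open>f\<close>; \<open>?z\<close> records the difference at the others.\<close>
    let ?z = "\<lambda>i\<in>{..<?t}. y (c i) \<ominus> ?C x (c i)"
    have yk: "y k \<in> carrier R" "?C x k \<in> carrier R" if "k < l" for k using that y Cx by (auto simp: carrier_std_free)
    have z: "?z \<in> carrier (std_free R ?t)" using yk cJ by (auto simp: carrier_std_free)
    have "y k = (?C x \<oplus>\<^bsub>std_free R l\<^esub> \<iota> ?z) k" if k: "k < l" for k
    proof (cases "k \<in> ?J")
      case True
      have "?C x k \<oplus> (y k \<ominus> ?C x k) = y k" using yk[OF k] by (simp add: a_minus_def a_ac r_neg)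
      then show ?thesis using k True dt[OF True] cd[OF True] by (simp add: ops \<iota>_def)
    next
      case False
      then obtain a where "a < m" "k = f a" using k by auto
      then show ?thesis using k x(2) yk[OF k] iof[of a] by (simp add: ops)
    qed
    then have "y = ?C x \<oplus>\<^bsub>std_free R l\<^esub> \<iota> ?z"
      using y by (auto simp: ops carrier_std_free fun_eq_iff PiE_def extensional_def)
    moreover have "?C x \<in> T ` carrier (std_free R n)" using split(2) x(1) by blast
    ultimately show ?thesis using z by blast
  qed
  show ?thesis using io inj gen by blast
qed

lemma std_free_projective: "cring R \<Longrightarrow> \<one>\<^bsub>R\<^esub> \<noteq> \<zero>\<^bsub>R\<^esub> \<Longrightarrow> projective_module R (std_free R n)"
  unfolding std_free_def by (rule free_module_projective)

lemma carrier_std_free_0: "cring R \<Longrightarrow> carrier (std_free R 0) = {\<zero>\<^bsub>std_free R 0\<^esub>}"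
  by (auto simp: carrier_std_free std_free_ops)

text \<open>If the kernel \<open>B\<close> of \<open>p\<close> has the complement \<iota>(C), then
  \<open>p\<close> restricted to the complement is injective and keeps its image. The map
  \<open>p\<close> is a differential or, in degree zero, the augmentation, hence the general target
  \<open>W\<close>.\<close>

lemma complement_image_kernel:
  fixes R :: "'a ring" and W :: "('a, 'w) module" and G :: "('a, 'g) module" and C :: "('a, 'c) module"
  assumes G: "module R G" and C: "module R C" and W: "module R W"
    and io: "\<iota> \<in> module_hom R C G" and p: "p \<in> module_hom R G W"
    and ker: "B = {x \<in> carrier G. p x = \<zero>\<^bsub>W\<^esub>}"
    and inj: "\<And>x. x \<in> carrier C \<Longrightarrow> \<iota> x \<in> B \<Longrightarrow> x = \<zero>\<^bsub>C\<^esub>"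
    and gen: "\<And>y. y \<in> carrier G \<Longrightarrow> \<exists>w\<in>B. \<exists>z\<in>carrier C. y = w \<oplus>\<^bsub>G\<^esub> \<iota> z"
  shows "(\<lambda>x. p (\<iota> x)) ` carrier C = p ` carrier G"
    and "{x \<in> carrier C. p (\<iota> x) = \<zero>\<^bsub>W\<^esub>} = {\<zero>\<^bsub>C\<^esub>}"
proof -
  interpret W: module R W by fact
  interpret C: module R C by fact
  show "(\<lambda>x. p (\<iota> x)) ` carrier C = p ` carrier G"
  proof (intro equalityI subsetI)
    fix v assume "v \<in> p ` carrier G"
    then obtain y where y: "y \<in> carrier G" "v = p y" by blast
    obtain w z where wz: "w \<in> B" "z \<in> carrier C" "y = w \<oplus>\<^bsub>G\<^esub> \<iota> z" using gen[OF y(1)] by blast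
    have "p y = p (\<iota> z)"
      unfolding wz(3) using wz(1,2) module_hom_in[OF io] module_hom_in[OF p]
      by (simp add: ker module_hom_add[OF p])
    then show "v \<in> (\<lambda>x. p (\<iota> x)) ` carrier C" using y(2) wz(2) by blast
  qed (use module_hom_in[OF io] in auto)
  show "{x \<in> carrier C. p (\<iota> x) = \<zero>\<^bsub>W\<^esub>} = {\<zero>\<^bsub>C\<^esub>}"
  proof (intro equalityI subsetI)
    fix x assume "x \<in> {x \<in> carrier C. p (\<iota> x) = \<zero>\<^bsub>W\<^esub>}"
    then show "x \<in> {\<zero>\<^bsub>C\<^esub>}" using inj[of x] module_hom_in[OF io, of x] by (simp add: ker)
  next
    fix x assume "x \<in> {\<zero>\<^bsub>C\<^esub>}"
    then show "x \<in> {x \<in> carrier C. p (\<iota> x) = \<zero>\<^bsub>W\<^esub>}"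
      using module_hom_zero[OF C W module_hom_comp[OF io p]] by simp
  qed
qed

text \<open>In degree \<open>n\<close> the free module is replaced by a free complement of the
  boundaries, and everything above is dropped. Boundaries are the kernel of the preceding map, so
  exactness below degree \<open>n\<close> is preserved and the last map becomes injective.\<close>

lemma truncate_resolution:
  fixes R :: "'a ring" and N :: "('a, 'b) module"
  assumes R: "cring R" "\<one>\<^bsub>R\<^esub> \<noteq> \<zero>\<^bsub>R\<^esub>" and N: "module R N"
    and res: "projective_resolution R N (\<lambda>i. std_free R (r i)) D e"
    and io: "\<iota> \<in> module_hom R (std_free R t) (std_free R (r n))"
    and inj: "\<And>x. x \<in> carrier (std_free R t) \<Longrightarrow> \<iota> x \<in> D n ` carrier (std_free R (r (Suc n))) \<Longrightarrow> x = \<zero>\<^bsub>std_free R t\<^esub>"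
    and gen: "\<And>y. y \<in> carrier (std_free R (r n)) \<Longrightarrow>
      \<exists>w\<in>D n ` carrier (std_free R (r (Suc n))). \<exists>z\<in>carrier (std_free R t). y = w \<oplus>\<^bsub>std_free R (r n)\<^esub> \<iota> z"
  shows "\<exists>r' d \<epsilon>. projective_resolution R N (\<lambda>i. std_free R (r' i)) d \<epsilon> \<and> (\<forall>i>n. r' i = 0)"
proof -
  let ?F = "std_free R"
  note DF = projective_resolutionD[OF res]
  note F = std_free_is_module[OF R(1)]
  define r' where "r' i = (if i < n then r i else if i = n then t else 0)" for i
  \<comment> \<open>\<open>j i\<close> compares the new module in degree \<open>i\<close> with the
    old one: the identity below \<open>n\<close>, the embedding \<iota> at \<open>n\<close>, zero
    above. A differential that lands below \<open>n\<close> needs no projection, since old and new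
    modules coincide there.\<close>
  define j where "j i = (if i < n then (\<lambda>x. x) else if i = n then \<iota> else (\<lambda>_. \<zero>\<^bsub>?F (r i)\<^esub>))" for i
  define d where "d i = (if i < n then (\<lambda>x. D i (j (Suc i) x)) else (\<lambda>_. \<zero>\<^bsub>?F (r' i)\<^esub>))" for i
  have j: "j i \<in> module_hom R (?F (r' i)) (?F (r i))" for i
  proof (cases i n rule: linorder_cases)
    case less
    then show ?thesis by (simp add: j_def r'_def module_hom_id)
  next
    case equal
    then show ?thesis using io by (simp add: j_def r'_def)
  next
    case greater
    then have "j i = (\<lambda>_. \<zero>\<^bsub>?F (r i)\<^esub>)" by (simp add: j_def)
    then show ?thesis by (simp only:) (rule module_hom_zero_map[OF F F])
  qed
  have d: "d i \<in> module_hom R (?F (r' (Suc i))) (?F (r' i))" for i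
  proof (cases "i < n")
    case True
    have "(\<lambda>x. D i (j (Suc i) x)) \<in> module_hom R (?F (r' (Suc i))) (?F (r i))"
      by (rule module_hom_comp[OF j DF(3)])
    then show ?thesis using True by (simp add: d_def r'_def[of i])
  next
    case False
    then have "d i = (\<lambda>_. \<zero>\<^bsub>?F (r' i)\<^esub>)" by (simp add: d_def)
    then show ?thesis by (simp only:) (rule module_hom_zero_map[OF F F])
  qed
  have e: "(\<lambda>x. e (j 0 x)) \<in> module_hom R (?F (r' 0)) N" by (rule module_hom_comp[OF j DF(4)])
  have top: "?F (r' n) = ?F t" "j n = \<iota>" by (simp_all add: r'_def j_def)
  have low: "?F (r' i) = ?F (r i)" "j i = (\<lambda>x. x)" if "i < n" for i using that by (simp_all add: r'_def j_def)
  have high: "carrier (?F (r' i)) = {\<zero>\<^bsub>?F (r' i)\<^esub>}" if "n < i" for i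
    using that carrier_std_free_0[OF R(1)] by (simp add: r'_def)
  have dn: "d i ` carrier (?F (r' (Suc i))) = {\<zero>\<^bsub>?F (r' i)\<^esub>}" if "n \<le> i" for i
    using that high[of "Suc i"] by (simp add: d_def)
  note complement = complement_image_kernel[OF F F _ io _ _ inj gen]
  have im: "(\<lambda>x. D i (j (Suc i) x)) ` carrier (?F (r' (Suc i))) = D i ` carrier (?F (r (Suc i)))" if i: "i < n" for i
  proof (cases "Suc i = n")
    case True
    have "(\<lambda>x. D i (\<iota> x)) ` carrier (?F t) = D i ` carrier (?F (r n))"
      using DF(3)[of i] DF(7)[of i] True by (intro complement(1)[OF F]) auto
    then show ?thesis using True top by simp
  next
    case False
    then show ?thesis using i low[of "Suc i"] by simp
  qed
  have surj: "(\<lambda>x. e (j 0 x)) ` carrier (?F (r' 0)) = carrier N"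
  \<comment> \<open>For \<open>n = 0\<close> the module being split is the one in degree zero, and
    the augmentation takes the part of the preceding differential.\<close>
  proof (cases "n = 0")
    case True
    have "(\<lambda>x. e (\<iota> x)) ` carrier (?F t) = e ` carrier (?F (r n))"
      using DF(4,6) True by (intro complement(1)[OF N]) auto
    then show ?thesis using True top DF(5) by simp
  next
    case False
    then show ?thesis using low[of 0] DF(5) by simp
  qed
  have ex0: "d 0 ` carrier (?F (r' 1)) = {x \<in> carrier (?F (r' 0)). e (j 0 x) = \<zero>\<^bsub>N\<^esub>}"
  proof (cases "n = 0")
    case True
    have "{x \<in> carrier (?F t). e (\<iota> x) = \<zero>\<^bsub>N\<^esub>} = {\<zero>\<^bsub>?F t\<^esub>}"
      using DF(4,6) True by (intro complement(2)[OF N]) auto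
    then show ?thesis using True top dn[of 0] by simp
  next
    case False
    then have n: "0 < n" by simp
    have "d 0 = (\<lambda>x. D 0 (j (Suc 0) x))" using n by (simp add: d_def)
    then have "d 0 ` carrier (?F (r' 1)) = D 0 ` carrier (?F (r 1))" using im[OF n] by simp
    then show ?thesis using DF(6) low[OF n] by simp
  qed
  have ex: "d (Suc i) ` carrier (?F (r' (Suc (Suc i)))) = {x \<in> carrier (?F (r' (Suc i))). d i x = \<zero>\<^bsub>?F (r' i)\<^esub>}" for i
  proof (cases "Suc i" n rule: linorder_cases)
    case less
    have "d (Suc i) = (\<lambda>x. D (Suc i) (j (Suc (Suc i)) x))" "d i = D i" "?F (r' i) = ?F (r i)"
      using less low[of "Suc i"] low[of i] by (simp_all add: d_def)
    then show ?thesis using im[OF less] DF(7)[of i] low[OF less] by simp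
  next
    case equal
    have "{x \<in> carrier (?F t). D i (\<iota> x) = \<zero>\<^bsub>?F (r i)\<^esub>} = {\<zero>\<^bsub>?F t\<^esub>}"
      using DF(3)[of i] DF(7)[of i] equal by (intro complement(2)[OF F]) auto
    moreover have "d i = (\<lambda>x. D i (\<iota> x))" "?F (r' i) = ?F (r i)" using equal top low[of i] by (auto simp: d_def)
    ultimately show ?thesis using equal top dn[of "Suc i"] by simp
  next
    case greater
    then show ?thesis using dn[of "Suc i"] high[of "Suc i"] module_hom_zero[OF F F d, of i] by auto
  qed
  have "projective_resolution R N (\<lambda>i. ?F (r' i)) d (\<lambda>x. e (j 0 x))"
    unfolding projective_resolution_def exact_at_def
    using std_free_projective[OF R] d e surj ex0 ex by simp
  then show ?thesis using r'_def by (intro exI[of _ r'] exI[of _ d] exI[of _ "\<lambda>x. e (j 0 x)"]) auto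
qed

text \<open>\<open>proj_dim\<close> quantifies over resolutions in one fixed element type.
  Isomorphisms \<open>u i\<close> and \<open>v i\<close> in each degree carry a resolution found in
  another type over to it.\<close>

lemma projective_resolution_transport:
  fixes R :: "'a ring" and N :: "('a, 'b) module"
    and Q :: "nat \<Rightarrow> ('a, 'x) module" and P :: "nat \<Rightarrow> ('a, 'y) module"
  assumes res: "projective_resolution R N Q d \<epsilon>" and P: "\<And>i. projective_module R (P i)"
    and u: "\<And>i. u i \<in> module_hom R (Q i) (P i)" and v: "\<And>i. v i \<in> module_hom R (P i) (Q i)"
    and vu: "\<And>i x. x \<in> carrier (Q i) \<Longrightarrow> v i (u i x) = x" and uv: "\<And>i x. x \<in> carrier (P i) \<Longrightarrow> u i (v i x) = x"
  shows "projective_resolution R N P (\<lambda>i x. u i (d i (v (Suc i) x))) (\<lambda>x. \<epsilon> (v 0 x))"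
proof -
  note D = projective_resolutionD[OF res]
  have PM: "module R (P i)" for i using P by (simp add: projective_module_def)
  have vim: "v i ` carrier (P i) = carrier (Q i)" for i
    using module_hom_in[OF v] module_hom_in[OF u] vu by (metis image_eqI image_subsetI subsetI subset_antisym)
  have dv: "(\<lambda>x. u i (d i (v (Suc i) x))) ` carrier (P (Suc i)) = u i ` d i ` carrier (Q (Suc i))" for i
    unfolding vim[symmetric] by (simp add: image_image)
  have ker: "u i ` {x \<in> carrier (Q i). f x = z} = {x \<in> carrier (P i). f (v i x) = z}" for i f z
  proof (intro equalityI subsetI)
    fix x assume "x \<in> {x \<in> carrier (P i). f (v i x) = z}"
    then show "x \<in> u i ` {x \<in> carrier (Q i). f x = z}"
      using uv module_hom_in[OF v] by (intro image_eqI[of _ _ "v i x"]) auto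
  qed (use vu module_hom_in[OF u] in auto)
  have uz: "u i y = \<zero>\<^bsub>P i\<^esub> \<longleftrightarrow> y = \<zero>\<^bsub>Q i\<^esub>" if "y \<in> carrier (Q i)" for i y
    using module_hom_zero[OF D(2) PM u] module_hom_zero[OF PM D(2) v] vu[OF that] by metis
  show ?thesis
    unfolding projective_resolution_def exact_at_def
  proof (intro conjI allI)
    show "(\<lambda>x. u i (d i (v (Suc i) x))) \<in> module_hom R (P (Suc i)) (P i)" for i
      by (rule module_hom_comp[OF module_hom_comp[OF v D(3)] u])
    show "(\<lambda>x. \<epsilon> (v 0 x)) \<in> module_hom R (P 0) N" by (rule module_hom_comp[OF v D(4)])
    show "(\<lambda>x. \<epsilon> (v 0 x)) ` carrier (P 0) = carrier N"
      using D(5) vim[of 0] by (metis image_image)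
    show "(\<lambda>x. u 0 (d 0 (v (Suc 0) x))) ` carrier (P 1) = {x \<in> carrier (P 0). \<epsilon> (v 0 x) = \<zero>\<^bsub>N\<^esub>}"
      using dv[of 0] D(6) ker[of 0 \<epsilon>] by simp
    show "(\<lambda>x. u (Suc i) (d (Suc i) (v (Suc (Suc i)) x))) ` carrier (P (Suc (Suc i)))
        = {x \<in> carrier (P (Suc i)). u i (d i (v (Suc i) x)) = \<zero>\<^bsub>P i\<^esub>}" for i
    proof -
      have "u i (d i (v (Suc i) x)) = \<zero>\<^bsub>P i\<^esub> \<longleftrightarrow> d i (v (Suc i) x) = \<zero>\<^bsub>Q i\<^esub>" if "x \<in> carrier (P (Suc i))" for x
        using that module_hom_in[OF v] module_hom_in[OF D(3)] by (intro uz) blast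
      then show ?thesis using dv[of "Suc i"] D(7)[of i] ker[of "Suc i" "d i"] by auto
    qed
  qed (rule P)
qed

lemma proj_dim_le:
  fixes R :: "'a ring" and N :: "('a, 'b) module"
  assumes R: "cring R" "\<one>\<^bsub>R\<^esub> \<noteq> \<zero>\<^bsub>R\<^esub>"
    and res: "projective_resolution R N (\<lambda>i. std_free R (r i)) d \<epsilon>" and zero: "\<And>i. n < i \<Longrightarrow> r i = 0"
  shows "proj_dim R N \<le> enat n"
proof -
  \<comment> \<open>An injection of the naturals into the index type prescribed by
    \<open>proj_dim\<close>; the two undefined components are fixed padding.\<close>
  define k :: "nat \<Rightarrow> nat \<times> 'b \<times> 'a" where "k i = (i, undefined, undefined)" for i
  define P where "P i = free_module R (k ` {..<r i})" for i
  have b: "bij_betw k {..<m} (k ` {..<m})" for m by (auto simp: bij_betw_def inj_on_def k_def)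
  have b': "bij_betw fst (k ` {..<m}) {..<m}" for m
    by (rule bij_betwI[where g = k]) (auto simp: k_def)
  let ?u = "\<lambda>i v. \<lambda>x\<in>k ` {..<r i}. v (fst x)" and ?v = "\<lambda>i v. \<lambda>x\<in>{..<r i}. v (k x)"
  have "projective_resolution R N P (\<lambda>i x. ?u i (d i (?v (Suc i) x))) (\<lambda>x. \<epsilon> (?v 0 x))"
  proof (rule projective_resolution_transport[OF res])
    show "projective_module R (P i)" for i unfolding P_def by (rule free_module_projective[OF R])
    show "?u i \<in> module_hom R (std_free R (r i)) (P i)" for i
      unfolding P_def std_free_def by (rule reindex_hom[OF R(1) b'])
    show "?v i \<in> module_hom R (P i) (std_free R (r i))" for i
      unfolding P_def std_free_def by (rule reindex_hom[OF R(1) b])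
    show "?v i (?u i x) = x" if "x \<in> carrier (std_free R (r i))" for i x
      using that by (auto simp: carrier_std_free fun_eq_iff k_def PiE_def extensional_def)
    show "?u i (?v i x) = x" if "x \<in> carrier (P i)" for i x
      using that by (auto simp: P_def carrier_free_module_finite fun_eq_iff k_def PiE_def extensional_def)
  qed
  moreover have "carrier (P i) = {\<zero>\<^bsub>P i\<^esub>}" if "n < i" for i
    using zero[OF that] R(1) by (auto simp: P_def carrier_free_module_finite free_module_ops)
  ultimately show ?thesis
    unfolding proj_dim_def by (intro Inf_lower) blast
qed

lemma proj_dim_lessE:
  fixes R :: "'a ring" and N :: "('a, 'b) module"
  assumes "proj_dim R N < enat d"
  obtains P :: "nat \<Rightarrow> ('a, nat \<times> 'b \<times> 'a \<Rightarrow> 'a) module" and \<delta> \<epsilon>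
  where "projective_resolution R N P \<delta> \<epsilon>" "\<And>i. d \<le> i \<Longrightarrow> carrier (P i) = {\<zero>\<^bsub>P i\<^esub>}"
proof -
  obtain n and P :: "nat \<Rightarrow> ('a, nat \<times> 'b \<times> 'a \<Rightarrow> 'a) module" and \<delta> \<epsilon>
    where "n < d" "projective_resolution R N P \<delta> \<epsilon>" "\<forall>i>n. carrier (P i) = {\<zero>\<^bsub>P i\<^esub>}"
    using assms unfolding proj_dim_def Inf_less_iff by fastforce
  then show ?thesis by (intro that[of P \<delta> \<epsilon>]) auto
qed

section \<open>Localization of free resolutions\<close>

text \<open>Two index conventions meet: in \<open>finite_free_resolution\<close> the map \<delta> i
  leaves degree \<open>i\<close>, in \<open>projective_resolution\<close> the i-th map leaves degree
  i + 1. Hence the argument \<open>int (Suc i)\<close>. Exactness is exactness of localization,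
  square by square.\<close>

lemma base_change_resolution:
  fixes R :: "'a ring" and L :: "'k ring" and M :: "('a, 'b) module" and M' :: "('k, 'c) module"
  assumes S: "mult_set R S" and L: "cring L" "\<one>\<^bsub>L\<^esub> \<noteq> \<zero>\<^bsub>L\<^esub>" "is_localization R S L \<phi>"
    and M: "module R M" and M': "module L M'" and h: "is_module_localization R S \<phi> M M' h"
    and res: "finite_free_resolution R M r \<delta> \<epsilon>"
  shows "projective_resolution L M' (\<lambda>i. std_free L (r (int i)))
    (\<lambda>i. mat_change R L \<phi> (r (int (Suc i))) (r (int i)) (\<delta> (int (Suc i))))
    (base_change R L (r 0) M' h \<epsilon>)"
proof -
  have R: "cring R" using S by (simp add: mult_set_def)
  have \<phi>: "\<phi> \<in> Ring.ring_hom R L" using L(3) by (simp add: is_localization_def)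
  note F = std_free_is_module[OF R] and G = std_free_is_module[OF L(1)]
  note locv = is_module_localization_map_vec[OF S L(1,3)]
  have hom: "\<delta> (int (Suc i)) \<in> module_hom R (std_free R (r (int (Suc i)))) (std_free R (r (int i)))" for i
  proof -
    have "\<delta> (int (Suc i)) \<in> module_hom R (std_free R (r (int (Suc i)))) (std_free R (r (int (Suc i) - 1)))"
      using res unfolding finite_free_resolution_def by blast
    moreover have "int (Suc i) - 1 = int i" by simp
    ultimately show ?thesis by (simp only:)
  qed
  have e: "\<epsilon> \<in> module_hom R (std_free R (r 0)) M" "\<epsilon> ` carrier (std_free R (r 0)) = carrier M"
    and ex0: "exact_at (std_free R (r 1)) (\<delta> 1) (std_free R (r 0)) \<epsilon> M"
    using res by (simp_all add: finite_free_resolution_def)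
  have ex: "exact_at (std_free R (r (int (Suc (Suc i))))) (\<delta> (int (Suc (Suc i)))) (std_free R (r (int (Suc i))))
      (\<delta> (int (Suc i))) (std_free R (r (int i)))" for i
  proof -
    have "exact_at (std_free R (r (int (Suc i) + 1))) (\<delta> (int (Suc i) + 1)) (std_free R (r (int (Suc i))))
        (\<delta> (int (Suc i))) (std_free R (r (int (Suc i) - 1)))"
    proof -
      have "\<forall>i\<ge>1. exact_at (std_free R (r (i + 1))) (\<delta> (i + 1)) (std_free R (r i)) (\<delta> i) (std_free R (r (i - 1)))"
        using res unfolding finite_free_resolution_def by blast
      then show ?thesis by (elim allE[of _ "int (Suc i)"] impE) simp_all
    qed
    moreover have "int (Suc i) - 1 = int i" "int (Suc i) + 1 = int (Suc (Suc i))" by simp_all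
    ultimately show ?thesis by (simp only:)
  qed
  have sl: "semilinear \<phi> R M M' h" using h by (simp add: is_module_localization_def)
  have e': "base_change R L (r 0) M' h \<epsilon> \<in> module_hom L (std_free L (r 0)) M'"
    by (rule base_change_hom[OF R M M' sl e(1)])
  have ce: "base_change R L (r 0) M' h \<epsilon> (map_vec \<phi> (r 0) x) = h (\<epsilon> x)" if "x \<in> carrier (std_free R (r 0))" for x
    by (rule base_change_map_vec[OF R L(1) \<phi> M M' sl e(1) that])
  note hom' = mat_change_hom[OF R L(1) \<phi> hom] and chom = mat_change_map_vec[OF R L(1) \<phi> hom]
  have 1: "\<delta> 1 \<in> module_hom R (std_free R (r 1)) (std_free R (r 0))" using hom[of 0] by simp
  show ?thesis
    unfolding projective_resolution_def
  proof (intro conjI allI)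
    show "projective_module L (std_free L (r (int i)))" for i by (rule std_free_projective[OF L(1,2)])
    show "mat_change R L \<phi> (r (int (Suc i))) (r (int i)) (\<delta> (int (Suc i)))
        \<in> module_hom L (std_free L (r (int (Suc i)))) (std_free L (r (int i)))" for i
      by (rule hom')
    show "base_change R L (r 0) M' h \<epsilon> \<in> module_hom L (std_free L (r (int 0))) M'" using e' by simp
    show "base_change R L (r 0) M' h \<epsilon> ` carrier (std_free L (r (int 0))) = carrier M'"
    proof -
      have "base_change R L (r 0) M' h \<epsilon> ` carrier (std_free L (r 0)) = carrier M'"
        by (rule localization_surj[OF L(3) G M' locv h e' _ e(2)]) (rule ce)
      then show ?thesis by simp
    qed
    have "exact_at (std_free L (r 1)) (mat_change R L \<phi> (r 1) (r 0) (\<delta> 1)) (std_free L (r 0)) (base_change R L (r 0) M' h \<epsilon>) M'"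
      by (rule localization_exact[OF S L(3) F M G G M' locv locv h e(1) mat_change_hom[OF R L(1) \<phi> 1] e' _ _ ex0])
        (rule mat_change_map_vec[OF R L(1) \<phi> 1], assumption, rule ce)
    then show "exact_at (std_free L (r (int 1))) (mat_change R L \<phi> (r (int (Suc 0))) (r (int 0)) (\<delta> (int (Suc 0))))
        (std_free L (r (int 0))) (base_change R L (r 0) M' h \<epsilon>) M'" by simp
    show "exact_at (std_free L (r (int (Suc (Suc i)))))
        (mat_change R L \<phi> (r (int (Suc (Suc i)))) (r (int (Suc i))) (\<delta> (int (Suc (Suc i)))))
        (std_free L (r (int (Suc i)))) (mat_change R L \<phi> (r (int (Suc i))) (r (int i)) (\<delta> (int (Suc i))))
        (std_free L (r (int i)))" for i
      by (rule localization_exact[OF S L(3) F F G G G locv locv locv hom hom' hom' _ _ ex]) (rule chom, assumption)+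
  qed
qed

section \<open>Ranks of the differentials and the locus\<close>

text \<open>The alternating sums obey \<chi>(i + 2) = r(i + 1) - \<chi>(i + 1), the recursion that
  rank-nullity gives for the ranks of consecutive differentials of an exact complex.\<close>

lemma fitting_chi_Suc:
  "fitting_chi r (int (Suc 0)) = int (r 0)"
  "fitting_chi r (int (Suc (Suc i))) = int (r (int (Suc i))) - fitting_chi r (int (Suc i))"
proof -
  show "fitting_chi r (int (Suc 0)) = int (r 0)" by (simp add: fitting_chi_def)
  have set: "{0..int (Suc (Suc i)) - 1} = insert (int (Suc i)) {0..int (Suc i) - 1}" by auto
  have "(\<Sum>j\<in>{0..int (Suc i) - 1}. (- 1) ^ nat (int (Suc (Suc i)) - j - 1) * int (r j))
      = (\<Sum>j\<in>{0..int (Suc i) - 1}. - ((- 1) ^ nat (int (Suc i) - j - 1) * int (r j)))"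
  proof (rule sum.cong)
    fix j assume "j \<in> {0..int (Suc i) - 1}"
    then have "nat (int (Suc (Suc i)) - j - 1) = Suc (nat (int (Suc i) - j - 1))" by auto
    then show "(- 1) ^ nat (int (Suc (Suc i)) - j - 1) * int (r j) = - ((- 1) ^ nat (int (Suc i) - j - 1) * int (r j))"
      by simp
  qed simp
  then show "fitting_chi r (int (Suc (Suc i))) = int (r (int (Suc i))) - fitting_chi r (int (Suc i))"
    unfolding fitting_chi_def set by (subst sum.insert) (simp_all add: sum_negf)
qed

lemma minors_ideal_subset_iff:
  fixes R :: "'a ring"
  assumes p: "\<pp> \<in> Spec R" and T: "T \<in> module_hom R (std_free R n) (std_free R l)"
  shows "minors_ideal R n l T (int m) \<subseteq> \<pp> \<longleftrightarrow>
    (\<forall>f g. selection m l f \<longrightarrow> selection m n g \<longrightarrow> minor R n T m f g \<in> \<pp>)"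
proof -
  interpret P: primeideal \<pp> R using p by (simp add: Spec_def)
  have R: "cring R" by (rule P.is_cring)
  show ?thesis
  proof (cases "m = 0")
    \<comment> \<open>Size zero is special in \<open>minors_ideal\<close>, which then is the whole
      ring. The empty minor is one, so the description by minors stays correct.\<close>
    case True
    have one: "\<one>\<^bsub>R\<^esub> \<notin> \<pp>" using P.I_notcarr P.one_imp_carrier by auto
    have "minor R n T 0 id id = \<one>\<^bsub>R\<^esub>" by (simp add: minor_def ring_det_def permutes_empty)
    moreover have "selection 0 l id" "selection 0 n id" by (auto simp: selection_def strict_mono_on_def)
    ultimately have "\<not> (\<forall>f g. selection 0 l f \<longrightarrow> selection 0 n g \<longrightarrow> minor R n T 0 f g \<in> \<pp>)"
      using one by metis
    moreover have "\<not> minors_ideal R n l T (int 0) \<subseteq> \<pp>" using one by (auto simp: minors_ideal_def)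
    ultimately show ?thesis using True by blast
  next
    case False
    let ?G = "{minor R n T m f g | f g. selection m l f \<and> selection m n g}"
    have G: "?G \<subseteq> carrier R"
      using module_hom_in[OF T std_basis_in[OF R]]
      by (auto simp: minor_def selection_def carrier_std_free intro!: ring_det_closed[OF R])
    have "minors_ideal R n l T (int m) = genideal R ?G"
      using False by (simp add: minors_ideal_def minor_def selection_def conj_assoc)
    moreover have "genideal R ?G \<subseteq> \<pp> \<longleftrightarrow> ?G \<subseteq> \<pp>"
      using P.genideal_self[OF G] P.genideal_minimal[OF P.is_ideal, of ?G] by auto
    moreover have "?G \<subseteq> \<pp> \<longleftrightarrow> (\<forall>f g. selection m l f \<longrightarrow> selection m n g \<longrightarrow> minor R n T m f g \<in> \<pp>)"
      by blast
    ultimately show ?thesis by simp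
  qed
qed

section \<open>Ranks along a fixed resolution and the criterion at a prime\<close>

locale resolved_module =
  fixes R :: "'a ring" (structure) and M :: "('a, 'b) module" and k :: nat and r \<delta> \<epsilon>
  assumes R: "cring R" "noetherian_ring R" "reduced_ring R"
    and M: "module R M" and rank: "has_rank R M k"
    and res: "finite_free_resolution R M r \<delta> \<epsilon>"
begin

abbreviation diff_hom :: "nat \<Rightarrow> (nat \<Rightarrow> 'a) \<Rightarrow> nat \<Rightarrow> 'a" where "diff_hom i \<equiv> \<delta> (int (Suc i))"
abbreviation rk :: "nat \<Rightarrow> nat" where "rk i \<equiv> r (int i)"

lemma diff_hom: "diff_hom i \<in> module_hom R (std_free R (rk (Suc i))) (std_free R (rk i))"
proof -
  have "\<delta> (int (Suc i)) \<in> module_hom R (std_free R (r (int (Suc i)))) (std_free R (r (int (Suc i) - 1)))"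
    using res unfolding finite_free_resolution_def by blast
  moreover have "int (Suc i) - 1 = int i" by simp
  ultimately show ?thesis by (simp only:)
qed

lemma localized_resolution:
  assumes p: "\<pp> \<in> Spec R"
  defines "\<phi> \<equiv> \<lambda>a. ring_frac R (carrier R - \<pp>) a \<one>"
  shows "mult_set R (carrier R - \<pp>)" "cring (ring_at R \<pp>)" "\<one>\<^bsub>ring_at R \<pp>\<^esub> \<noteq> \<zero>\<^bsub>ring_at R \<pp>\<^esub>"
    "is_localization R (carrier R - \<pp>) (ring_at R \<pp>) \<phi>" "module (ring_at R \<pp>) (module_at R M \<pp>)"
    "projective_resolution (ring_at R \<pp>) (module_at R M \<pp>) (\<lambda>i. std_free (ring_at R \<pp>) (rk i))
      (\<lambda>i. mat_change R (ring_at R \<pp>) \<phi> (rk (Suc i)) (rk i) (diff_hom i))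
      (base_change R (ring_at R \<pp>) (r 0) (module_at R M \<pp>) (\<lambda>x. module_frac R M (carrier R - \<pp>) x \<one>) \<epsilon>)"
proof -
  interpret P: primeideal \<pp> R using p by (simp add: Spec_def)
  show S: "mult_set R (carrier R - \<pp>)" by (rule mult_set_prime_complement[OF p])
  then interpret S: mult_set R "carrier R - \<pp>" .
  show L: "cring (ring_at R \<pp>)" unfolding ring_at_def by (rule S.localize_ring_cring)
  have "\<not> (\<exists>u\<in>carrier R - \<pp>. u \<otimes> \<one> = \<zero>)" using P.zero_closed by auto
  then show one: "\<one>\<^bsub>ring_at R \<pp>\<^esub> \<noteq> \<zero>\<^bsub>ring_at R \<pp>\<^esub>"
    using loc_zero_iff[OF S P.one_closed] by (simp add: ring_at_def localize_ring_simps(5))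
  show loc: "is_localization R (carrier R - \<pp>) (ring_at R \<pp>) \<phi>"
    unfolding ring_at_def \<phi>_def by (rule S.is_localization_loc)
  show M': "module (ring_at R \<pp>) (module_at R M \<pp>)"
    unfolding ring_at_def module_at_def by (rule S.localize_module_is_module[OF M])
  have "is_module_localization R (carrier R - \<pp>) \<phi> M (module_at R M \<pp>) (\<lambda>x. module_frac R M (carrier R - \<pp>) x \<one>)"
    unfolding module_at_def \<phi>_def by (rule S.is_module_localization_loc[OF M])
  then show "projective_resolution (ring_at R \<pp>) (module_at R M \<pp>) (\<lambda>i. std_free (ring_at R \<pp>) (rk i))
      (\<lambda>i. mat_change R (ring_at R \<pp>) \<phi> (rk (Suc i)) (rk i) (diff_hom i))
      (base_change R (ring_at R \<pp>) (r 0) (module_at R M \<pp>) (\<lambda>x. module_frac R M (carrier R - \<pp>) x \<one>) \<epsilon>)"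
    by (rule base_change_resolution[OF S L one loc M M' _ res])
qed

text \<open>Over the field R_q the augmentation has rank \<open>k\<close>, so the first differential
  has rank r(0) - k, and each later rank is r(i + 1) minus the one before. This is the recursion of
  \<open>fitting_chi\<close> started with an error of k, whose sign alternates. The value does not
  depend on \<qq>.\<close>

lemma rank_at_minimal_prime:
  assumes q: "\<qq> \<in> minimal_primes R"
  shows "int (rank_at R (ring_at R \<qq>) (\<lambda>a. ring_frac R (carrier R - \<qq>) a \<one>) (rk (Suc i)) (rk i) (diff_hom i))
    = fitting_chi r (int (Suc i)) - (- 1) ^ i * int k"
proof -
  have qS: "\<qq> \<in> Spec R" using q by (simp add: minimal_primes_def)
  let ?K = "ring_at R \<qq>" and ?N = "module_at R M \<qq>"
  let ?\<phi> = "\<lambda>a. ring_frac R (carrier R - \<qq>) a \<one>"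
  let ?D = "\<lambda>i. mat_change R ?K ?\<phi> (rk (Suc i)) (rk i) (diff_hom i)"
  have K: "field ?K" by (rule field_ring_at_minimal_prime(1)[OF R q])
  note loc = localized_resolution[OF qS]
  note D = projective_resolutionD[OF loc(6)]
  note fd = std_free_basis[OF K]
  have k: "vectorspace.dim ?K ?N = k" using rank q by (simp add: has_rank_def)
  show ?thesis
  proof (induction i)
    case 0
    have "k + rank_at R ?K ?\<phi> (rk (Suc 0)) (rk 0) (diff_hom 0) = r 0"
      using vdim_rank_nullity[OF K D(2)[of 0] loc(5) D(4) fd(1)] D(5) D(6)
      by (simp add: vdim_carrier k fd(2) rank_at_def)
    then show ?case using fitting_chi_Suc(1)[of r] by simp
  next
    case (Suc i)
    have "rank_at R ?K ?\<phi> (rk (Suc i)) (rk i) (diff_hom i)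
        + rank_at R ?K ?\<phi> (rk (Suc (Suc i))) (rk (Suc i)) (diff_hom (Suc i)) = rk (Suc i)"
      unfolding rank_at_def D(7)[of i]
      using vdim_rank_nullity[OF K D(2)[of "Suc i"] D(2)[of i] D(3)[of i] fd(1)] by (simp only: fd(2))
    then show ?case using Suc.IH fitting_chi_Suc(2)[of r i] by simp
  qed
qed

text \<open>The criterion is phrased for the complement of the locus, since a bound on the
  projective dimension is what a resolution witnesses. Here \<open>n\<close> stands for d -
  1.\<close>

lemma proj_dim_less_iff:
  assumes p: "\<pp> \<in> Spec R"
  shows "proj_dim (ring_at R \<pp>) (module_at R M \<pp>) < enat (Suc n) \<longleftrightarrow>
    \<not> minors_ideal R (rk (Suc n)) (rk n) (diff_hom n) (fitting_chi r (int (Suc n)) - (- 1) ^ n * int k) \<subseteq> \<pp>"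
proof -
  interpret cring R by (rule R(1))
  interpret P: primeideal \<pp> R using p by (simp add: Spec_def)
  let ?T = "diff_hom n" and ?n = "rk (Suc n)" and ?l = "rk n"
  let ?L = "ring_at R \<pp>" and ?N = "module_at R M \<pp>" and ?S = "carrier R - \<pp>"
  let ?\<phi> = "\<lambda>\<qq> a. ring_frac R (carrier R - \<qq>) a \<one>"
  note T = diff_hom[of n] and loc = localized_resolution[OF p]
  have \<phi>: "?\<phi> \<pp> \<in> Ring.ring_hom R ?L" using loc(4) by (simp add: is_localization_def)
  have \<phi>': "?\<phi> \<qq> \<in> Ring.ring_hom R (ring_at R \<qq>)" if "\<qq> \<in> minimal_primes R" for \<qq>
    using localized_resolution(4)[of \<qq>] that by (simp add: is_localization_def minimal_primes_def)
  obtain \<qq> where q: "\<qq> \<in> minimal_primes R" "\<qq> \<subseteq> \<pp>" using minimal_prime_below[OF R(2) p] by blast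
  \<comment> \<open>The size of the minors is an integer expression in general. Being a rank at a
    minimal prime, it is a natural number here.\<close>
  define m where "m = rank_at R (ring_at R \<qq>) (?\<phi> \<qq>) ?n ?l ?T"
  have m: "int m = fitting_chi r (int (Suc n)) - (- 1) ^ n * int k"
    unfolding m_def by (rule rank_at_minimal_prime[OF q(1)])
  have mq: "rank_at R (ring_at R \<qq>') (?\<phi> \<qq>') ?n ?l ?T = m" if "\<qq>' \<in> minimal_primes R" for \<qq>'
    using rank_at_minimal_prime[OF that, of n] m by simp
  have minor_in: "minor R ?n ?T j f g \<in> carrier R" if "f \<in> {..<j} \<rightarrow> {..<?l}" for j f g
    unfolding minor_def using module_hom_in[OF T std_basis_in[OF R(1)]] that
    by (intro ring_det_closed[OF R(1)]) (auto simp: carrier_std_free)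
  \<comment> \<open>Every minimal prime gives the same rank \<open>m\<close>, so a minor of size m +
    1 lies in all of them and is zero in the reduced ring. Using only the one \<qq> below \<pp>
    would not suffice.\<close>
  have zero: "minor R ?n ?T (Suc m) f g = \<zero>" if fg: "selection (Suc m) ?l f" "selection (Suc m) ?n g" for f g
  proof (rule reduced_zero_if_in_minimal_primes[OF R])
    show c: "minor R ?n ?T (Suc m) f g \<in> carrier R" using fg(1) by (intro minor_in) (auto simp: selection_def)
    fix \<qq>' assume q': "\<qq>' \<in> minimal_primes R"
    have "?\<phi> \<qq>' (minor R ?n ?T (Suc m) f g) = \<zero>\<^bsub>ring_at R \<qq>'\<^esub>"
      by (rule rank_at_via_minors(2)[OF R(1) field_ring_at_minimal_prime(1)[OF R q'] \<phi>'[OF q'] T _ fg]) (simp only: mq[OF q'] lessI)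
    then show "minor R ?n ?T (Suc m) f g \<in> \<qq>'" using field_ring_at_minimal_prime(2)[OF R q' c] by simp
  qed
  show ?thesis
  proof
    assume "proj_dim ?L ?N < enat (Suc n)"
    then obtain P :: "nat \<Rightarrow> (('a \<times> 'a) set, nat \<times> ('b \<times> 'a) set \<times> ('a \<times> 'a) set \<Rightarrow> ('a \<times> 'a) set) module" and d e
      where P: "projective_resolution ?L ?N P d e" "\<And>i. Suc n \<le> i \<Longrightarrow> carrier (P i) = {\<zero>\<^bsub>P i\<^esub>}"
      by (rule proj_dim_lessE) (rule that)
    obtain h where h: "h \<in> module_hom ?L (std_free ?L ?l) (std_free ?L ?n)"
      "\<And>y. y \<in> carrier (std_free ?L ?n) \<Longrightarrow> mat_change R ?L (?\<phi> \<pp>) ?n ?l ?T (h (mat_change R ?L (?\<phi> \<pp>) ?n ?l ?T y))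
        = mat_change R ?L (?\<phi> \<pp>) ?n ?l ?T y"
      using generalized_inverse_of_differential[OF loc(6) P(1) loc(5) P(2)[OF order_refl]] by blast
    \<comment> \<open>The inverse found over R_p is brought down to \<open>R\<close>, from where it
      can be mapped to the residue field as well as to the localization at \<qq>.\<close>
    obtain s H where s: "s \<in> ?S" and H: "H \<in> module_hom R (std_free R ?l) (std_free R ?n)"
      and THT: "\<And>x. x \<in> carrier (std_free R ?n) \<Longrightarrow> ?T (H (?T x)) = s \<odot>\<^bsub>std_free R ?l\<^esub> ?T x"
      using descend_generalized_inverse[OF loc(1,2,4) T h] by blast
    note res_field = residue_field[OF p]
    let ?r = "rank_at R (residue_field R \<pp>) (residue_map R \<pp>) ?n ?l ?T"
    \<comment> \<open>The kernel of the map to R_q is \<qq>, that of the map to the residue field is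
      \<pp>; the inclusion of primes is all that \<open>rank_at_constant\<close> needs.\<close>
    have ker: "residue_map R \<pp> a = \<zero>\<^bsub>residue_field R \<pp>\<^esub>" if "a \<in> carrier R" "?\<phi> \<qq> a = \<zero>\<^bsub>ring_at R \<qq>\<^esub>" for a
      using that field_ring_at_minimal_prime(2)[OF R q(1), of a] res_field(3)[of a] q(2) by auto
    note fields = field_ring_at_minimal_prime(1)[OF R q(1)] \<phi>'[OF q(1)] res_field(1,2)
    have "residue_map R \<pp> s \<noteq> \<zero>\<^bsub>residue_field R \<pp>\<^esub>" using s res_field(3)[of s] by simp
    then have "?r = m"
      unfolding m_def using s by (intro rank_at_constant[OF R(1) fields ker T H _ _ THT, symmetric]) auto
    then obtain f g where fg: "selection m ?l f" "selection m ?n g"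
      "residue_map R \<pp> (minor R ?n ?T m f g) \<noteq> \<zero>\<^bsub>residue_field R \<pp>\<^esub>"
      using rank_at_via_minors(1)[OF R(1) res_field(1,2) T] by auto
    have "minor R ?n ?T m f g \<in> carrier R" using fg(1) by (intro minor_in) (auto simp: selection_def)
    then have "minor R ?n ?T m f g \<notin> \<pp>" using fg(3) res_field(3) by blast
    then show "\<not> minors_ideal R ?n ?l ?T (fitting_chi r (int (Suc n)) - (- 1) ^ n * int k) \<subseteq> \<pp>"
      unfolding m[symmetric] minors_ideal_subset_iff[OF p T] using fg(1,2) by blast
  next
    assume "\<not> minors_ideal R ?n ?l ?T (fitting_chi r (int (Suc n)) - (- 1) ^ n * int k) \<subseteq> \<pp>"
    then obtain f g where fg: "selection m ?l f" "selection m ?n g" "minor R ?n ?T m f g \<notin> \<pp>"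
      unfolding m[symmetric] minors_ideal_subset_iff[OF p T] by blast
    have f: "f \<in> {..<m} \<rightarrow> {..<?l}" and g: "g \<in> {..<m} \<rightarrow> {..<?n}" using fg by (auto simp: selection_def)
    let ?D = "mat_change R ?L (?\<phi> \<pp>) ?n ?l ?T"
    have D: "?D \<in> module_hom ?L (std_free ?L ?n) (std_free ?L ?l)" by (rule mat_change_hom[OF R(1) loc(2) \<phi> T])
    note mc = minor_base_change[OF R(1) loc(2) \<phi> T]
    have unit: "minor ?L ?n ?D m f g \<in> Units ?L"
      unfolding mc[OF f g] using loc(4) minor_in[OF f] fg(3) by (simp add: is_localization_def)
    have bordered: "\<forall>i<?l. \<forall>j<?n. minor ?L ?n ?D (Suc m)
        (\<lambda>a. if a < m then f a else i) (\<lambda>b. if b < m then g b else j) = \<zero>\<^bsub>?L\<^esub>"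
    \<comment> \<open>Bordering may break the order of the indices or repeat one, so vanishing is
      extended from increasing selections over \<open>R\<close> before passing to the
      localization.\<close>
    proof (intro allI impI)
      fix i j assume ij: "i < ?l" "j < ?n"
      let ?f = "\<lambda>a. if a < m then f a else i" and ?g = "\<lambda>b. if b < m then g b else j"
      have fg': "?f \<in> {..<Suc m} \<rightarrow> {..<?l}" "?g \<in> {..<Suc m} \<rightarrow> {..<?n}" using f g ij by auto
      have "minor R ?n ?T (Suc m) ?f ?g = \<zero>"
        by (rule minor_all_selections[OF R(1) T fg' zero])
      then show "minor ?L ?n ?D (Suc m) ?f ?g = \<zero>\<^bsub>?L\<^esub>"
        unfolding mc[OF fg'] using ring_hom_zero[OF \<phi>] R(1) loc(2) by (simp add: cring_def)
    qed
    obtain t \<iota> where \<iota>: "\<iota> \<in> module_hom ?L (std_free ?L t) (std_free ?L ?l)"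
      "\<And>x. x \<in> carrier (std_free ?L t) \<Longrightarrow> \<iota> x \<in> ?D ` carrier (std_free ?L ?n) \<Longrightarrow> x = \<zero>\<^bsub>std_free ?L t\<^esub>"
      "\<And>y. y \<in> carrier (std_free ?L ?l) \<Longrightarrow> \<exists>w\<in>?D ` carrier (std_free ?L ?n). \<exists>z\<in>carrier (std_free ?L t).
         y = w \<oplus>\<^bsub>std_free ?L ?l\<^esub> \<iota> z"
      using complement_of_minor[OF loc(2) D fg(1,2) unit bordered] by blast
    obtain r' d e where res': "projective_resolution ?L ?N (\<lambda>i. std_free ?L (r' i)) d e" and r': "\<forall>i>n. r' i = 0"
      using truncate_resolution[OF loc(2,3,5,6) \<iota>] by blast
    have "proj_dim ?L ?N \<le> enat n" using r' by (intro proj_dim_le[OF loc(2,3) res']) blast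
    then show "proj_dim ?L ?N < enat (Suc n)" by (rule order_le_less_trans) simp
  qed
qed

end

text \<open>The upper index is \<open>d\<close>, one more than in the English heading, so the minors
  are those of the differential leaving degree d. With d - 1 the case d = 1 would involve minors of
  size -k, hence the unit ideal and an empty locus, although projective dimension at least one does
  occur. The bound on \<open>d\<close> excludes the analogous degenerate case d = 0.\<close>

theorem corollary4p9:
  fixes R :: "'a ring" and M :: "('a, 'b) module" and k :: nat and d :: int
  assumes "cring R" and "noetherian_ring R" and "reduced_ring R"
    and "module R M" and "finite_module R M" and "has_rank R M k"
    and "d \<ge> 1"
  shows "zero_locus R (higher_fitting R M d ((- 1) ^ nat (d - 1) * int k)) =
    {\<pp> \<in> Spec R. proj_dim (ring_at R \<pp>) (module_at R M \<pp>) \<ge> enat (nat d)}"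
proof -
  obtain r \<delta> \<epsilon> where res: "finite_free_resolution R M r \<delta> \<epsilon>"
    and fitt: "\<And>i m. higher_fitting R M i m = minors_ideal R (r i) (r (i - 1)) (\<delta> i) (fitting_chi r i - m)"
    using higher_fitting_eq[OF assms(1,2,4,5)] by blast
  interpret resolved_module R M k r \<delta> \<epsilon>
    by (rule resolved_module.intro) fact+
  define n where "n = nat (d - 1)"
  \<comment> \<open>The differential leaving degree d is number n = d - 1 in the numbering of
    \<open>diff_hom\<close>, and being at least d is the negation of being below n + 1.\<close>
  have d: "d = int (Suc n)" "d - 1 = int n" "nat d = Suc n" using assms(7) by (simp_all add: n_def)
  have "higher_fitting R M d ((- 1) ^ nat (d - 1) * int k)
      = minors_ideal R (rk (Suc n)) (rk n) (diff_hom n) (fitting_chi r (int (Suc n)) - (- 1) ^ n * int k)"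
    unfolding fitt d(2) by (simp only: d(1) nat_int)
  then show ?thesis
    unfolding zero_locus_def d(3) using proj_dim_less_iff[of _ n] by (auto simp flip: not_less)
qed

end
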